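(* The 2-category $\mathsf{CatBaseComp}$ of categories with a base of computability has all limits of pie weight.
   Context: A base of computability $B$ in a category $\mathscr C$ is a family $(B(a))_{a\in\mathscr C_0}$, where each $B(a)$ is a subclass of the class $\mathrm{Mon}(-,a)$ of monomorphisms with codomain $a$, such that: (Base1) $1_a\in B(a)$ for every object $a$; (Base2) for all objects $a,b$, all $i\colon s\to a$ in $B(a)$, all $j\colon t\to b$ in $B(b)$, and all $f\colon s\to b$, there is a pullback of $j$ along $f$, with projection $f^*j\colon j^*(s)\to s$, such that $i\circ f^*j\in B(a)$. If $C$, $D$ are bases of computability in $\mathscr C$, $\mathscr D$, a computability transfer $F\colon(\mathscr C,C)\to(\mathscr D,D)$ is a functor $F\colon\mathscr C\to\mathscr D$ such that $F(i)\in D(F(a))$ for all objects $a$ and all $i\in C(a)$, and $F$ preserves all pullbacks occurring in (Base2) (i.e. pullbacks of arrows $j\in C(b)$ along arbitrary arrows $f\colon s\to b$). $\mathsf{CatBaseComp}$ is the 2-category with objects the pairs $(\mathscr C,C)$ of a category with a base of computability, 1-cells the computability transfers, and 2-cells the natural transformations between the underlying functors. Weighted limits: for 2-categories $\mathscr K,\mathscr W$ and 2-functors $F\colon\mathscr W\to\mathbf{Cat}$ (the weight) and $G\colon\mathscr W\to\mathscr K$, an $F$-weighted limit of $G$ is an object $\lim^F G$ of $\mathscr K$ with isomorphisms of categories $\mathscr K(K,\lim^FG)\cong[\mathscr W,\mathbf{Cat}](F,\mathscr K(K,G(-)))$, natural in $K\in\mathscr K$. Pie limits (Power and Robinson): these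 are the weighted limits, over small $\mathscr W$, constructible from (set-indexed, 2-categorical) products, inserters and equifiers. A weight $F\colon\mathscr W\to\mathbf{Cat}$ with $\mathscr W$ small is a pie weight if and only if the functor $\mathscr W_0\to\mathbf{Set}$, $w\mapsto \mathrm{ob}(F(w))$, on the underlying ordinary category $\mathscr W_0$ of $\mathscr W$ is a coproduct of representable functors. *)

theory Defs
  imports Main "HOL-Library.FuncSet"
begin

section \<open>Categories, functors and natural transformations\<close>

text \<open>
  Categories are given by carrier sets of objects and arrows inside two types. The values of the
  structure maps outside the carriers are irrelevant. \<open>Comp C g f\<close> is the composite of \<open>f\<close>
  followed by \<open>g\<close>.
\<close>

record ('o, 'a) cat =
  Obj :: "'o set"
  Arr :: "'a set"
  Dom :: "'a \<Rightarrow> 'o"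
  Cod :: "'a \<Rightarrow> 'o"
  Ident :: "'o \<Rightarrow> 'a"
  Comp :: "'a \<Rightarrow> 'a \<Rightarrow> 'a"

definition category :: "('o, 'a) cat \<Rightarrow> bool" where
  "category C \<longleftrightarrow>
     (\<forall>f\<in>Arr C. Dom C f \<in> Obj C \<and> Cod C f \<in> Obj C) \<and>
     (\<forall>a\<in>Obj C. Ident C a \<in> Arr C \<and> Dom C (Ident C a) = a \<and> Cod C (Ident C a) = a) \<and>
     (\<forall>f\<in>Arr C. \<forall>g\<in>Arr C. Cod C f = Dom C g \<longrightarrow>
        Comp C g f \<in> Arr C \<and> Dom C (Comp C g f) = Dom C f \<and> Cod C (Comp C g f) = Cod C g) \<and>
     (\<forall>f\<in>Arr C. Comp C f (Ident C (Dom C f)) = f \<and> Comp C (Ident C (Cod C f)) f = f) \<and>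
     (\<forall>f\<in>Arr C. \<forall>g\<in>Arr C. \<forall>h\<in>Arr C. Cod C f = Dom C g \<longrightarrow> Cod C g = Dom C h \<longrightarrow>
        Comp C h (Comp C g f) = Comp C (Comp C h g) f)"

definition prod_cat :: "('o, 'a) cat \<Rightarrow> ('p, 'b) cat \<Rightarrow> ('o \<times> 'p, 'a \<times> 'b) cat" where
  "prod_cat C D =
     \<lparr>Obj = Obj C \<times> Obj D, Arr = Arr C \<times> Arr D,
      Dom = (\<lambda>(f, g). (Dom C f, Dom D g)), Cod = (\<lambda>(f, g). (Cod C f, Cod D g)),
      Ident = (\<lambda>(a, b). (Ident C a, Ident D b)),
      Comp = (\<lambda>(f', g') (f, g). (Comp C f' f, Comp D g' g))\<rparr>"

text \<open>
  Functors and natural transformations are extensional (\<open>undefined\<close> outside the carriers), so that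
  HOL equality is equality of functors and of transformations.
\<close>

record ('o, 'a, 'p, 'b) functr =
  OMap :: "'o \<Rightarrow> 'p"
  AMap :: "'a \<Rightarrow> 'b"

definition is_functor :: "('o, 'a) cat \<Rightarrow> ('p, 'b) cat \<Rightarrow> ('o, 'a, 'p, 'b) functr \<Rightarrow> bool" where
  "is_functor C D F \<longleftrightarrow>
     OMap F \<in> Obj C \<rightarrow>\<^sub>E Obj D \<and> AMap F \<in> Arr C \<rightarrow>\<^sub>E Arr D \<and>
     (\<forall>f\<in>Arr C. Dom D (AMap F f) = OMap F (Dom C f) \<and> Cod D (AMap F f) = OMap F (Cod C f)) \<and>
     (\<forall>a\<in>Obj C. AMap F (Ident C a) = Ident D (OMap F a)) \<and>
     (\<forall>f\<in>Arr C. \<forall>g\<in>Arr C. Cod C f = Dom C g \<longrightarrow>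
        AMap F (Comp C g f) = Comp D (AMap F g) (AMap F f))"

definition functor_id :: "('o, 'a) cat \<Rightarrow> ('o, 'a, 'o, 'a) functr" where
  "functor_id C = \<lparr>OMap = (\<lambda>a\<in>Obj C. a), AMap = (\<lambda>f\<in>Arr C. f)\<rparr>"

definition functor_comp :: "('o, 'a) cat \<Rightarrow> ('p, 'b, 'q, 'c) functr \<Rightarrow> ('o, 'a, 'p, 'b) functr
    \<Rightarrow> ('o, 'a, 'q, 'c) functr" where
  "functor_comp C G F =
     \<lparr>OMap = (\<lambda>a\<in>Obj C. OMap G (OMap F a)), AMap = (\<lambda>f\<in>Arr C. AMap G (AMap F f))\<rparr>"

definition is_cat_iso :: "('o, 'a) cat \<Rightarrow> ('p, 'b) cat \<Rightarrow> ('o, 'a, 'p, 'b) functr \<Rightarrow> bool" where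
  "is_cat_iso C D F \<longleftrightarrow> is_functor C D F \<and>
     (\<exists>G. is_functor D C G \<and> functor_comp C G F = functor_id C \<and> functor_comp D F G = functor_id D)"

text \<open>
  A cell carries its source, its target and its family of components; it is used both for natural
  transformations and for modifications.
\<close>

record ('f, 'c) cell =
  Src :: 'f
  Tgt :: 'f
  Cmp :: 'c

type_synonym ('o, 'a, 'p, 'b) nt = "(('o, 'a, 'p, 'b) functr, 'o \<Rightarrow> 'b) cell"

definition is_nt :: "('o, 'a) cat \<Rightarrow> ('p, 'b) cat \<Rightarrow> ('o, 'a, 'p, 'b) nt \<Rightarrow> bool" where
  "is_nt C D t \<longleftrightarrow>
     is_functor C D (Src t) \<and> is_functor C D (Tgt t) \<and> Cmp t \<in> Obj C \<rightarrow>\<^sub>E Arr D \<and>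
     (\<forall>a\<in>Obj C. Dom D (Cmp t a) = OMap (Src t) a \<and> Cod D (Cmp t a) = OMap (Tgt t) a) \<and>
     (\<forall>f\<in>Arr C. Comp D (Cmp t (Cod C f)) (AMap (Src t) f) =
                 Comp D (AMap (Tgt t) f) (Cmp t (Dom C f)))"

definition nt_id :: "('o, 'a) cat \<Rightarrow> ('p, 'b) cat \<Rightarrow> ('o, 'a, 'p, 'b) functr
    \<Rightarrow> ('o, 'a, 'p, 'b) nt" where
  "nt_id C D F = \<lparr>Src = F, Tgt = F, Cmp = (\<lambda>a\<in>Obj C. Ident D (OMap F a))\<rparr>"

definition vcomp :: "('o, 'a) cat \<Rightarrow> ('p, 'b) cat \<Rightarrow> ('o, 'a, 'p, 'b) nt
    \<Rightarrow> ('o, 'a, 'p, 'b) nt \<Rightarrow> ('o, 'a, 'p, 'b) nt" where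
  "vcomp C D t s =
     \<lparr>Src = Src s, Tgt = Tgt t, Cmp = (\<lambda>a\<in>Obj C. Comp D (Cmp t a) (Cmp s a))\<rparr>"

text \<open>
  Horizontal composite of \<open>s\<close>, between functors from \<open>C\<close> to some \<open>D\<close>, followed by \<open>t\<close>, between
  functors from \<open>D\<close> to \<open>E\<close>.
\<close>

definition hcomp :: "('o, 'a) cat \<Rightarrow> ('q, 'c) cat \<Rightarrow> ('p, 'b, 'q, 'c) nt
    \<Rightarrow> ('o, 'a, 'p, 'b) nt \<Rightarrow> ('o, 'a, 'q, 'c) nt" where
  "hcomp C E t s =
     \<lparr>Src = functor_comp C (Src t) (Src s), Tgt = functor_comp C (Tgt t) (Tgt s),
      Cmp = (\<lambda>a\<in>Obj C. Comp E (Cmp t (OMap (Tgt s) a)) (AMap (Src t) (Cmp s a)))\<rparr>"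

definition functor_cat :: "('o, 'a) cat \<Rightarrow> ('p, 'b) cat
    \<Rightarrow> (('o, 'a, 'p, 'b) functr, ('o, 'a, 'p, 'b) nt) cat" where
  "functor_cat C D =
     \<lparr>Obj = {F. is_functor C D F}, Arr = {t. is_nt C D t}, Dom = Src, Cod = Tgt,
      Ident = nt_id C D, Comp = vcomp C D\<rparr>"

definition full_subcat :: "('o, 'a) cat \<Rightarrow> 'o set \<Rightarrow> ('o, 'a) cat" where
  "full_subcat C S = C\<lparr>Obj := Obj C \<inter> S, Arr := {f \<in> Arr C. Dom C f \<in> S \<and> Cod C f \<in> S}\<rparr>"


section \<open>2-categories, 2-functors and 2-natural transformations\<close>

text \<open>
  2-categories are strict, presented as categories enriched in categories. Hom-categories of
  different pairs of objects need not be disjoint, which is why composition is indexed by three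
  objects: \<open>HComp K A B C\<close> composes \<open>(g, f)\<close> with \<open>f\<close> from \<open>A\<close> to \<open>B\<close> and \<open>g\<close> from \<open>B\<close> to \<open>C\<close>.
\<close>

record ('o, 'a, 'c) two_cat =
  Ob :: "'o set"
  Hom :: "'o \<Rightarrow> 'o \<Rightarrow> ('a, 'c) cat"
  HComp :: "'o \<Rightarrow> 'o \<Rightarrow> 'o \<Rightarrow> ('a \<times> 'a, 'c \<times> 'c, 'a, 'c) functr"
  HId :: "'o \<Rightarrow> 'a"

abbreviation comp1 :: "('o, 'a, 'c) two_cat \<Rightarrow> 'o \<Rightarrow> 'o \<Rightarrow> 'o \<Rightarrow> 'a \<Rightarrow> 'a \<Rightarrow> 'a" where
  "comp1 K A B C g f \<equiv> OMap (HComp K A B C) (g, f)"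

abbreviation comp2 :: "('o, 'a, 'c) two_cat \<Rightarrow> 'o \<Rightarrow> 'o \<Rightarrow> 'o \<Rightarrow> 'c \<Rightarrow> 'c \<Rightarrow> 'c" where
  "comp2 K A B C t s \<equiv> AMap (HComp K A B C) (t, s)"

definition two_category :: "('o, 'a, 'c) two_cat \<Rightarrow> bool" where
  "two_category K \<longleftrightarrow>
     (\<forall>A\<in>Ob K. \<forall>B\<in>Ob K. category (Hom K A B)) \<and>
     (\<forall>A\<in>Ob K. HId K A \<in> Obj (Hom K A A)) \<and>
     (\<forall>A\<in>Ob K. \<forall>B\<in>Ob K. \<forall>C\<in>Ob K.
        is_functor (prod_cat (Hom K B C) (Hom K A B)) (Hom K A C) (HComp K A B C)) \<and>
     (\<forall>A\<in>Ob K. \<forall>B\<in>Ob K.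
        (\<forall>f\<in>Obj (Hom K A B).
           comp1 K A A B f (HId K A) = f \<and> comp1 K A B B (HId K B) f = f) \<and>
        (\<forall>s\<in>Arr (Hom K A B).
           comp2 K A A B s (Ident (Hom K A A) (HId K A)) = s \<and>
           comp2 K A B B (Ident (Hom K B B) (HId K B)) s = s)) \<and>
     (\<forall>A\<in>Ob K. \<forall>B\<in>Ob K. \<forall>C\<in>Ob K. \<forall>D\<in>Ob K.
        (\<forall>f\<in>Obj (Hom K A B). \<forall>g\<in>Obj (Hom K B C). \<forall>h\<in>Obj (Hom K C D).
           comp1 K A C D h (comp1 K A B C g f) = comp1 K A B D (comp1 K B C D h g) f) \<and>
        (\<forall>r\<in>Arr (Hom K A B). \<forall>s\<in>Arr (Hom K B C). \<forall>t\<in>Arr (Hom K C D).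
           comp2 K A C D t (comp2 K A B C s r) = comp2 K A B D (comp2 K B C D t s) r))"

text \<open>The opposite 2-category reverses 1-cells but not 2-cells.\<close>

definition op_two_cat :: "('o, 'a, 'c) two_cat \<Rightarrow> ('o, 'a, 'c) two_cat" where
  "op_two_cat K =
     \<lparr>Ob = Ob K, Hom = (\<lambda>A B. Hom K B A),
      HComp = (\<lambda>A B C.
        \<lparr>OMap = (\<lambda>(g, f)\<in>Obj (Hom K C B) \<times> Obj (Hom K B A). comp1 K C B A f g),
         AMap = (\<lambda>(t, s)\<in>Arr (Hom K C B) \<times> Arr (Hom K B A). comp2 K C B A s t)\<rparr>),
      HId = HId K\<rparr>"

record ('o, 'a, 'c, 'p, 'b, 'd) two_functr =
  TObj :: "'o \<Rightarrow> 'p"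
  THom :: "'o \<Rightarrow> 'o \<Rightarrow> ('a, 'c, 'b, 'd) functr"

abbreviation T1 :: "('o, 'a, 'c, 'p, 'b, 'd) two_functr \<Rightarrow> 'o \<Rightarrow> 'o \<Rightarrow> 'a \<Rightarrow> 'b" where
  "T1 T A B \<equiv> OMap (THom T A B)"

abbreviation T2 :: "('o, 'a, 'c, 'p, 'b, 'd) two_functr \<Rightarrow> 'o \<Rightarrow> 'o \<Rightarrow> 'c \<Rightarrow> 'd" where
  "T2 T A B \<equiv> AMap (THom T A B)"

definition two_functor :: "('o, 'a, 'c) two_cat \<Rightarrow> ('p, 'b, 'd) two_cat
    \<Rightarrow> ('o, 'a, 'c, 'p, 'b, 'd) two_functr \<Rightarrow> bool" where
  "two_functor K L T \<longleftrightarrow>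
     (\<forall>A\<in>Ob K. TObj T A \<in> Ob L) \<and>
     (\<forall>A\<in>Ob K. \<forall>B\<in>Ob K. is_functor (Hom K A B) (Hom L (TObj T A) (TObj T B)) (THom T A B)) \<and>
     (\<forall>A\<in>Ob K. T1 T A A (HId K A) = HId L (TObj T A)) \<and>
     (\<forall>A\<in>Ob K. \<forall>B\<in>Ob K. \<forall>C\<in>Ob K.
        (\<forall>f\<in>Obj (Hom K A B). \<forall>g\<in>Obj (Hom K B C).
           T1 T A C (comp1 K A B C g f) =
             comp1 L (TObj T A) (TObj T B) (TObj T C) (T1 T B C g) (T1 T A B f)) \<and>
        (\<forall>s\<in>Arr (Hom K A B). \<forall>t\<in>Arr (Hom K B C).
           T2 T A C (comp2 K A B C t s) =
             comp2 L (TObj T A) (TObj T B) (TObj T C) (T2 T B C t) (T2 T A B s)))"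

definition two_functor_comp :: "('o, 'a, 'c) two_cat \<Rightarrow> ('p, 'b, 'd, 'q, 'e, 'g) two_functr
    \<Rightarrow> ('o, 'a, 'c, 'p, 'b, 'd) two_functr \<Rightarrow> ('o, 'a, 'c, 'q, 'e, 'g) two_functr" where
  "two_functor_comp K S T =
     \<lparr>TObj = (\<lambda>A. TObj S (TObj T A)),
      THom = (\<lambda>A B. functor_comp (Hom K A B) (THom S (TObj T A) (TObj T B)) (THom T A B))\<rparr>"

text \<open>A 2-functor with values in a 2-category of categories.\<close>

type_synonym ('o, 'a, 'c, 'p, 'b) cat_valued =
  "('o, 'a, 'c, ('p, 'b) cat, ('p, 'b, 'p, 'b) functr, ('p, 'b, 'p, 'b) nt) two_functr"

text \<open>The representable 2-functor \<open>K(A, -)\<close>.\<close>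

definition representable :: "('o, 'a, 'c) two_cat \<Rightarrow> 'o \<Rightarrow> ('o, 'a, 'c, 'a, 'c) cat_valued" where
  "representable K A =
     \<lparr>TObj = (\<lambda>X. Hom K A X),
      THom = (\<lambda>X Y.
        let post = (\<lambda>g. \<lparr>OMap = (\<lambda>x\<in>Obj (Hom K A X). comp1 K A X Y g x),
                         AMap = (\<lambda>r\<in>Arr (Hom K A X). comp2 K A X Y (Ident (Hom K X Y) g) r)\<rparr>)
        in \<lparr>OMap = (\<lambda>g\<in>Obj (Hom K X Y). post g),
            AMap = (\<lambda>t\<in>Arr (Hom K X Y).
              \<lparr>Src = post (Dom (Hom K X Y) t), Tgt = post (Cod (Hom K X Y) t),
               Cmp = (\<lambda>x\<in>Obj (Hom K A X). comp2 K A X Y t (Ident (Hom K A X) x))\<rparr>)\<rparr>)\<rparr>"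

text \<open>
  The category of 2-natural transformations and modifications between 2-functors \<open>F\<close> and \<open>H\<close> from
  \<open>W\<close> to the 2-category of categories. The values of \<open>F\<close> and of \<open>H\<close> may live in different types.
\<close>

definition two_nat :: "('o, 'a, 'c) two_cat \<Rightarrow> ('o, 'a, 'c, 'p, 'b) cat_valued
    \<Rightarrow> ('o, 'a, 'c, 'q, 'd) cat_valued \<Rightarrow> ('o \<Rightarrow> ('p, 'b, 'q, 'd) functr) \<Rightarrow> bool" where
  "two_nat W F H \<alpha> \<longleftrightarrow>
     \<alpha> \<in> extensional (Ob W) \<and>
     (\<forall>v\<in>Ob W. is_functor (TObj F v) (TObj H v) (\<alpha> v)) \<and>
     (\<forall>v\<in>Ob W. \<forall>w\<in>Ob W.
        (\<forall>u\<in>Obj (Hom W v w).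
           functor_comp (TObj F v) (T1 H v w u) (\<alpha> v) = functor_comp (TObj F v) (\<alpha> w) (T1 F v w u)) \<and>
        (\<forall>s\<in>Arr (Hom W v w).
           hcomp (TObj F v) (TObj H w) (T2 H v w s) (nt_id (TObj F v) (TObj H v) (\<alpha> v)) =
           hcomp (TObj F v) (TObj H w) (nt_id (TObj F w) (TObj H w) (\<alpha> w)) (T2 F v w s)))"

type_synonym ('o, 'p, 'b, 'q, 'd) modif =
  "('o \<Rightarrow> ('p, 'b, 'q, 'd) functr, 'o \<Rightarrow> ('p, 'b, 'q, 'd) nt) cell"

definition modification :: "('o, 'a, 'c) two_cat \<Rightarrow> ('o, 'a, 'c, 'p, 'b) cat_valued
    \<Rightarrow> ('o, 'a, 'c, 'q, 'd) cat_valued \<Rightarrow> ('o, 'p, 'b, 'q, 'd) modif \<Rightarrow> bool" where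
  "modification W F H m \<longleftrightarrow>
     two_nat W F H (Src m) \<and> two_nat W F H (Tgt m) \<and>
     Cmp m \<in> extensional (Ob W) \<and>
     (\<forall>v\<in>Ob W. is_nt (TObj F v) (TObj H v) (Cmp m v) \<and>
        Src (Cmp m v) = Src m v \<and> Tgt (Cmp m v) = Tgt m v) \<and>
     (\<forall>v\<in>Ob W. \<forall>w\<in>Ob W. \<forall>u\<in>Obj (Hom W v w).
        hcomp (TObj F v) (TObj H w) (nt_id (TObj H v) (TObj H w) (T1 H v w u)) (Cmp m v) =
        hcomp (TObj F v) (TObj H w) (Cmp m w) (nt_id (TObj F v) (TObj F w) (T1 F v w u)))"

definition two_nat_cat :: "('o, 'a, 'c) two_cat \<Rightarrow> ('o, 'a, 'c, 'p, 'b) cat_valued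
    \<Rightarrow> ('o, 'a, 'c, 'q, 'd) cat_valued
    \<Rightarrow> ('o \<Rightarrow> ('p, 'b, 'q, 'd) functr, ('o, 'p, 'b, 'q, 'd) modif) cat" where
  "two_nat_cat W F H =
     \<lparr>Obj = {\<alpha>. two_nat W F H \<alpha>}, Arr = {m. modification W F H m}, Dom = Src, Cod = Tgt,
      Ident = (\<lambda>\<alpha>. \<lparr>Src = \<alpha>, Tgt = \<alpha>, Cmp = (\<lambda>w\<in>Ob W. nt_id (TObj F w) (TObj H w) (\<alpha> w))\<rparr>),
      Comp = (\<lambda>n m. \<lparr>Src = Src m, Tgt = Tgt n,
                     Cmp = (\<lambda>w\<in>Ob W. vcomp (TObj F w) (TObj H w) (Cmp n w) (Cmp m w))\<rparr>)\<rparr>"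


section \<open>Weighted limits\<close>

text \<open>
  \<open>cones K W F G\<close> is the 2-functor \<open>A \<mapsto> [W, Cat](F, K(A, G -))\<close> on the opposite of \<open>K\<close>. Its
  action on 1-cells and 2-cells of \<open>K\<close> is pasting with the action of \<open>K(-, G w)\<close>, which is a
  representable 2-functor of the opposite of \<open>K\<close>.
\<close>

definition cones :: "('o, 'a, 'c) two_cat \<Rightarrow> ('w, 'x, 'y) two_cat
    \<Rightarrow> ('w, 'x, 'y, 'p, 'b) cat_valued \<Rightarrow> ('w, 'x, 'y, 'o, 'a, 'c) two_functr
    \<Rightarrow> ('o, 'a, 'c, 'w \<Rightarrow> ('p, 'b, 'a, 'c) functr, ('w, 'p, 'b, 'a, 'c) modif) cat_valued" where
  "cones K W F G =
     (let cone = (\<lambda>A. two_nat_cat W F (two_functor_comp W (representable K A) G));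
          contra = (\<lambda>w. representable (op_two_cat K) (TObj G w));
          pre = (\<lambda>A B h \<alpha>. \<lambda>w\<in>Ob W. functor_comp (TObj F w) (T1 (contra w) A B h) (\<alpha> w));
          on1 = (\<lambda>A B h.
            \<lparr>OMap = (\<lambda>\<alpha>\<in>Obj (cone A). pre A B h \<alpha>),
             AMap = (\<lambda>m\<in>Arr (cone A).
               \<lparr>Src = pre A B h (Src m), Tgt = pre A B h (Tgt m),
                Cmp = (\<lambda>w\<in>Ob W. hcomp (TObj F w) (Hom K B (TObj G w))
                  (nt_id (Hom K A (TObj G w)) (Hom K B (TObj G w)) (T1 (contra w) A B h))
                  (Cmp m w))\<rparr>)\<rparr>);
          on2 = (\<lambda>A B t.
            \<lparr>Src = on1 A B (Dom (Hom K B A) t), Tgt = on1 A B (Cod (Hom K B A) t),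
             Cmp = (\<lambda>\<alpha>\<in>Obj (cone A).
               \<lparr>Src = pre A B (Dom (Hom K B A) t) \<alpha>, Tgt = pre A B (Cod (Hom K B A) t) \<alpha>,
                Cmp = (\<lambda>w\<in>Ob W. hcomp (TObj F w) (Hom K B (TObj G w))
                  (T2 (contra w) A B t)
                  (nt_id (TObj F w) (Hom K A (TObj G w)) (\<alpha> w)))\<rparr>)\<rparr>)
      in \<lparr>TObj = cone,
          THom = (\<lambda>A B. \<lparr>OMap = (\<lambda>h\<in>Obj (Hom K B A). on1 A B h),
                         AMap = (\<lambda>t\<in>Arr (Hom K B A). on2 A B t)\<rparr>)\<rparr>)"

text \<open>
  \<open>L\<close> is an \<open>F\<close>-weighted limit of \<open>G\<close>, exhibited by the isomorphisms of categories
  \<open>\<phi> A : K(A, L) \<cong> [W, Cat](F, K(A, G -))\<close>, 2-natural in \<open>A\<close>.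
\<close>

definition is_weighted_limit :: "('o, 'a, 'c) two_cat \<Rightarrow> ('w, 'x, 'y) two_cat
    \<Rightarrow> ('w, 'x, 'y, 'p, 'b) cat_valued \<Rightarrow> ('w, 'x, 'y, 'o, 'a, 'c) two_functr \<Rightarrow> 'o
    \<Rightarrow> ('o \<Rightarrow> ('a, 'c, 'w \<Rightarrow> ('p, 'b, 'a, 'c) functr, ('w, 'p, 'b, 'a, 'c) modif) functr)
    \<Rightarrow> bool" where
  "is_weighted_limit K W F G L \<phi> \<longleftrightarrow>
     L \<in> Ob K \<and>
     (\<forall>A\<in>Ob K. is_cat_iso (Hom K A L) (two_nat_cat W F (two_functor_comp W (representable K A) G)) (\<phi> A)) \<and>
     two_nat (op_two_cat K) (representable (op_two_cat K) L) (cones K W F G) \<phi>"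

definition has_weighted_limits :: "('o, 'a, 'c) two_cat \<Rightarrow> ('w, 'x, 'y) two_cat
    \<Rightarrow> ('w, 'x, 'y, 'p, 'b) cat_valued \<Rightarrow> bool" where
  "has_weighted_limits K W F \<longleftrightarrow>
     (\<forall>G. two_functor W K G \<longrightarrow> (\<exists>L \<phi>. is_weighted_limit K W F G L \<phi>))"


section \<open>Smallness and pie weights\<close>

text \<open>
  The type \<open>'u\<close> plays the role of the universe: the elements of (possibly large) categories are
  taken from it. A set is small relative to \<open>'u\<close> if families of elements of \<open>'u\<close> indexed by it
  can be coded by elements of \<open>'u\<close>, that is, if \<open>|'u| ^ |A| \<le> |'u|\<close>. When \<open>'u\<close> is a Grothendieck
  universe, of inaccessible cardinality \<open>\<kappa>\<close>, this says exactly that \<open>|A| < \<kappa>\<close>.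
\<close>

definition small :: "'u itself \<Rightarrow> 'a set \<Rightarrow> bool" where
  "small U A \<longleftrightarrow> (\<exists>code :: ('a \<Rightarrow> 'u) \<Rightarrow> 'u. inj_on code (A \<rightarrow>\<^sub>E UNIV))"

definition small_cat :: "'u itself \<Rightarrow> ('o, 'a) cat \<Rightarrow> bool" where
  "small_cat U C \<longleftrightarrow> small U (Obj C) \<and> small U (Arr C)"

definition small_two_cat :: "'u itself \<Rightarrow> ('o, 'a, 'c) two_cat \<Rightarrow> bool" where
  "small_two_cat U W \<longleftrightarrow> small U (Ob W) \<and> (\<forall>v\<in>Ob W. \<forall>w\<in>Ob W. small_cat U (Hom W v w))"

definition cat_hcomp :: "('o, 'a) cat \<Rightarrow> ('q, 'c) cat
    \<Rightarrow> (('p, 'b, 'q, 'c) functr, ('p, 'b, 'q, 'c) nt) cat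
    \<Rightarrow> (('o, 'a, 'p, 'b) functr, ('o, 'a, 'p, 'b) nt) cat
    \<Rightarrow> (('p, 'b, 'q, 'c) functr \<times> ('o, 'a, 'p, 'b) functr,
        ('p, 'b, 'q, 'c) nt \<times> ('o, 'a, 'p, 'b) nt,
        ('o, 'a, 'q, 'c) functr, ('o, 'a, 'q, 'c) nt) functr" where
  "cat_hcomp C E X Y =
     \<lparr>OMap = (\<lambda>(G, F)\<in>Obj X \<times> Obj Y. functor_comp C G F),
      AMap = (\<lambda>(t, s)\<in>Arr X \<times> Arr Y. hcomp C E t s)\<rparr>"

definition Cat :: "'u itself
    \<Rightarrow> (('o, 'a) cat, ('o, 'a, 'o, 'a) functr, ('o, 'a, 'o, 'a) nt) two_cat" where
  "Cat U =
     \<lparr>Ob = {C. category C \<and> small_cat U C}, Hom = functor_cat,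
      HComp = (\<lambda>C D E. cat_hcomp C E (functor_cat D E) (functor_cat C D)),
      HId = functor_id\<rparr>"

text \<open>
  For a set-valued functor on the underlying ordinary category of \<open>W\<close>, given by its values \<open>P\<close> on
  objects and its action \<open>act\<close> on arrows: a natural bijection \<open>e\<close> from the coproduct over \<open>i \<in> I\<close>
  of the representables at \<open>r i\<close>. Taking \<open>I\<close> of the stated type loses no generality, since an
  index \<open>i\<close> is determined by \<open>r i\<close> and the image under \<open>e\<close> of the identity of \<open>r i\<close>.
\<close>

definition coproduct_of_representables :: "('w, 'x, 'y) two_cat \<Rightarrow> ('w \<Rightarrow> 's set)
    \<Rightarrow> ('w \<Rightarrow> 'w \<Rightarrow> 'x \<Rightarrow> 's \<Rightarrow> 's) \<Rightarrow> bool" where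
  "coproduct_of_representables W P act \<longleftrightarrow>
     (\<exists>(I :: ('w \<times> 's) set) r e.
        (\<forall>i\<in>I. r i \<in> Ob W) \<and>
        (\<forall>w\<in>Ob W. bij_betw (e w) (SIGMA i:I. Obj (Hom W (r i) w)) (P w)) \<and>
        (\<forall>v\<in>Ob W. \<forall>w\<in>Ob W. \<forall>u\<in>Obj (Hom W v w). \<forall>i\<in>I. \<forall>f\<in>Obj (Hom W (r i) v).
           e w (i, comp1 W (r i) v w u f) = act v w u (e v (i, f))))"

text \<open>
  Pie weights are taken in the form of Power and Robinson's characterization of the weights whose
  limits are constructible from products, inserters and equifiers.
\<close>

definition pie_weight :: "'u itself \<Rightarrow> ('w, 'x, 'y) two_cat
    \<Rightarrow> ('w, 'x, 'y, 'p, 'b) cat_valued \<Rightarrow> bool" where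
  "pie_weight U W F \<longleftrightarrow>
     two_category W \<and> small_two_cat U W \<and> two_functor W (Cat U) F \<and>
     coproduct_of_representables W (\<lambda>w. Obj (TObj F w)) (\<lambda>v w u. OMap (T1 F v w u))"


section \<open>Categories with a base of computability\<close>

definition is_mono :: "('o, 'a) cat \<Rightarrow> 'a \<Rightarrow> bool" where
  "is_mono C i \<longleftrightarrow> i \<in> Arr C \<and>
     (\<forall>f\<in>Arr C. \<forall>g\<in>Arr C. Dom C f = Dom C g \<longrightarrow> Cod C f = Dom C i \<longrightarrow> Cod C g = Dom C i \<longrightarrow>
        Comp C i f = Comp C i g \<longrightarrow> f = g)"

text \<open>\<open>p\<close> and \<open>q\<close> form a pullback of \<open>j\<close> along \<open>f\<close>, where \<open>p\<close> is opposite to \<open>j\<close>.\<close>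

definition is_pullback :: "('o, 'a) cat \<Rightarrow> 'a \<Rightarrow> 'a \<Rightarrow> 'a \<Rightarrow> 'a \<Rightarrow> bool" where
  "is_pullback C j f p q \<longleftrightarrow>
     j \<in> Arr C \<and> f \<in> Arr C \<and> p \<in> Arr C \<and> q \<in> Arr C \<and>
     Cod C j = Cod C f \<and> Cod C p = Dom C f \<and> Cod C q = Dom C j \<and> Dom C p = Dom C q \<and>
     Comp C f p = Comp C j q \<and>
     (\<forall>x\<in>Arr C. \<forall>y\<in>Arr C.
        Dom C x = Dom C y \<longrightarrow> Cod C x = Dom C f \<longrightarrow> Cod C y = Dom C j \<longrightarrow>
        Comp C f x = Comp C j y \<longrightarrow>
        (\<exists>!z. z \<in> Arr C \<and> Dom C z = Dom C x \<and> Cod C z = Dom C p \<and>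
              Comp C p z = x \<and> Comp C q z = y))"

definition base_of_computability :: "('o, 'a) cat \<Rightarrow> ('o \<Rightarrow> 'a set) \<Rightarrow> bool" where
  "base_of_computability C B \<longleftrightarrow>
     (\<forall>a\<in>Obj C. \<forall>i\<in>B a. is_mono C i \<and> Cod C i = a) \<and>
     (\<forall>a\<in>Obj C. Ident C a \<in> B a) \<and>
     (\<forall>a\<in>Obj C. \<forall>b\<in>Obj C. \<forall>i\<in>B a. \<forall>j\<in>B b. \<forall>f\<in>Arr C.
        Dom C f = Dom C i \<longrightarrow> Cod C f = b \<longrightarrow>
        (\<exists>p q. is_pullback C j f p q \<and> Comp C i p \<in> B a))"

definition computability_transfer :: "('o, 'a) cat \<times> ('o \<Rightarrow> 'a set)
    \<Rightarrow> ('p, 'b) cat \<times> ('p \<Rightarrow> 'b set) \<Rightarrow> ('o, 'a, 'p, 'b) functr \<Rightarrow> bool" where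
  "computability_transfer X Y F \<longleftrightarrow>
     is_functor (fst X) (fst Y) F \<and>
     (\<forall>a\<in>Obj (fst X). \<forall>i\<in>snd X a. AMap F i \<in> snd Y (OMap F a)) \<and>
     (\<forall>b\<in>Obj (fst X). \<forall>j\<in>snd X b. \<forall>f p q.
        is_pullback (fst X) j f p q \<longrightarrow>
        is_pullback (fst Y) (AMap F j) (AMap F f) (AMap F p) (AMap F q))"

text \<open>
  Objects and arrows are both taken from the universe \<open>'u\<close>, without any restriction on the size of
  the carriers or of the hom-sets, so that large categories and proper classes \<open>B a\<close> are allowed.
\<close>

type_synonym 'u cat_base = "('u, 'u) cat \<times> ('u \<Rightarrow> 'u set)"

definition transfer_cat :: "'u cat_base \<Rightarrow> 'u cat_base
    \<Rightarrow> (('u, 'u, 'u, 'u) functr, ('u, 'u, 'u, 'u) nt) cat" where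
  "transfer_cat X Y = full_subcat (functor_cat (fst X) (fst Y)) {F. computability_transfer X Y F}"

definition CatBaseComp ::
    "('u cat_base, ('u, 'u, 'u, 'u) functr, ('u, 'u, 'u, 'u) nt) two_cat" where
  "CatBaseComp =
     \<lparr>Ob = {(C, B). category C \<and> base_of_computability C B},
      Hom = transfer_cat,
      HComp = (\<lambda>X Y Z. cat_hcomp (fst X) (fst Z) (transfer_cat Y Z) (transfer_cat X Y)),
      HId = (\<lambda>X. functor_id (fst X))\<rparr>"


section \<open>\<open>CatBaseComp\<close> is a 2-category\<close>

lemma catD:
  assumes "category C"
  shows "f \<in> Arr C \<Longrightarrow> Dom C f \<in> Obj C" "f \<in> Arr C \<Longrightarrow> Cod C f \<in> Obj C"
    "a \<in> Obj C \<Longrightarrow> Ident C a \<in> Arr C" "a \<in> Obj C \<Longrightarrow> Dom C (Ident C a) = a" "a \<in> Obj C \<Longrightarrow> Cod C (Ident C a) = a"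
    "f \<in> Arr C \<Longrightarrow> g \<in> Arr C \<Longrightarrow> Cod C f = Dom C g \<Longrightarrow> Comp C g f \<in> Arr C"
    "f \<in> Arr C \<Longrightarrow> g \<in> Arr C \<Longrightarrow> Cod C f = Dom C g \<Longrightarrow> Dom C (Comp C g f) = Dom C f"
    "f \<in> Arr C \<Longrightarrow> g \<in> Arr C \<Longrightarrow> Cod C f = Dom C g \<Longrightarrow> Cod C (Comp C g f) = Cod C g"
    "f \<in> Arr C \<Longrightarrow> Dom C f = a \<Longrightarrow> Comp C f (Ident C a) = f"
    "f \<in> Arr C \<Longrightarrow> Cod C f = a \<Longrightarrow> Comp C (Ident C a) f = f"
  using assms unfolding category_def by blast+

lemma cat_assoc:
  assumes "category C" "f \<in> Arr C" "g \<in> Arr C" "h \<in> Arr C" "Cod C f = Dom C g" "Cod C g = Dom C h"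
  shows "Comp C h (Comp C g f) = Comp C (Comp C h g) f"
  using assms unfolding category_def by blast

lemma functorD:
  assumes "is_functor C D F"
  shows "a \<in> Obj C \<Longrightarrow> OMap F a \<in> Obj D" "f \<in> Arr C \<Longrightarrow> AMap F f \<in> Arr D"
   "f \<in> Arr C \<Longrightarrow> Dom D (AMap F f) = OMap F (Dom C f)" "f \<in> Arr C \<Longrightarrow> Cod D (AMap F f) = OMap F (Cod C f)"
   "a \<in> Obj C \<Longrightarrow> AMap F (Ident C a) = Ident D (OMap F a)"
   "f \<in> Arr C \<Longrightarrow> g \<in> Arr C \<Longrightarrow> Cod C f = Dom C g \<Longrightarrow> AMap F (Comp C g f) = Comp D (AMap F g) (AMap F f)"
   "OMap F \<in> extensional (Obj C)" "AMap F \<in> extensional (Arr C)"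
  using assms unfolding is_functor_def PiE_def by auto

lemma ntD:
  assumes "is_nt C D t"
  shows "is_functor C D (Src t)" "is_functor C D (Tgt t)" "a \<in> Obj C \<Longrightarrow> Cmp t a \<in> Arr D"
   "a \<in> Obj C \<Longrightarrow> Dom D (Cmp t a) = OMap (Src t) a" "a \<in> Obj C \<Longrightarrow> Cod D (Cmp t a) = OMap (Tgt t) a"
   "f \<in> Arr C \<Longrightarrow> Comp D (Cmp t (Cod C f)) (AMap (Src t) f) = Comp D (AMap (Tgt t) f) (Cmp t (Dom C f))"
   "Cmp t \<in> extensional (Obj C)"
  using assms unfolding is_nt_def PiE_def by auto

lemma functor_fid: "category C \<Longrightarrow> is_functor C C (functor_id C)"
  unfolding is_functor_def functor_id_def by (auto simp: catD)

lemma functor_fcomp: "category C \<Longrightarrow> is_functor C D F \<Longrightarrow> is_functor D E G \<Longrightarrow> is_functor C E (functor_comp C G F)"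
  unfolding is_functor_def[of C E] unfolding functor_comp_def by (auto simp: catD functorD)

lemma nt_nt_id: "category C \<Longrightarrow> category D \<Longrightarrow> is_functor C D F \<Longrightarrow> is_nt C D (nt_id C D F)"
  unfolding is_nt_def nt_id_def by (auto simp: catD functorD)

lemma nt_vcomp: assumes C: "category C" "category D" and s: "is_nt C D s" and t: "is_nt C D t" and e: "Tgt s = Src t"
  shows "is_nt C D (vcomp C D t s)"
proof -
  { fix f assume f: "f \<in> Arr C"
    let ?a = "Dom C f" let ?b = "Cod C f"
    have ab: "?a \<in> Obj C" "?b \<in> Obj C" using f C by (auto simp: catD)
    note [simp] = catD[OF C(1)] catD[OF C(2)] functorD[OF ntD(1)[OF s]] functorD[OF ntD(1)[OF t]] functorD[OF ntD(2)[OF t]] ntD[OF s] ntD[OF t] e f ab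
    have "Comp D (Comp D (Cmp t ?b) (Cmp s ?b)) (AMap (Src s) f) = Comp D (Cmp t ?b) (Comp D (Cmp s ?b) (AMap (Src s) f))"
      by (rule cat_assoc[OF C(2), symmetric]) auto
    also have "\<dots> = Comp D (Cmp t ?b) (Comp D (AMap (Src t) f) (Cmp s ?a))" by simp
    also have "\<dots> = Comp D (Comp D (Cmp t ?b) (AMap (Src t) f)) (Cmp s ?a)"
      by (rule cat_assoc[OF C(2)]) auto
    also have "\<dots> = Comp D (Comp D (AMap (Tgt t) f) (Cmp t ?a)) (Cmp s ?a)" by simp
    also have "\<dots> = Comp D (AMap (Tgt t) f) (Comp D (Cmp t ?a) (Cmp s ?a))"
      by (rule cat_assoc[OF C(2), symmetric]) auto
    finally have "Comp D (Comp D (Cmp t ?b) (Cmp s ?b)) (AMap (Src s) f) = Comp D (AMap (Tgt t) f) (Comp D (Cmp t ?a) (Cmp s ?a))" . }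
  note 1 = this
  show ?thesis using 1 C s t e unfolding is_nt_def[of C D "vcomp C D t s"] unfolding vcomp_def
    by (auto simp: catD ntD)
qed

lemma nt_hcomp: assumes C: "category C" "category D" "category E" and s: "is_nt C D s" and t: "is_nt D E t"
  shows "is_nt C E (hcomp C E t s)"
proof -
  { fix f assume f: "f \<in> Arr C"
    let ?a = "Dom C f" let ?b = "Cod C f"
    let ?G = "Src t" let ?G' = "Tgt t" let ?F = "Src s" let ?F' = "Tgt s"
    have ab: "?a \<in> Obj C" "?b \<in> Obj C" using f C by (auto simp: catD)
    note [simp] = catD[OF C(1)] catD[OF C(2)] catD[OF C(3)] functorD[OF ntD(1)[OF s]] functorD[OF ntD(2)[OF s]] functorD[OF ntD(1)[OF t]] functorD[OF ntD(2)[OF t]] ntD[OF s] ntD[OF t] f ab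
    have "Comp E (Comp E (Cmp t (OMap ?F' ?b)) (AMap ?G (Cmp s ?b))) (AMap ?G (AMap ?F f))
      = Comp E (Cmp t (OMap ?F' ?b)) (Comp E (AMap ?G (Cmp s ?b)) (AMap ?G (AMap ?F f)))"
      by (rule cat_assoc[OF C(3), symmetric]) auto
    also have "\<dots> = Comp E (Cmp t (OMap ?F' ?b)) (AMap ?G (Comp D (Cmp s ?b) (AMap ?F f)))"
      by (simp del: ntD(6)[OF s])
    also have "\<dots> = Comp E (Cmp t (OMap ?F' ?b)) (AMap ?G (Comp D (AMap ?F' f) (Cmp s ?a)))" by simp
    also have "\<dots> = Comp E (Cmp t (OMap ?F' ?b)) (Comp E (AMap ?G (AMap ?F' f)) (AMap ?G (Cmp s ?a)))" by simp
    also have "\<dots> = Comp E (Comp E (Cmp t (Cod D (AMap ?F' f))) (AMap ?G (AMap ?F' f))) (AMap ?G (Cmp s ?a))"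
      by (subst cat_assoc[OF C(3)]) auto
    also have "\<dots> = Comp E (Comp E (AMap ?G' (AMap ?F' f)) (Cmp t (OMap ?F' ?a))) (AMap ?G (Cmp s ?a))"
      by (subst ntD(6)[OF t]) auto
    also have "\<dots> = Comp E (AMap ?G' (AMap ?F' f)) (Comp E (Cmp t (OMap ?F' ?a)) (AMap ?G (Cmp s ?a)))"
      by (rule cat_assoc[OF C(3), symmetric]) auto
    finally have "Comp E (Comp E (Cmp t (OMap ?F' ?b)) (AMap ?G (Cmp s ?b))) (AMap ?G (AMap ?F f)) = 
       Comp E (AMap ?G' (AMap ?F' f)) (Comp E (Cmp t (OMap ?F' ?a)) (AMap ?G (Cmp s ?a)))" . }
  note 1 = this
  note [simp] = catD[OF C(1)] catD[OF C(2)] catD[OF C(3)] functorD[OF ntD(1)[OF s]] functorD[OF ntD(2)[OF s]] functorD[OF ntD(1)[OF t]] functorD[OF ntD(2)[OF t]] ntD[OF s] ntD[OF t]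
  have 2: "is_functor C E (functor_comp C (Src t) (Src s))" "is_functor C E (functor_comp C (Tgt t) (Tgt s))"
    by (rule functor_fcomp[OF C(1), of D]; simp)+
  show ?thesis using 1 2 unfolding is_nt_def[of C E "hcomp C E t s"] unfolding hcomp_def
    by (auto simp: functor_comp_def)
qed

lemma category_functor_cat: assumes C: "category C" "category D" shows "category (functor_cat C D)"
proof -
  have id1: "vcomp C D f (nt_id C D (Src f)) = f" "vcomp C D (nt_id C D (Tgt f)) f = f" if "is_nt C D f" for f
    using that C unfolding vcomp_def nt_id_def
    by (auto intro!: cell.equality extensionalityI[of _ "Obj C"] simp: ntD catD)
  have as: "vcomp C D h (vcomp C D g f) = vcomp C D (vcomp C D h g) f"
    if "is_nt C D f" "is_nt C D g" "is_nt C D h" "Tgt f = Src g" "Tgt g = Src h" for f g h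
    using that C unfolding vcomp_def 
    by (auto intro!: cell.equality restrict_ext cat_assoc simp: ntD)
  show ?thesis
    unfolding category_def functor_cat_def
    by (auto simp: C id1 as nt_nt_id nt_vcomp ntD) (auto simp: nt_id_def vcomp_def)
qed

lemma category_full: "category C \<Longrightarrow> category (full_subcat C S)"
  unfolding category_def full_subcat_def by auto

lemma interchange:
  assumes C: "category C" "category D" "category E"
   and s: "is_nt C D s" "is_nt C D s'" "Tgt s = Src s'" and t: "is_nt D E t" "is_nt D E t'" "Tgt t = Src t'"
  shows "hcomp C E (vcomp D E t' t) (vcomp C D s' s) = vcomp C E (hcomp C E t' s') (hcomp C E t s)"
proof -
  note [simp] = catD[OF C(1)] catD[OF C(2)] catD[OF C(3)] functorD[OF ntD(1)[OF s(1)]] functorD[OF ntD(2)[OF s(1)]] functorD[OF ntD(1)[OF t(1)]] functorD[OF ntD(2)[OF t(1)]] ntD[OF s(1)] ntD[OF t(1)]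
     functorD[OF ntD(1)[OF s(2)]] functorD[OF ntD(2)[OF s(2)]] functorD[OF ntD(1)[OF t(2)]] functorD[OF ntD(2)[OF t(2)]] ntD[OF s(2)] ntD[OF t(2)] s(3) t(3)
  { fix a assume a: "a \<in> Obj C"
    note [simp] = a
    let ?b = "OMap (Tgt s') a"
    let ?x = "AMap (Src t) (Cmp s a)" let ?y = "AMap (Src t) (Cmp s' a)"
    let ?y' = "AMap (Src t') (Cmp s' a)" let ?u = "Cmp t ?b" let ?v = "Cmp t' ?b" let ?u' = "Cmp t (OMap (Src s') a)"
    have 0: "Comp E ?u ?y = Comp E ?y' ?u'"
      using ntD(6)[OF t(1), of "Cmp s' a"] by simp
    have "Comp E (Comp E ?v ?u) (Comp E ?y ?x) = Comp E ?v (Comp E (Comp E ?u ?y) ?x)"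
      by (simp add: cat_assoc[OF C(3)] del: 0)
    also have "\<dots> = Comp E ?v (Comp E (Comp E ?y' ?u') ?x)" unfolding 0 ..
    also have "\<dots> = Comp E (Comp E ?v ?y') (Comp E ?u' ?x)" by (simp add: cat_assoc[OF C(3)])
    finally have "Comp E (Comp E ?v ?u) (Comp E ?y ?x) = Comp E (Comp E ?v ?y') (Comp E ?u' ?x)" . }
  then show ?thesis unfolding hcomp_def vcomp_def
    by (auto intro!: cell.equality restrict_ext)
qed

lemma fcomp_id: assumes "category C" "category D" "is_functor C D F"
  shows "functor_comp C F (functor_id C) = F" "functor_comp C (functor_id D) F = F"
  using assms unfolding functor_comp_def functor_id_def
  by (auto intro!: functr.equality extensionalityI[of _ "Obj C"] extensionalityI[of _ "Arr C"] simp: functorD)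

lemma fcomp_assoc: assumes "category C" "is_functor C D F" 
  shows "functor_comp C H (functor_comp C G F) = functor_comp C (functor_comp D H G) F"
  using assms unfolding functor_comp_def by (auto intro!: functr.equality restrict_ext simp: functorD)

lemma hcomp_id: assumes C: "category C" "category D" "is_nt C D s"
  shows "hcomp C D s (nt_id C C (functor_id C)) = s" "hcomp C D (nt_id D D (functor_id D)) s = s"
proof -
  note [simp] = catD[OF C(1)] catD[OF C(2)] ntD[OF C(3)] functorD[OF ntD(1)[OF C(3)]] functorD[OF ntD(2)[OF C(3)]]
  show "hcomp C D s (nt_id C C (functor_id C)) = s" "hcomp C D (nt_id D D (functor_id D)) s = s"
  unfolding hcomp_def nt_id_def
  by (auto intro!: cell.equality extensionalityI[of _ "Obj C"] simp: fcomp_id C functor_id_def) (auto simp: fcomp_id[OF C(1,2), unfolded functor_id_def])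
qed

lemma hcomp_assoc: assumes C: "category A" "category B" "category C" "category D"
   and r: "is_nt A B r" and s: "is_nt B C s" and t: "is_nt C D t"
  shows "hcomp A D t (hcomp A C s r) = hcomp A D (hcomp B D t s) r"
proof -
  note [simp] = catD[OF C(1)] catD[OF C(2)] catD[OF C(3)] catD[OF C(4)] ntD[OF r] ntD[OF s] ntD[OF t]
  functorD[OF ntD(1)[OF r]] functorD[OF ntD(2)[OF r]]
  functorD[OF ntD(1)[OF s]] functorD[OF ntD(2)[OF s]]
  functorD[OF ntD(1)[OF t]] functorD[OF ntD(2)[OF t]]
  have "Comp D (Cmp t (OMap (Tgt s) (OMap (Tgt r) a))) (AMap (Src t) (Comp C (Cmp s (OMap (Tgt r) a)) (AMap (Src s) (Cmp r a)))) =
     Comp D (Comp D (Cmp t (OMap (Tgt s) (OMap (Tgt r) a))) (AMap (Src t) (Cmp s (OMap (Tgt r) a)))) (AMap (Src t) (AMap (Src s) (Cmp r a)))"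
    if a: "a \<in> Obj A" for a
  proof -
    note [simp] = a
    have "AMap (Src t) (Comp C (Cmp s (OMap (Tgt r) a)) (AMap (Src s) (Cmp r a))) = Comp D (AMap (Src t) (Cmp s (OMap (Tgt r) a))) (AMap (Src t) (AMap (Src s) (Cmp r a)))"
      by simp
    then show ?thesis by (simp only:) (rule cat_assoc[OF C(4)], auto)
  qed
  then show ?thesis
    unfolding hcomp_def
    by (intro cell.equality) (simp_all add: fcomp_assoc[OF C(1), of B] functor_comp_def cong: restrict_cong)
qed

lemma hcomp_nt_id: assumes C: "category C" "category D" "category E" "is_functor C D F" "is_functor D E G"
  shows "hcomp C E (nt_id D E G) (nt_id C D F) = nt_id C E (functor_comp C G F)"
  using C unfolding hcomp_def nt_id_def by (auto intro!: cell.equality restrict_ext simp: functorD catD functor_comp_def)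

lemma transfer_fid:
  assumes X: "category (fst X)" "base_of_computability (fst X) (snd X)"
  shows "computability_transfer X X (functor_id (fst X))"
proof -
  have 4: "i \<in> Arr (fst X)" if "a \<in> Obj (fst X)" "i \<in> snd X a" for a i
    using assms(2) that unfolding base_of_computability_def is_mono_def by auto
  have 5: "j \<in> Arr C" "f \<in> Arr C" "p \<in> Arr C" "q \<in> Arr C" if "is_pullback C j f p q" for C :: "('x,'y) cat" and j f p q
    using that unfolding is_pullback_def by auto
  show ?thesis unfolding computability_transfer_def
    apply (intro conjI ballI allI impI)
    subgoal by (rule functor_fid[OF X(1)])
    subgoal for a i using 4[of a i] by (simp add: functor_id_def)
    subgoal for b j f p q using 5[of "fst X" j f p q] by (simp add: functor_id_def)
    done
qed

lemma transfer_fcomp: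
  assumes "category (fst X)" "base_of_computability (fst X) (snd X)"  "computability_transfer X Y F" "computability_transfer Y Z G"
  shows "computability_transfer X Z (functor_comp (fst X) G F)"
proof -
  have f: "is_functor (fst X) (fst Y) F" using assms by (auto simp: computability_transfer_def)
  have 1: "AMap G (AMap F i) \<in> snd Z (OMap G (OMap F a))" if "a \<in> Obj (fst X)" "i \<in> snd X a" for a i
    using that assms functorD[OF f] unfolding computability_transfer_def by blast
  have 2: "is_pullback (fst Z) (AMap G (AMap F j)) (AMap G (AMap F f)) (AMap G (AMap F p)) (AMap G (AMap F q))"
    if "b \<in> Obj (fst X)" "j \<in> snd X b" "is_pullback (fst X) j f p q" for b j f p q
    using that assms functorD[OF f] unfolding computability_transfer_def by blast
  have 3: "is_functor (fst X) (fst Z) (functor_comp (fst X) G F)" using assms functor_fcomp unfolding computability_transfer_def by blast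
  have 4: "i \<in> Arr (fst X)" if "a \<in> Obj (fst X)" "i \<in> snd X a" for a i
    using assms(2) that unfolding base_of_computability_def is_mono_def by auto
  have 5: "j \<in> Arr C" "f \<in> Arr C" "p \<in> Arr C" "q \<in> Arr C" if "is_pullback C j f p q" for C :: "('x,'y) cat" and j f p q
    using that unfolding is_pullback_def by auto
  show ?thesis unfolding computability_transfer_def[of X Z]
    apply (intro conjI ballI allI impI)
    subgoal by (rule 3)
    subgoal for a i using 1[of a i] 4[of a i] by (simp add: functor_comp_def)
    subgoal for b j f p q using 2[of b j f p q] 5[of "fst X" j f p q] by (simp add: functor_comp_def)
    done
qed

lemma two_category_CatBaseComp: "two_category (CatBaseComp :: ('u cat_base, _, _) two_cat)"
proof -
  let ?O = "{(C, B). category C \<and> base_of_computability C B} :: 'u cat_base set"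
  have c: "category (fst X)" "base_of_computability (fst X) (snd X)" if "X \<in> ?O" for X using that by auto
  have o: "Obj (transfer_cat X Y) = {F. computability_transfer X Y F}" for X Y :: "'u cat_base"
    unfolding transfer_cat_def full_subcat_def functor_cat_def by (auto simp: computability_transfer_def)
  have a: "Arr (transfer_cat X Y) = {t. is_nt (fst X) (fst Y) t \<and> computability_transfer X Y (Src t) \<and> computability_transfer X Y (Tgt t)}" for X Y :: "'u cat_base"
    unfolding transfer_cat_def full_subcat_def functor_cat_def by (auto simp: computability_transfer_def)
  have s: "Dom (transfer_cat X Y) = Src" "Cod (transfer_cat X Y) = Tgt" "Comp (transfer_cat X Y) = vcomp (fst X) (fst Y)"
    "Ident (transfer_cat X Y) = nt_id (fst X) (fst Y)" for X Y :: "'u cat_base"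
    unfolding transfer_cat_def full_subcat_def functor_cat_def by auto
  have f: "is_functor (fst X) (fst Y) F" if "computability_transfer X Y F" for X Y :: "'u cat_base" and F
    using that by (auto simp: computability_transfer_def)
  have h: "Src (hcomp C E t s) = functor_comp C (Src t) (Src s)" "Tgt (hcomp C E t s) = functor_comp C (Tgt t) (Tgt s)" for C E :: "('u,'u) cat" and s t
    by (auto simp: hcomp_def)
  have v: "Src (vcomp C E t s) = Src s" "Tgt (vcomp C E t s) = Tgt t" for C E :: "('u,'u) cat" and s t
    by (auto simp: vcomp_def)
  have i: "Src (nt_id C E F) = F" "Tgt (nt_id C E F) = F" for C E :: "('u,'u) cat" and F
    by (auto simp: nt_id_def)
  show ?thesis
    unfolding two_category_def CatBaseComp_def two_cat.simps
    apply (intro conjI ballI)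
    subgoal unfolding transfer_cat_def by (intro category_full category_functor_cat c)
    subgoal using o transfer_fid c by blast
    subgoal for X Y Z
    proof -
      assume X: "X \<in> ?O" and Y: "Y \<in> ?O" and Z: "Z \<in> ?O"
      note c' = c[OF X] c[OF Y] c[OF Z]
      have [simp]: "computability_transfer X Z (functor_comp (fst X) G F)" if "computability_transfer X Y F" "computability_transfer Y Z G" for F G
        using that c' transfer_fcomp by blast
      have [simp]: "is_nt (fst X) (fst Z) (hcomp (fst X) (fst Z) t s)" if "is_nt (fst X) (fst Y) s" "is_nt (fst Y) (fst Z) t" for t s
        using that c' nt_hcomp by blast
      have [simp]: "hcomp (fst X) (fst Z) (nt_id (fst Y) (fst Z) G) (nt_id (fst X) (fst Y) F) = nt_id (fst X) (fst Z) (functor_comp (fst X) G F)"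
        if "computability_transfer X Y F" "computability_transfer Y Z G" for F G
        using that c' hcomp_nt_id f by blast
      have [simp]: "hcomp (fst X) (fst Z) (vcomp (fst Y) (fst Z) t' t) (vcomp (fst X) (fst Y) s' s) = vcomp (fst X) (fst Z) (hcomp (fst X) (fst Z) t' s') (hcomp (fst X) (fst Z) t s)"
        if "is_nt (fst X) (fst Y) s" "is_nt (fst X) (fst Y) s'" "Tgt s = Src s'" "is_nt (fst Y) (fst Z) t" "is_nt (fst Y) (fst Z) t'" "Tgt t = Src t'" for s s' t t'
        using that c' interchange by blast
      show ?thesis
        unfolding is_functor_def cat_hcomp_def prod_cat_def
        using c' by (auto simp: o a s h i v f nt_nt_id nt_vcomp)
    qed
    subgoal for X Y F using c[of X] c[of Y] fcomp_id[of "fst X" "fst Y" F] f[of X Y F] by (simp add: cat_hcomp_def o transfer_fid)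
    subgoal for X Y F using c[of X] c[of Y] fcomp_id[of "fst X" "fst Y" F] f[of X Y F] by (simp add: cat_hcomp_def o transfer_fid)
    subgoal for X Y t using c[of X] c[of Y] hcomp_id[of "fst X" "fst Y" t] by (simp add: cat_hcomp_def o a s i transfer_fid nt_nt_id functor_fid)
    subgoal for X Y t using c[of X] c[of Y] hcomp_id[of "fst X" "fst Y" t] by (simp add: cat_hcomp_def o a s i transfer_fid nt_nt_id functor_fid)
    subgoal for X Y Z Z' f g h
      using c[of X] c[of Y] c[of Z] c[of Z'] transfer_fcomp[of X Y f Z g] transfer_fcomp[of Y Z g Z' h] fcomp_assoc[of "fst X" "fst Y" f h g] f[of X Y]
      by (simp add: cat_hcomp_def o)
    subgoal for X Y Z Z' r s t
      using c[of X] c[of Y] c[of Z] c[of Z']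
      transfer_fcomp[of X Y "Src r" Z "Src s"] transfer_fcomp[of Y Z "Src s" Z' "Src t"]
      transfer_fcomp[of X Y "Tgt r" Z "Tgt s"] transfer_fcomp[of Y Z "Tgt s" Z' "Tgt t"]
       nt_hcomp[of "fst X" "fst Y" "fst Z" r s] nt_hcomp[of "fst Y" "fst Z" "fst Z'" s t]
       hcomp_assoc[of "fst X" "fst Y" "fst Z" "fst Z'" r s t]
      by (simp add: cat_hcomp_def a h)
    done
qed

end

theory Submission
  imports Defs
begin

text \<open>
  The weighted limit of a diagram of categories \<open>H\<close> is the category of 2-natural transformations
  \<open>F \<Rightarrow> H\<close> and modifications; smallness of the weight allows to code it by elements of the universe.
  So the question is whether, for the diagram \<open>H\<close> underlying a diagram \<open>G\<close> of categories with
  a base, this category has a base that turns a functor into it into a transfer exactly when all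
  its components are transfers. The base is taken pointwise: a modification \<open>m\<close> belongs to it iff its
  component at every object \<open>x\<close> of every \<open>F w\<close> belongs to the base of \<open>G w\<close>.

  The hypothesis on the weight enters in the second base axiom. To pull back \<open>j\<close> along \<open>f\<close> one can
  choose a pullback in \<open>G w\<close> for every \<open>w\<close> and every object \<open>x\<close> of \<open>F w\<close>, but the domains of these
  pullbacks have to form a strictly 2-natural family. Since the objects of \<open>F\<close> form a coproduct of
  representables, every object is \<open>F u (y)\<close> for a unique generator \<open>y\<close> and a unique 1-cell \<open>u\<close>:
  one chooses pullbacks at the generators only, and transports them along the transfers \<open>G u\<close>,
  which preserve them (lemmas \<open>generators\<close>, \<open>pullbacks_along_weight\<close>). No choice is left on the arrows
  of \<open>F w\<close> and on 2-cells of the weight, where universality of the pullbacks gives existence,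
  functoriality and 2-naturality (\<open>lim_base_pullback\<close>).

  A commuting square of modifications that is a pullback at each \<open>(w, x)\<close> is a pullback
  (\<open>pullback_if_pointwise\<close>). Conversely, a pullback of an arrow of the base is isomorphic to one of
  the pullbacks just constructed, hence it is a pointwise pullback (\<open>pointwise_if_pullback\<close>). The
  second fact says that the projections of the limit are transfers, and the first one that a functor with
  transfers as components is a transfer (\<open>kappa_comp_surj\<close>).

  That the projections exhibit a weighted limit is then a statement about one cone: by the Yoneda
  lemma, composition with a fixed cone is 2-natural in the vertex, so only its bijectivity on 1-cells
  and on 2-cells has to be verified (\<open>weighted_limitI\<close>).
\<close>

section \<open>Pointwise description of 2-natural transformations and modifications\<close>

lemma whisker_right:
  assumes "category C" "category D" "category E" "is_functor C D F" "is_nt D E t"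
  shows "hcomp C E t (nt_id C D F) =
    \<lparr>Src = functor_comp C (Src t) F, Tgt = functor_comp C (Tgt t) F,
     Cmp = (\<lambda>a\<in>Obj C. Cmp t (OMap F a))\<rparr>"
proof -
  note [simp] = catD[OF assms(1)] catD[OF assms(2)] catD[OF assms(3)] functorD[OF assms(4)] ntD[OF assms(5)]
    functorD[OF ntD(1)[OF assms(5)]] functorD[OF ntD(2)[OF assms(5)]]
  show ?thesis
    unfolding hcomp_def nt_id_def by (auto intro!: cell.equality restrict_ext)
qed

lemma whisker_left:
  assumes "category C" "category D" "category E" "is_functor D E G" "is_nt C D s"
  shows "hcomp C E (nt_id D E G) s =
    \<lparr>Src = functor_comp C G (Src s), Tgt = functor_comp C G (Tgt s),
     Cmp = (\<lambda>a\<in>Obj C. AMap G (Cmp s a))\<rparr>"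
proof -
  note [simp] = catD[OF assms(1)] catD[OF assms(2)] catD[OF assms(3)] functorD[OF assms(4)] ntD[OF assms(5)]
    functorD[OF ntD(1)[OF assms(5)]] functorD[OF ntD(2)[OF assms(5)]]
  show ?thesis
    unfolding hcomp_def nt_id_def by (auto intro!: cell.equality restrict_ext)
qed

lemma fcomp_eq_iff:
  "functor_comp C G F = functor_comp C G' F' \<longleftrightarrow>
     (\<forall>a\<in>Obj C. OMap G (OMap F a) = OMap G' (OMap F' a)) \<and>
     (\<forall>f\<in>Arr C. AMap G (AMap F f) = AMap G' (AMap F' f))"
  unfolding functor_comp_def by (auto simp: restrict_def fun_eq_iff; metis)

lemma functor_eqI:
  assumes "is_functor C D F" "is_functor C D' F'"
    and "\<And>a. a \<in> Obj C \<Longrightarrow> OMap F a = OMap F' a" "\<And>f. f \<in> Arr C \<Longrightarrow> AMap F f = AMap F' f"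
  shows "F = F'"
  using assms functorD(7,8)[OF assms(1)] functorD(7,8)[OF assms(2)]
  by (auto intro!: functr.equality extensionalityI)

lemma nt_eqI:
  assumes "is_nt C D s" "is_nt C D' t" "Src s = Src t" "Tgt s = Tgt t"
    and "\<And>a. a \<in> Obj C \<Longrightarrow> Cmp s a = Cmp t a"
  shows "s = t"
  using assms ntD(7)[OF assms(1)] ntD(7)[OF assms(2)]
  by (auto intro!: cell.equality extensionalityI)

lemma cat_isoI:
  assumes C: "category C" and D: "category D" and F: "is_functor C D F"
    and bO: "bij_betw (OMap F) (Obj C) (Obj D)" and bA: "bij_betw (AMap F) (Arr C) (Arr D)"
  shows "is_cat_iso C D F"
proof -
  let ?o = "inv_into (Obj C) (OMap F)" and ?a = "inv_into (Arr C) (AMap F)"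
  define G where "G = \<lparr>OMap = restrict ?o (Obj D), AMap = restrict ?a (Arr D)\<rparr>"
  note iO = inj_onD[OF bij_betw_imp_inj_on[OF bO]] and iA = inj_onD[OF bij_betw_imp_inj_on[OF bA]]
  have o: "?o b \<in> Obj C" "OMap F (?o b) = b" if "b \<in> Obj D" for b
    using that bO by (metis bij_betw_imp_surj_on inv_into_into, metis bij_betw_inv_into_right)
  have a: "?a g \<in> Arr C" "AMap F (?a g) = g" if "g \<in> Arr D" for g
    using that bA by (metis bij_betw_imp_surj_on inv_into_into, metis bij_betw_inv_into_right)
  note [simp] = catD[OF C] catD[OF D] functorD[OF F] o a
  have d: "Dom C (?a g) = ?o (Dom D g)" "Cod C (?a g) = ?o (Cod D g)" if "g \<in> Arr D" for g
    using that functorD(3,4)[OF F, of "?a g"] by (auto intro!: iO)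
  have "is_functor D C G"
    unfolding is_functor_def G_def using d by (auto intro!: iA)
  moreover have "functor_comp C G F = functor_id C" "functor_comp D F G = functor_id D"
    unfolding functor_comp_def functor_id_def G_def
    using bO bA by (auto intro!: restrict_ext simp: bij_betw_inv_into_left)
  ultimately show ?thesis using F unfolding is_cat_iso_def by blast
qed

text \<open>
  The 2-category of all categories inside two given types. It serves as the common codomain of weights,
  representables and underlying diagrams, for which no bound on the size is available.
\<close>

definition CAT :: "(('o, 'a) cat, ('o, 'a, 'o, 'a) functr, ('o, 'a, 'o, 'a) nt) two_cat" where
  "CAT = \<lparr>Ob = {C. category C}, Hom = functor_cat,
      HComp = (\<lambda>C D E. cat_hcomp C E (functor_cat D E) (functor_cat C D)),
      HId = functor_id\<rparr>"

lemma two_functor_CatD: "two_functor W (Cat U) F \<Longrightarrow> two_functor W CAT F"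
  unfolding two_functor_def Cat_def CAT_def by auto

lemma functor_cat_simps [simp]:
  "Obj (functor_cat C D) = {F. is_functor C D F}" "Arr (functor_cat C D) = {t. is_nt C D t}"
  "Dom (functor_cat C D) = Src" "Cod (functor_cat C D) = Tgt" "Ident (functor_cat C D) = nt_id C D"
  "Comp (functor_cat C D) = vcomp C D"
  by (auto simp: functor_cat_def)

lemma prod_cat_simps [simp]:
  "Obj (prod_cat C D) = Obj C \<times> Obj D" "Arr (prod_cat C D) = Arr C \<times> Arr D"
  "Dom (prod_cat C D) (f, g) = (Dom C f, Dom D g)" "Cod (prod_cat C D) (f, g) = (Cod C f, Cod D g)"
  "Ident (prod_cat C D) (a, b) = (Ident C a, Ident D b)"
  "Comp (prod_cat C D) (f', g') (f, g) = (Comp C f' f, Comp D g' g)"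
  by (auto simp: prod_cat_def)

lemma two_catD:
  assumes "two_category K"
  shows "A \<in> Ob K \<Longrightarrow> B \<in> Ob K \<Longrightarrow> category (Hom K A B)"
    and "A \<in> Ob K \<Longrightarrow> HId K A \<in> Obj (Hom K A A)"
    and "A \<in> Ob K \<Longrightarrow> B \<in> Ob K \<Longrightarrow> C \<in> Ob K \<Longrightarrow> is_functor (prod_cat (Hom K B C) (Hom K A B)) (Hom K A C) (HComp K A B C)"
    and "A \<in> Ob K \<Longrightarrow> B \<in> Ob K \<Longrightarrow> f \<in> Obj (Hom K A B) \<Longrightarrow> comp1 K A A B f (HId K A) = f"
    and "A \<in> Ob K \<Longrightarrow> B \<in> Ob K \<Longrightarrow> f \<in> Obj (Hom K A B) \<Longrightarrow> comp1 K A B B (HId K B) f = f"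
    and "A \<in> Ob K \<Longrightarrow> B \<in> Ob K \<Longrightarrow> s \<in> Arr (Hom K A B) \<Longrightarrow> comp2 K A A B s (Ident (Hom K A A) (HId K A)) = s"
    and "A \<in> Ob K \<Longrightarrow> B \<in> Ob K \<Longrightarrow> s \<in> Arr (Hom K A B) \<Longrightarrow> comp2 K A B B (Ident (Hom K B B) (HId K B)) s = s"
  using assms unfolding two_category_def by blast+

lemma two_cat_assoc:
  assumes "two_category K" "A \<in> Ob K" "B \<in> Ob K" "C \<in> Ob K" "D \<in> Ob K"
  shows "f \<in> Obj (Hom K A B) \<Longrightarrow> g \<in> Obj (Hom K B C) \<Longrightarrow> h \<in> Obj (Hom K C D) \<Longrightarrow>
        comp1 K A C D h (comp1 K A B C g f) = comp1 K A B D (comp1 K B C D h g) f"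
    and "r \<in> Arr (Hom K A B) \<Longrightarrow> s \<in> Arr (Hom K B C) \<Longrightarrow> t \<in> Arr (Hom K C D) \<Longrightarrow>
           comp2 K A C D t (comp2 K A B C s r) = comp2 K A B D (comp2 K B C D t s) r"
  using assms unfolding two_category_def by blast+

lemma two_cat_hcomp:
  assumes K: "two_category K" and o: "A \<in> Ob K" "B \<in> Ob K" "C \<in> Ob K"
  shows "f \<in> Obj (Hom K A B) \<Longrightarrow> g \<in> Obj (Hom K B C) \<Longrightarrow> comp1 K A B C g f \<in> Obj (Hom K A C)"
    and "s \<in> Arr (Hom K A B) \<Longrightarrow> t \<in> Arr (Hom K B C) \<Longrightarrow> comp2 K A B C t s \<in> Arr (Hom K A C)"
    and "s \<in> Arr (Hom K A B) \<Longrightarrow> t \<in> Arr (Hom K B C) \<Longrightarrow>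
      Dom (Hom K A C) (comp2 K A B C t s) = comp1 K A B C (Dom (Hom K B C) t) (Dom (Hom K A B) s)"
    and "s \<in> Arr (Hom K A B) \<Longrightarrow> t \<in> Arr (Hom K B C) \<Longrightarrow>
      Cod (Hom K A C) (comp2 K A B C t s) = comp1 K A B C (Cod (Hom K B C) t) (Cod (Hom K A B) s)"
    and "f \<in> Obj (Hom K A B) \<Longrightarrow> g \<in> Obj (Hom K B C) \<Longrightarrow>
      comp2 K A B C (Ident (Hom K B C) g) (Ident (Hom K A B) f) = Ident (Hom K A C) (comp1 K A B C g f)"
    and "s \<in> Arr (Hom K A B) \<Longrightarrow> s' \<in> Arr (Hom K A B) \<Longrightarrow> t \<in> Arr (Hom K B C) \<Longrightarrow> t' \<in> Arr (Hom K B C) \<Longrightarrow>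
      Cod (Hom K A B) s = Dom (Hom K A B) s' \<Longrightarrow> Cod (Hom K B C) t = Dom (Hom K B C) t' \<Longrightarrow>
      comp2 K A B C (Comp (Hom K B C) t' t) (Comp (Hom K A B) s' s)
        = Comp (Hom K A C) (comp2 K A B C t' s') (comp2 K A B C t s)"
  using functorD(1)[OF two_catD(3)[OF K o], of "(g, f)"]
    functorD(2)[OF two_catD(3)[OF K o], of "(t, s)"]
    functorD(3)[OF two_catD(3)[OF K o], of "(t, s)"]
    functorD(4)[OF two_catD(3)[OF K o], of "(t, s)"]
    functorD(5)[OF two_catD(3)[OF K o], of "(g, f)"]
    functorD(6)[OF two_catD(3)[OF K o], of "(t, s)" "(t', s')"]
  by simp_all

lemma two_functorD:
  assumes "two_functor K L T"
  shows "A \<in> Ob K \<Longrightarrow> TObj T A \<in> Ob L"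
    and "A \<in> Ob K \<Longrightarrow> B \<in> Ob K \<Longrightarrow> is_functor (Hom K A B) (Hom L (TObj T A) (TObj T B)) (THom T A B)"
    and "A \<in> Ob K \<Longrightarrow> T1 T A A (HId K A) = HId L (TObj T A)"
    and "A \<in> Ob K \<Longrightarrow> B \<in> Ob K \<Longrightarrow> C \<in> Ob K \<Longrightarrow> f \<in> Obj (Hom K A B) \<Longrightarrow> g \<in> Obj (Hom K B C) \<Longrightarrow>
           T1 T A C (comp1 K A B C g f) =
             comp1 L (TObj T A) (TObj T B) (TObj T C) (T1 T B C g) (T1 T A B f)"
    and "A \<in> Ob K \<Longrightarrow> B \<in> Ob K \<Longrightarrow> C \<in> Ob K \<Longrightarrow> s \<in> Arr (Hom K A B) \<Longrightarrow> t \<in> Arr (Hom K B C) \<Longrightarrow>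
           T2 T A C (comp2 K A B C t s) =
             comp2 L (TObj T A) (TObj T B) (TObj T C) (T2 T B C t) (T2 T A B s)"
  using assms unfolding two_functor_def by blast+

lemma cat_valuedD:
  assumes T: "two_functor W CAT T"
  shows "v \<in> Ob W \<Longrightarrow> category (TObj T v)"
    and "v \<in> Ob W \<Longrightarrow> w \<in> Ob W \<Longrightarrow> u \<in> Obj (Hom W v w) \<Longrightarrow> is_functor (TObj T v) (TObj T w) (T1 T v w u)"
    and "v \<in> Ob W \<Longrightarrow> w \<in> Ob W \<Longrightarrow> s \<in> Arr (Hom W v w) \<Longrightarrow> is_nt (TObj T v) (TObj T w) (T2 T v w s)"
    and "v \<in> Ob W \<Longrightarrow> w \<in> Ob W \<Longrightarrow> s \<in> Arr (Hom W v w) \<Longrightarrow> Src (T2 T v w s) = T1 T v w (Dom (Hom W v w) s)"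
    and "v \<in> Ob W \<Longrightarrow> w \<in> Ob W \<Longrightarrow> s \<in> Arr (Hom W v w) \<Longrightarrow> Tgt (T2 T v w s) = T1 T v w (Cod (Hom W v w) s)"
    and "v \<in> Ob W \<Longrightarrow> T1 T v v (HId W v) = functor_id (TObj T v)"
    and "v \<in> Ob W \<Longrightarrow> w \<in> Ob W \<Longrightarrow> z \<in> Ob W \<Longrightarrow> f \<in> Obj (Hom W v w) \<Longrightarrow> g \<in> Obj (Hom W w z) \<Longrightarrow>
      T1 T v z (comp1 W v w z g f) = functor_comp (TObj T v) (T1 T w z g) (T1 T v w f)"
proof -
  note c = two_functorD[OF T, unfolded CAT_def two_cat.simps]
  show c1: "v \<in> Ob W \<Longrightarrow> category (TObj T v)" for v using c(1) by simp
  show c2: "v \<in> Ob W \<Longrightarrow> w \<in> Ob W \<Longrightarrow> u \<in> Obj (Hom W v w) \<Longrightarrow> is_functor (TObj T v) (TObj T w) (T1 T v w u)" for v w u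
    using functorD(1)[OF c(2)] by simp
  show "v \<in> Ob W \<Longrightarrow> w \<in> Ob W \<Longrightarrow> s \<in> Arr (Hom W v w) \<Longrightarrow> is_nt (TObj T v) (TObj T w) (T2 T v w s)"
    using functorD(2)[OF c(2)] by simp
  show "v \<in> Ob W \<Longrightarrow> w \<in> Ob W \<Longrightarrow> s \<in> Arr (Hom W v w) \<Longrightarrow> Src (T2 T v w s) = T1 T v w (Dom (Hom W v w) s)"
    using functorD(3)[OF c(2)] by simp
  show "v \<in> Ob W \<Longrightarrow> w \<in> Ob W \<Longrightarrow> s \<in> Arr (Hom W v w) \<Longrightarrow> Tgt (T2 T v w s) = T1 T v w (Cod (Hom W v w) s)"
    using functorD(4)[OF c(2)] by simp
  show "v \<in> Ob W \<Longrightarrow> T1 T v v (HId W v) = functor_id (TObj T v)"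
    using c(3) by simp
  show "v \<in> Ob W \<Longrightarrow> w \<in> Ob W \<Longrightarrow> z \<in> Ob W \<Longrightarrow> f \<in> Obj (Hom W v w) \<Longrightarrow> g \<in> Obj (Hom W w z) \<Longrightarrow>
      T1 T v z (comp1 W v w z g f) = functor_comp (TObj T v) (T1 T w z g) (T1 T v w f)"
    using c(4) c2 by (simp add: cat_hcomp_def)
qed

text \<open>
  The 2-naturality equations compare horizontal composites with identities. Such composites are
  whiskerings, so the equations may be tested one object and one arrow of the weight at a time.
\<close>

lemma two_nat_iff:
  assumes W: "two_category W" and F: "two_functor W CAT F" and H: "two_functor W CAT H"
  shows "two_nat W F H \<alpha> \<longleftrightarrow>
     \<alpha> \<in> extensional (Ob W) \<and>
     (\<forall>v\<in>Ob W. is_functor (TObj F v) (TObj H v) (\<alpha> v)) \<and>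
     (\<forall>v\<in>Ob W. \<forall>w\<in>Ob W.
        (\<forall>u\<in>Obj (Hom W v w).
          (\<forall>x\<in>Obj (TObj F v). OMap (T1 H v w u) (OMap (\<alpha> v) x) = OMap (\<alpha> w) (OMap (T1 F v w u) x)) \<and>
          (\<forall>f\<in>Arr (TObj F v). AMap (T1 H v w u) (AMap (\<alpha> v) f) = AMap (\<alpha> w) (AMap (T1 F v w u) f))) \<and>
        (\<forall>s\<in>Arr (Hom W v w). \<forall>x\<in>Obj (TObj F v).
           Cmp (T2 H v w s) (OMap (\<alpha> v) x) = AMap (\<alpha> w) (Cmp (T2 F v w s) x)))"
proof -
  note f = cat_valuedD[OF F] and h = cat_valuedD[OF H]
  have 1: "hcomp (TObj F v) (TObj H w) (T2 H v w s) (nt_id (TObj F v) (TObj H v) (\<alpha> v)) =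
           hcomp (TObj F v) (TObj H w) (nt_id (TObj F w) (TObj H w) (\<alpha> w)) (T2 F v w s) \<longleftrightarrow>
     (\<forall>x\<in>Obj (TObj F v). Cmp (T2 H v w s) (OMap (\<alpha> v) x) = AMap (\<alpha> w) (Cmp (T2 F v w s) x))"
    if "v \<in> Ob W" "w \<in> Ob W" "s \<in> Arr (Hom W v w)"
      and fn: "\<forall>v\<in>Ob W. is_functor (TObj F v) (TObj H v) (\<alpha> v)"
      and eq: "\<forall>u\<in>Obj (Hom W v w). functor_comp (TObj F v) (T1 H v w u) (\<alpha> v) = functor_comp (TObj F v) (\<alpha> w) (T1 F v w u)"
    for v w s
  proof -
    note [simp] = that(1-3) bspec[OF fn]
    have d: "Dom (Hom W v w) s \<in> Obj (Hom W v w)" "Cod (Hom W v w) s \<in> Obj (Hom W v w)"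
      using that(3) catD(1,2)[OF two_catD(1)[OF W that(1,2)]] by auto
    have l: "hcomp (TObj F v) (TObj H w) (T2 H v w s) (nt_id (TObj F v) (TObj H v) (\<alpha> v)) =
      \<lparr>Src = functor_comp (TObj F v) (Src (T2 H v w s)) (\<alpha> v), Tgt = functor_comp (TObj F v) (Tgt (T2 H v w s)) (\<alpha> v),
       Cmp = (\<lambda>a\<in>Obj (TObj F v). Cmp (T2 H v w s) (OMap (\<alpha> v) a))\<rparr>"
      by (rule whisker_right) (simp_all add: f h)
    have r: "hcomp (TObj F v) (TObj H w) (nt_id (TObj F w) (TObj H w) (\<alpha> w)) (T2 F v w s) =
      \<lparr>Src = functor_comp (TObj F v) (\<alpha> w) (Src (T2 F v w s)), Tgt = functor_comp (TObj F v) (\<alpha> w) (Tgt (T2 F v w s)),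
       Cmp = (\<lambda>a\<in>Obj (TObj F v). AMap (\<alpha> w) (Cmp (T2 F v w s) a))\<rparr>"
      by (rule whisker_left) (simp_all add: f h)
    show ?thesis
      unfolding l r using eq d by (auto simp: f h restrict_def fun_eq_iff)
  qed
  show ?thesis
    unfolding two_nat_def using 1 by (simp add: fcomp_eq_iff cong: conj_cong)
qed

lemma modification_iff:
  assumes W: "two_category W" and F: "two_functor W CAT F" and H: "two_functor W CAT H"
  shows "modification W F H m \<longleftrightarrow>
     two_nat W F H (Src m) \<and> two_nat W F H (Tgt m) \<and>
     Cmp m \<in> extensional (Ob W) \<and>
     (\<forall>v\<in>Ob W. is_nt (TObj F v) (TObj H v) (Cmp m v) \<and>
        Src (Cmp m v) = Src m v \<and> Tgt (Cmp m v) = Tgt m v) \<and>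
     (\<forall>v\<in>Ob W. \<forall>w\<in>Ob W. \<forall>u\<in>Obj (Hom W v w). \<forall>x\<in>Obj (TObj F v).
        AMap (T1 H v w u) (Cmp (Cmp m v) x) = Cmp (Cmp m w) (OMap (T1 F v w u) x))"
proof -
  note f = cat_valuedD[OF F] and h = cat_valuedD[OF H]
  have 1: "hcomp (TObj F v) (TObj H w) (nt_id (TObj H v) (TObj H w) (T1 H v w u)) (Cmp m v) =
        hcomp (TObj F v) (TObj H w) (Cmp m w) (nt_id (TObj F v) (TObj F w) (T1 F v w u)) \<longleftrightarrow>
     (\<forall>x\<in>Obj (TObj F v). AMap (T1 H v w u) (Cmp (Cmp m v) x) = Cmp (Cmp m w) (OMap (T1 F v w u) x))"
    if "v \<in> Ob W" "w \<in> Ob W" "u \<in> Obj (Hom W v w)"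
      and t: "two_nat W F H (Src m)" "two_nat W F H (Tgt m)"
      and n: "\<forall>v\<in>Ob W. is_nt (TObj F v) (TObj H v) (Cmp m v) \<and>
        Src (Cmp m v) = Src m v \<and> Tgt (Cmp m v) = Tgt m v"
    for v w u
  proof -
    note [simp] = that(1-3) bspec[OF n]
    have "functor_comp (TObj F v) (T1 H v w u) (Src m v) = functor_comp (TObj F v) (Src m w) (T1 F v w u)"
        "functor_comp (TObj F v) (T1 H v w u) (Tgt m v) = functor_comp (TObj F v) (Tgt m w) (T1 F v w u)"
      using t unfolding two_nat_def by auto
    moreover have "hcomp (TObj F v) (TObj H w) (nt_id (TObj H v) (TObj H w) (T1 H v w u)) (Cmp m v) =
      \<lparr>Src = functor_comp (TObj F v) (T1 H v w u) (Src (Cmp m v)), Tgt = functor_comp (TObj F v) (T1 H v w u) (Tgt (Cmp m v)),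
       Cmp = (\<lambda>a\<in>Obj (TObj F v). AMap (T1 H v w u) (Cmp (Cmp m v) a))\<rparr>"
      by (rule whisker_left) (simp_all add: f h)
    moreover have "hcomp (TObj F v) (TObj H w) (Cmp m w) (nt_id (TObj F v) (TObj F w) (T1 F v w u)) =
      \<lparr>Src = functor_comp (TObj F v) (Src (Cmp m w)) (T1 F v w u), Tgt = functor_comp (TObj F v) (Tgt (Cmp m w)) (T1 F v w u),
       Cmp = (\<lambda>a\<in>Obj (TObj F v). Cmp (Cmp m w) (OMap (T1 F v w u) a))\<rparr>"
      by (rule whisker_right) (simp_all add: f h)
    ultimately show ?thesis
      by (auto simp: restrict_def fun_eq_iff)
  qed
  show ?thesis
    unfolding modification_def using 1 by (simp cong: conj_cong)
qed


lemma two_natD: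
  assumes W: "two_category W" and F: "two_functor W CAT F" and H: "two_functor W CAT H"
    and a: "two_nat W F H \<alpha>"
  shows "\<alpha> \<in> extensional (Ob W)"
    and "v \<in> Ob W \<Longrightarrow> is_functor (TObj F v) (TObj H v) (\<alpha> v)"
    and "v \<in> Ob W \<Longrightarrow> w \<in> Ob W \<Longrightarrow> u \<in> Obj (Hom W v w) \<Longrightarrow> x \<in> Obj (TObj F v) \<Longrightarrow>
      OMap (T1 H v w u) (OMap (\<alpha> v) x) = OMap (\<alpha> w) (OMap (T1 F v w u) x)"
    and "v \<in> Ob W \<Longrightarrow> w \<in> Ob W \<Longrightarrow> u \<in> Obj (Hom W v w) \<Longrightarrow> f \<in> Arr (TObj F v) \<Longrightarrow>
      AMap (T1 H v w u) (AMap (\<alpha> v) f) = AMap (\<alpha> w) (AMap (T1 F v w u) f)"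
    and "v \<in> Ob W \<Longrightarrow> w \<in> Ob W \<Longrightarrow> s \<in> Arr (Hom W v w) \<Longrightarrow> x \<in> Obj (TObj F v) \<Longrightarrow>
      Cmp (T2 H v w s) (OMap (\<alpha> v) x) = AMap (\<alpha> w) (Cmp (T2 F v w s) x)"
  using a unfolding two_nat_iff[OF W F H] by blast+

lemma modificationD:
  assumes W: "two_category W" and F: "two_functor W CAT F" and H: "two_functor W CAT H"
    and m: "modification W F H m"
  shows "two_nat W F H (Src m)" and "two_nat W F H (Tgt m)"
    and "Cmp m \<in> extensional (Ob W)"
    and "v \<in> Ob W \<Longrightarrow> is_nt (TObj F v) (TObj H v) (Cmp m v)"
    and "v \<in> Ob W \<Longrightarrow> Src (Cmp m v) = Src m v"
    and "v \<in> Ob W \<Longrightarrow> Tgt (Cmp m v) = Tgt m v"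
    and "v \<in> Ob W \<Longrightarrow> w \<in> Ob W \<Longrightarrow> u \<in> Obj (Hom W v w) \<Longrightarrow> x \<in> Obj (TObj F v) \<Longrightarrow>
      AMap (T1 H v w u) (Cmp (Cmp m v) x) = Cmp (Cmp m w) (OMap (T1 F v w u) x)"
  using m unfolding modification_iff[OF W F H] by blast+

lemma modification_eqI:
  assumes W: "two_category W" and F: "two_functor W CAT F" and H: "two_functor W CAT H"
    and m: "modification W F H m" and n: "modification W F H n"
    and e: "Src m = Src n" "Tgt m = Tgt n"
    and c: "\<And>v x. v \<in> Ob W \<Longrightarrow> x \<in> Obj (TObj F v) \<Longrightarrow> Cmp (Cmp m v) x = Cmp (Cmp n v) x"
  shows "m = n"
proof -
  note md = modificationD[OF W F H m] and nd = modificationD[OF W F H n]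
  have "Cmp m v = Cmp n v" if v: "v \<in> Ob W" for v
    by (rule nt_eqI[OF md(4)[OF v] nd(4)[OF v]]) (simp_all add: md(5,6) nd(5,6) v e c)
  then have "Cmp m = Cmp n" using md(3) nd(3) by (auto intro: extensionalityI)
  then show ?thesis using e by (auto intro: cell.equality)
qed

lemma two_nat_eqI:
  assumes W: "two_category W" and F: "two_functor W CAT F" and H: "two_functor W CAT H"
    and a: "two_nat W F H \<alpha>" and b: "two_nat W F H \<beta>"
    and o: "\<And>v x. v \<in> Ob W \<Longrightarrow> x \<in> Obj (TObj F v) \<Longrightarrow> OMap (\<alpha> v) x = OMap (\<beta> v) x"
    and m: "\<And>v f. v \<in> Ob W \<Longrightarrow> f \<in> Arr (TObj F v) \<Longrightarrow> AMap (\<alpha> v) f = AMap (\<beta> v) f"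
  shows "\<alpha> = \<beta>"
proof -
  note ad = two_natD[OF W F H a] and bd = two_natD[OF W F H b]
  have "\<alpha> v = \<beta> v" if v: "v \<in> Ob W" for v
    by (rule functor_eqI[OF ad(2)[OF v] bd(2)[OF v]]) (simp_all add: v o m)
  then show ?thesis using ad(1) bd(1) by (auto intro: extensionalityI)
qed

lemma two_nat_cat_simps [simp]:
  "Obj (two_nat_cat W F H) = {\<alpha>. two_nat W F H \<alpha>}" "Arr (two_nat_cat W F H) = {m. modification W F H m}"
  "Dom (two_nat_cat W F H) = Src" "Cod (two_nat_cat W F H) = Tgt"
  by (auto simp: two_nat_cat_def)

lemma nt_id_simps [simp]: "Src (nt_id C D F) = F" "Tgt (nt_id C D F) = F"
  "a \<in> Obj C \<Longrightarrow> Cmp (nt_id C D F) a = Ident D (OMap F a)"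
  by (auto simp: nt_id_def)

lemma vcomp_simps [simp]: "Src (vcomp C D t s) = Src s" "Tgt (vcomp C D t s) = Tgt t"
  "a \<in> Obj C \<Longrightarrow> Cmp (vcomp C D t s) a = Comp D (Cmp t a) (Cmp s a)"
  by (auto simp: vcomp_def)

lemma ident_two_nat_cat [simp]:
  "Src (Ident (two_nat_cat W F H) \<alpha>) = \<alpha>" "Tgt (Ident (two_nat_cat W F H) \<alpha>) = \<alpha>"
  "v \<in> Ob W \<Longrightarrow> Cmp (Ident (two_nat_cat W F H) \<alpha>) v = nt_id (TObj F v) (TObj H v) (\<alpha> v)"
  "Cmp (Ident (two_nat_cat W F H) \<alpha>) \<in> extensional (Ob W)"
  by (auto simp: two_nat_cat_def)

lemma comp_two_nat_cat [simp]:
  "Src (Comp (two_nat_cat W F H) n m) = Src m" "Tgt (Comp (two_nat_cat W F H) n m) = Tgt n"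
  "v \<in> Ob W \<Longrightarrow> Cmp (Comp (two_nat_cat W F H) n m) v = vcomp (TObj F v) (TObj H v) (Cmp n v) (Cmp m v)"
  "Cmp (Comp (two_nat_cat W F H) n m) \<in> extensional (Ob W)"
  by (auto simp: two_nat_cat_def)

section \<open>Transformations, representables and opposites\<close>

lemma category_two_nat_cat:
  assumes W: "two_category W" and F: "two_functor W CAT F" and H: "two_functor W CAT H"
  shows "category (two_nat_cat W F H)"
proof -
  let ?C = "two_nat_cat W F H"
  note f = cat_valuedD[OF F] and h = cat_valuedD[OF H]
  note td = two_natD[OF W F H] and md = modificationD[OF W F H]
  have id: "modification W F H (Ident ?C \<alpha>)" if a: "two_nat W F H \<alpha>" for \<alpha>
    unfolding modification_iff[OF W F H]
    using a td[OF a] functorD(1)[OF td(2)[OF a]] functorD(5)[OF h(2)] functorD(1)[OF f(2)]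
    by (auto simp: f h intro!: nt_nt_id)
  have comp: "modification W F H (Comp ?C n m)"
    if m: "modification W F H m" and n: "modification W F H n" and e: "Tgt m = Src n" for m n
  proof -
    have "is_nt (TObj F v) (TObj H v) (vcomp (TObj F v) (TObj H v) (Cmp n v) (Cmp m v))" if "v \<in> Ob W" for v
      using that md[OF m] md[OF n] e by (intro nt_vcomp) (auto simp: f h)
    moreover have "AMap (T1 H v w u) (Comp (TObj H v) (Cmp (Cmp n v) x) (Cmp (Cmp m v) x)) =
        Comp (TObj H w) (Cmp (Cmp n w) (OMap (T1 F v w u) x)) (Cmp (Cmp m w) (OMap (T1 F v w u) x))"
      if "v \<in> Ob W" "w \<in> Ob W" "u \<in> Obj (Hom W v w)" "x \<in> Obj (TObj F v)" for v w u x
      using that md[OF m] md[OF n] e ntD[OF md(4)[OF m]] ntD[OF md(4)[OF n]]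
      by (subst functorD(6)[OF h(2)]) (auto simp: )
    ultimately show ?thesis
      unfolding modification_iff[OF W F H]
      using md[OF m] md[OF n] functorD(1)[OF f(2)] by (auto simp: e)
  qed
  have "Comp ?C m (Ident ?C (Src m)) = m" if m: "modification W F H m" for m
    by (rule modification_eqI[OF W F H comp[OF id[OF md(1)[OF m]] m] m])
      (auto simp: catD(9)[OF h(1)] ntD[OF md(4)[OF m]] md[OF m])
  moreover have "Comp ?C (Ident ?C (Tgt m)) m = m" if m: "modification W F H m" for m
    by (rule modification_eqI[OF W F H comp[OF m id[OF md(2)[OF m]]] m])
      (auto simp: catD(10)[OF h(1)] ntD[OF md(4)[OF m]] md[OF m])
  moreover have "Comp ?C m'' (Comp ?C m' m) = Comp ?C (Comp ?C m'' m') m"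
    if m: "modification W F H m" "modification W F H m'" "modification W F H m''" "Tgt m = Src m'" "Tgt m' = Src m''"
    for m m' m''
    by (rule modification_eqI[OF W F H comp[OF comp[OF m(1,2,4)] m(3)] comp[OF m(1) comp[OF m(2,3,5)]]])
      (auto intro!: cat_assoc h(1)
        simp: m(4,5) ntD[OF md(4)[OF m(1)]] ntD[OF md(4)[OF m(2)]] ntD[OF md(4)[OF m(3)]]
          md[OF m(1)] md[OF m(2)] md[OF m(3)])
  ultimately show ?thesis
    unfolding category_def by (auto simp: id comp md)
qed

lemma op_simps [simp]: "Ob (op_two_cat K) = Ob K" "Hom (op_two_cat K) A B = Hom K B A" "HId (op_two_cat K) = HId K"
  "f \<in> Obj (Hom K B A) \<Longrightarrow> g \<in> Obj (Hom K C B) \<Longrightarrow> comp1 (op_two_cat K) A B C g f = comp1 K C B A f g"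
  "s \<in> Arr (Hom K B A) \<Longrightarrow> t \<in> Arr (Hom K C B) \<Longrightarrow> comp2 (op_two_cat K) A B C t s = comp2 K C B A s t"
  by (auto simp: op_two_cat_def)

lemma two_category_op:
  assumes K: "two_category K"
  shows "two_category (op_two_cat K)"
proof -
  note c = two_cat_hcomp[OF K] and k = two_catD[OF K] and as = two_cat_assoc[OF K]
  note cc = catD[OF k(1)]
  have "is_functor (prod_cat (Hom K C B) (Hom K B A)) (Hom K C A) (HComp (op_two_cat K) A B C)"
    if o: "A \<in> Ob K" "B \<in> Ob K" "C \<in> Ob K" for A B C
  proof -
    have "OMap (HComp (op_two_cat K) A B C) \<in> extensional (Obj (Hom K C B) \<times> Obj (Hom K B A))"
      "AMap (HComp (op_two_cat K) A B C) \<in> extensional (Arr (Hom K C B) \<times> Arr (Hom K B A))"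
      by (auto simp: op_two_cat_def)
    then show ?thesis
      unfolding is_functor_def PiE_def by (auto simp: c o k cc)
  qed
  then show ?thesis
    unfolding two_category_def[of "op_two_cat K"] by (auto simp: k as c cc)
qed

lemma representable_simps [simp]:
  "TObj (representable K A) X = Hom K A X"
  "g \<in> Obj (Hom K X Y) \<Longrightarrow> x \<in> Obj (Hom K A X) \<Longrightarrow> OMap (T1 (representable K A) X Y g) x = comp1 K A X Y g x"
  "g \<in> Obj (Hom K X Y) \<Longrightarrow> r \<in> Arr (Hom K A X) \<Longrightarrow>
     AMap (T1 (representable K A) X Y g) r = comp2 K A X Y (Ident (Hom K X Y) g) r"
  "t \<in> Arr (Hom K X Y) \<Longrightarrow> x \<in> Obj (Hom K A X) \<Longrightarrow>
     Cmp (T2 (representable K A) X Y t) x = comp2 K A X Y t (Ident (Hom K A X) x)"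
  by (auto simp: representable_def Let_def)

lemma two_functor_representable:
  assumes K: "two_category K" and A: "A \<in> Ob K"
  shows "two_functor K CAT (representable K A)"
proof -
  let ?R = "representable K A"
  note c = two_cat_hcomp[OF K] and k = two_catD[OF K] and as = two_cat_assoc[OF K]
  note cc = catD[OF k(1)]
  have fn: "is_functor (Hom K A X) (Hom K A Y) (T1 ?R X Y g)"
    if o: "X \<in> Ob K" "Y \<in> Ob K" and g: "g \<in> Obj (Hom K X Y)" for X Y g
  proof -
    have 1: "comp2 K A X Y (Ident (Hom K X Y) g) (Comp (Hom K A X) t s) =
      Comp (Hom K A Y) (comp2 K A X Y (Ident (Hom K X Y) g) t) (comp2 K A X Y (Ident (Hom K X Y) g) s)"
      if "s \<in> Arr (Hom K A X)" "t \<in> Arr (Hom K A X)" "Cod (Hom K A X) s = Dom (Hom K A X) t" for s t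
      using c(6)[OF A o that(1,2), of "Ident (Hom K X Y) g" "Ident (Hom K X Y) g"] that g o A by (simp add: cc)
    have "OMap (T1 ?R X Y g) \<in> extensional (Obj (Hom K A X))"
      "AMap (T1 ?R X Y g) \<in> extensional (Arr (Hom K A X))" using g by (auto simp: representable_def Let_def)
    then show ?thesis
      unfolding is_functor_def PiE_def by (auto simp: c A o g k cc 1)
  qed
  have st: "Src (T2 ?R X Y t) = T1 ?R X Y (Dom (Hom K X Y) t)" "Tgt (T2 ?R X Y t) = T1 ?R X Y (Cod (Hom K X Y) t)"
    if "X \<in> Ob K" "Y \<in> Ob K" "t \<in> Arr (Hom K X Y)" for X Y t
    using that by (auto simp: representable_def Let_def cc)
  have nt: "is_nt (Hom K A X) (Hom K A Y) (T2 ?R X Y t)"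
    if o: "X \<in> Ob K" "Y \<in> Ob K" and t: "t \<in> Arr (Hom K X Y)" for X Y t
  proof -
    have x: "Cmp (T2 ?R X Y t) \<in> extensional (Obj (Hom K A X))" using t by (auto simp: representable_def Let_def)
    have 1: "Comp (Hom K A Y) (comp2 K A X Y t (Ident (Hom K A X) (Cod (Hom K A X) r)))
          (comp2 K A X Y (Ident (Hom K X Y) (Dom (Hom K X Y) t)) r)
        = Comp (Hom K A Y) (comp2 K A X Y (Ident (Hom K X Y) (Cod (Hom K X Y) t)) r)
           (comp2 K A X Y t (Ident (Hom K A X) (Dom (Hom K A X) r)))" if r: "r \<in> Arr (Hom K A X)" for r
      by (subst (1 2) c(6)[OF A o, symmetric]) (simp_all add: cc o A r t)
    show ?thesis
      unfolding is_nt_def PiE_def using x 1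
      by (auto simp: st o t fn cc A c)
  qed
  have ext: "THom ?R X Y = \<lparr>OMap = restrict (T1 ?R X Y) (Obj (Hom K X Y)), AMap = restrict (T2 ?R X Y) (Arr (Hom K X Y))\<rparr>" for X Y
    by (auto simp: representable_def Let_def)
  have "is_functor (Hom K X Y) (functor_cat (Hom K A X) (Hom K A Y)) (THom ?R X Y)"
    if o: "X \<in> Ob K" "Y \<in> Ob K" for X Y
  proof -
    have 1: "T2 ?R X Y (Ident (Hom K X Y) g) = nt_id (Hom K A X) (Hom K A Y) (T1 ?R X Y g)"
      if g: "g \<in> Obj (Hom K X Y)" for g
      by (rule nt_eqI[OF nt nt_nt_id]) (simp_all add: o g cc A k fn st c)
    have 2: "T2 ?R X Y (Comp (Hom K X Y) t s) = vcomp (Hom K A X) (Hom K A Y) (T2 ?R X Y t) (T2 ?R X Y s)"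
      if s: "s \<in> Arr (Hom K X Y)" "t \<in> Arr (Hom K X Y)" "Cod (Hom K X Y) s = Dom (Hom K X Y) t" for s t
    proof (rule nt_eqI[OF nt nt_vcomp])
      fix x assume x: "x \<in> Obj (Hom K A X)"
      show "Cmp (T2 ?R X Y (Comp (Hom K X Y) t s)) x = Cmp (vcomp (Hom K A X) (Hom K A Y) (T2 ?R X Y t) (T2 ?R X Y s)) x"
        using c(6)[OF A o, of "Ident (Hom K A X) x" "Ident (Hom K A X) x" s t] x s
        by (simp add: o A cc)
    qed (simp_all add: o s cc A k nt st)
    have "OMap (THom ?R X Y) \<in> extensional (Obj (Hom K X Y))" "AMap (THom ?R X Y) \<in> extensional (Arr (Hom K X Y))"
      by (subst ext, simp)+
    then show ?thesis
      unfolding is_functor_def PiE_def using 1 2 by (simp add: fn nt st o)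
  qed
  moreover have "T1 ?R X X (HId K X) = functor_id (Hom K A X)" if "X \<in> Ob K" for X
    by (rule functor_eqI[OF fn functor_fid]) (simp_all add: that A k functor_id_def)
  moreover have "T1 ?R X Z (comp1 K X Y Z g f) = functor_comp (Hom K A X) (T1 ?R Y Z g) (T1 ?R X Y f)"
    if o: "X \<in> Ob K" "Y \<in> Ob K" "Z \<in> Ob K" and f: "f \<in> Obj (Hom K X Y)" "g \<in> Obj (Hom K Y Z)" for X Y Z f g
    by (rule functor_eqI[OF fn functor_fcomp[OF _ fn fn]])
      (simp_all add: o f A k c(1-4) as functor_comp_def cc c(5)[symmetric])
  moreover have "T2 ?R X Z (comp2 K X Y Z t s) = hcomp (Hom K A X) (Hom K A Z) (T2 ?R Y Z t) (T2 ?R X Y s)"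
    if o: "X \<in> Ob K" "Y \<in> Ob K" "Z \<in> Ob K" and s: "s \<in> Arr (Hom K X Y)" "t \<in> Arr (Hom K Y Z)" for X Y Z s t
  proof (rule nt_eqI[OF nt nt_hcomp[OF _ _ _ nt nt]])
    have comp: "T1 ?R X Z (comp1 K X Y Z g f) = functor_comp (Hom K A X) (T1 ?R Y Z g) (T1 ?R X Y f)"
      if "f \<in> Obj (Hom K X Y)" "g \<in> Obj (Hom K Y Z)" for f g
      by (rule functor_eqI[OF fn functor_fcomp[OF _ fn fn]])
        (simp_all add: o that A k c(1-4) as functor_comp_def cc c(5)[symmetric])
    show "Src (T2 ?R X Z (comp2 K X Y Z t s)) = Src (hcomp (Hom K A X) (Hom K A Z) (T2 ?R Y Z t) (T2 ?R X Y s))"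
       "Tgt (T2 ?R X Z (comp2 K X Y Z t s)) = Tgt (hcomp (Hom K A X) (Hom K A Z) (T2 ?R Y Z t) (T2 ?R X Y s))"
      by (simp_all add: st o s c comp cc hcomp_def)
    fix x assume x: "x \<in> Obj (Hom K A X)"
    let ?y = "comp1 K A X Y (Cod (Hom K X Y) s) x"
    have "comp2 K A X Z (comp2 K X Y Z t s) (Ident (Hom K A X) x) = comp2 K A Y Z t (comp2 K A X Y s (Ident (Hom K A X) x))"
      by (simp add: as o A x s cc)
    also have "\<dots> = comp2 K A Y Z (Comp (Hom K Y Z) t (Ident (Hom K Y Z) (Dom (Hom K Y Z) t)))
       (Comp (Hom K A Y) (Ident (Hom K A Y) ?y) (comp2 K A X Y s (Ident (Hom K A X) x)))"
      by (simp add: o A x s cc c)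
    also have "\<dots> = Comp (Hom K A Z) (comp2 K A Y Z t (Ident (Hom K A Y) ?y))
       (comp2 K A Y Z (Ident (Hom K Y Z) (Dom (Hom K Y Z) t)) (comp2 K A X Y s (Ident (Hom K A X) x)))"
      by (rule c(6)) (simp_all add: o A x s cc c)
    finally show "Cmp (T2 ?R X Z (comp2 K X Y Z t s)) x = Cmp (hcomp (Hom K A X) (Hom K A Z) (T2 ?R Y Z t) (T2 ?R X Y s)) x"
      by (simp add: hcomp_def o A x s cc c st)
  qed (simp_all add: o s A c k)
  ultimately show ?thesis
    unfolding two_functor_def CAT_def by (simp add: k A cat_hcomp_def fn nt)
qed

text \<open>
  Together with \<open>two_functor_representable\<close> this makes \<open>K(A, G -)\<close> a 2-functor, so that
  the pointwise description applies to cones.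
\<close>

lemma two_functor_tcomp:
  assumes W: "two_category W" and T: "two_functor W K T" and S: "two_functor K L S"
  shows "two_functor W L (two_functor_comp W S T)"
proof -
  note t = two_functorD[OF T] and s = two_functorD[OF S] and w = two_catD[OF W] and c = two_cat_hcomp[OF W]
  note tf = functorD[OF t(2)] and sf = functorD[OF s(2)]
  show ?thesis
    unfolding two_functor_def two_functor_comp_def
    using functor_fcomp[OF w(1) t(2) s(2)]
    by (auto simp: t s functor_comp_def w c tf)
qed

lemma hom_simps [simp]:
  assumes "two_functor W K G" "v \<in> Ob W" "w \<in> Ob W"
  shows "u \<in> Obj (Hom W v w) \<Longrightarrow> x \<in> Obj (Hom K A (TObj G v)) \<Longrightarrow>
     OMap (T1 (two_functor_comp W (representable K A) G) v w u) x
       = comp1 K A (TObj G v) (TObj G w) (T1 G v w u) x"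
    and "u \<in> Obj (Hom W v w) \<Longrightarrow> r \<in> Arr (Hom K A (TObj G v)) \<Longrightarrow>
     AMap (T1 (two_functor_comp W (representable K A) G) v w u) r
       = comp2 K A (TObj G v) (TObj G w) (Ident (Hom K (TObj G v) (TObj G w)) (T1 G v w u)) r"
    and "s \<in> Arr (Hom W v w) \<Longrightarrow> x \<in> Obj (Hom K A (TObj G v)) \<Longrightarrow>
     Cmp (T2 (two_functor_comp W (representable K A) G) v w s) x
       = comp2 K A (TObj G v) (TObj G w) (T2 G v w s) (Ident (Hom K A (TObj G v)) x)"
  using two_functorD(1,2)[OF assms(1)] assms(2,3) functorD(1,2)[OF two_functorD(2)[OF assms]]
  by (auto simp: two_functor_comp_def functor_comp_def)

lemma hom_TObj [simp]: "TObj (two_functor_comp W (representable K A) G) w = Hom K A (TObj G w)"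
  by (simp add: two_functor_comp_def)


section \<open>Weighted limits from a universal cone\<close>

locale weighted_diagram =
  fixes K :: "('o, 'a, 'c) two_cat" and W :: "('w, 'x, 'y) two_cat"
    and F :: "('w, 'x, 'y, 'p, 'b) cat_valued" and G :: "('w, 'x, 'y, 'o, 'a, 'c) two_functr"
  assumes K: "two_category K" and W: "two_category W"
    and F: "two_functor W CAT F" and G: "two_functor W K G"
begin

abbreviation hom :: "'o \<Rightarrow> ('w, 'x, 'y, 'a, 'c) cat_valued" where
  "hom A \<equiv> two_functor_comp W (representable K A) G"

text \<open>
  The cone \<open>\<alpha>\<close> with vertex \<open>A\<close> restricted along a 1-cell \<open>h : B \<rightarrow> A\<close>. This, \<open>cone_comp2\<close> and
  \<open>modif_comp\<close> are the actions of \<open>cones\<close>, unfolded to values at the objects and arrows of the weight.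
\<close>

definition cone_comp :: "'o \<Rightarrow> 'o \<Rightarrow> ('w \<Rightarrow> ('p, 'b, 'a, 'c) functr) \<Rightarrow> 'a \<Rightarrow> 'w \<Rightarrow> ('p, 'b, 'a, 'c) functr" where
  "cone_comp A B \<alpha> h = (\<lambda>w\<in>Ob W.
     \<lparr>OMap = (\<lambda>x\<in>Obj (TObj F w). comp1 K B A (TObj G w) (OMap (\<alpha> w) x) h),
      AMap = (\<lambda>f\<in>Arr (TObj F w). comp2 K B A (TObj G w) (AMap (\<alpha> w) f) (Ident (Hom K B A) h))\<rparr>)"

definition cone_comp2 :: "'o \<Rightarrow> 'o \<Rightarrow> ('w \<Rightarrow> ('p, 'b, 'a, 'c) functr) \<Rightarrow> 'c \<Rightarrow> ('w, 'p, 'b, 'a, 'c) modif" where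
  "cone_comp2 A B \<alpha> t =
     \<lparr>Src = cone_comp A B \<alpha> (Dom (Hom K B A) t), Tgt = cone_comp A B \<alpha> (Cod (Hom K B A) t),
      Cmp = (\<lambda>w\<in>Ob W.
        \<lparr>Src = cone_comp A B \<alpha> (Dom (Hom K B A) t) w, Tgt = cone_comp A B \<alpha> (Cod (Hom K B A) t) w,
         Cmp = (\<lambda>x\<in>Obj (TObj F w).
           comp2 K B A (TObj G w) (Ident (Hom K A (TObj G w)) (OMap (\<alpha> w) x)) t)\<rparr>)\<rparr>"

definition modif_comp :: "'o \<Rightarrow> 'o \<Rightarrow> ('w, 'p, 'b, 'a, 'c) modif \<Rightarrow> 'a \<Rightarrow> ('w, 'p, 'b, 'a, 'c) modif" where
  "modif_comp A B m h =
     \<lparr>Src = cone_comp A B (Src m) h, Tgt = cone_comp A B (Tgt m) h,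
      Cmp = (\<lambda>w\<in>Ob W.
        \<lparr>Src = cone_comp A B (Src m) h w, Tgt = cone_comp A B (Tgt m) h w,
         Cmp = (\<lambda>x\<in>Obj (TObj F w).
           comp2 K B A (TObj G w) (Cmp (Cmp m w) x) (Ident (Hom K B A) h))\<rparr>)\<rparr>"

lemmas k = two_catD[OF K] and kc = two_cat_hcomp[OF K] and kas = two_cat_assoc[OF K]
lemmas cc = catD[OF two_catD(1)[OF K]]
lemmas f = cat_valuedD[OF F]
lemmas fo = functorD[OF cat_valuedD(2)[OF F]] and fa = ntD[OF cat_valuedD(3)[OF F]]
lemmas g = two_functorD[OF G]
lemmas ga = functorD[OF two_functorD(2)[OF G]]

lemma hom: "A \<in> Ob K \<Longrightarrow> two_functor W CAT (hom A)"
  using two_functor_tcomp[OF W G two_functor_representable[OF K]] .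

lemma coneD:
  assumes A: "A \<in> Ob K" and a: "two_nat W F (hom A) \<alpha>"
  shows "v \<in> Ob W \<Longrightarrow> is_functor (TObj F v) (Hom K A (TObj G v)) (\<alpha> v)"
    and "v \<in> Ob W \<Longrightarrow> x \<in> Obj (TObj F v) \<Longrightarrow> OMap (\<alpha> v) x \<in> Obj (Hom K A (TObj G v))"
    and "v \<in> Ob W \<Longrightarrow> \<phi> \<in> Arr (TObj F v) \<Longrightarrow> AMap (\<alpha> v) \<phi> \<in> Arr (Hom K A (TObj G v))"
    and "v \<in> Ob W \<Longrightarrow> \<phi> \<in> Arr (TObj F v) \<Longrightarrow>
      Dom (Hom K A (TObj G v)) (AMap (\<alpha> v) \<phi>) = OMap (\<alpha> v) (Dom (TObj F v) \<phi>)"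
    and "v \<in> Ob W \<Longrightarrow> \<phi> \<in> Arr (TObj F v) \<Longrightarrow>
      Cod (Hom K A (TObj G v)) (AMap (\<alpha> v) \<phi>) = OMap (\<alpha> v) (Cod (TObj F v) \<phi>)"
    and "v \<in> Ob W \<Longrightarrow> x \<in> Obj (TObj F v) \<Longrightarrow>
      AMap (\<alpha> v) (Ident (TObj F v) x) = Ident (Hom K A (TObj G v)) (OMap (\<alpha> v) x)"
    and "v \<in> Ob W \<Longrightarrow> \<phi> \<in> Arr (TObj F v) \<Longrightarrow> \<psi> \<in> Arr (TObj F v) \<Longrightarrow> Cod (TObj F v) \<phi> = Dom (TObj F v) \<psi> \<Longrightarrow>
      AMap (\<alpha> v) (Comp (TObj F v) \<psi> \<phi>) = Comp (Hom K A (TObj G v)) (AMap (\<alpha> v) \<psi>) (AMap (\<alpha> v) \<phi>)"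
    and "v \<in> Ob W \<Longrightarrow> w \<in> Ob W \<Longrightarrow> u \<in> Obj (Hom W v w) \<Longrightarrow> x \<in> Obj (TObj F v) \<Longrightarrow>
      OMap (\<alpha> w) (OMap (T1 F v w u) x) = comp1 K A (TObj G v) (TObj G w) (T1 G v w u) (OMap (\<alpha> v) x)"
    and "v \<in> Ob W \<Longrightarrow> w \<in> Ob W \<Longrightarrow> u \<in> Obj (Hom W v w) \<Longrightarrow> \<phi> \<in> Arr (TObj F v) \<Longrightarrow>
      AMap (\<alpha> w) (AMap (T1 F v w u) \<phi>)
        = comp2 K A (TObj G v) (TObj G w) (Ident (Hom K (TObj G v) (TObj G w)) (T1 G v w u)) (AMap (\<alpha> v) \<phi>)"
    and "v \<in> Ob W \<Longrightarrow> w \<in> Ob W \<Longrightarrow> s \<in> Arr (Hom W v w) \<Longrightarrow> x \<in> Obj (TObj F v) \<Longrightarrow>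
      AMap (\<alpha> w) (Cmp (T2 F v w s) x)
        = comp2 K A (TObj G v) (TObj G w) (T2 G v w s) (Ident (Hom K A (TObj G v)) (OMap (\<alpha> v) x))"
proof -
  note d = two_natD[OF W F hom[OF A] a]
  show 1: "is_functor (TObj F v) (Hom K A (TObj G v)) (\<alpha> v)" if "v \<in> Ob W" for v
    using d(2)[OF that] by simp
  note 2 = functorD[OF 1]
  show "v \<in> Ob W \<Longrightarrow> x \<in> Obj (TObj F v) \<Longrightarrow> OMap (\<alpha> v) x \<in> Obj (Hom K A (TObj G v))"
    and "v \<in> Ob W \<Longrightarrow> \<phi> \<in> Arr (TObj F v) \<Longrightarrow> AMap (\<alpha> v) \<phi> \<in> Arr (Hom K A (TObj G v))"
    and "v \<in> Ob W \<Longrightarrow> \<phi> \<in> Arr (TObj F v) \<Longrightarrow>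
      Dom (Hom K A (TObj G v)) (AMap (\<alpha> v) \<phi>) = OMap (\<alpha> v) (Dom (TObj F v) \<phi>)"
    and "v \<in> Ob W \<Longrightarrow> \<phi> \<in> Arr (TObj F v) \<Longrightarrow>
      Cod (Hom K A (TObj G v)) (AMap (\<alpha> v) \<phi>) = OMap (\<alpha> v) (Cod (TObj F v) \<phi>)"
    and "v \<in> Ob W \<Longrightarrow> x \<in> Obj (TObj F v) \<Longrightarrow>
      AMap (\<alpha> v) (Ident (TObj F v) x) = Ident (Hom K A (TObj G v)) (OMap (\<alpha> v) x)"
    and "v \<in> Ob W \<Longrightarrow> \<phi> \<in> Arr (TObj F v) \<Longrightarrow> \<psi> \<in> Arr (TObj F v) \<Longrightarrow> Cod (TObj F v) \<phi> = Dom (TObj F v) \<psi> \<Longrightarrow>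
      AMap (\<alpha> v) (Comp (TObj F v) \<psi> \<phi>) = Comp (Hom K A (TObj G v)) (AMap (\<alpha> v) \<psi>) (AMap (\<alpha> v) \<phi>)"
    using 2 by blast+
  show "v \<in> Ob W \<Longrightarrow> w \<in> Ob W \<Longrightarrow> u \<in> Obj (Hom W v w) \<Longrightarrow> x \<in> Obj (TObj F v) \<Longrightarrow>
      OMap (\<alpha> w) (OMap (T1 F v w u) x) = comp1 K A (TObj G v) (TObj G w) (T1 G v w u) (OMap (\<alpha> v) x)"
    by (simp add: G 2 flip: d(3))
  show "v \<in> Ob W \<Longrightarrow> w \<in> Ob W \<Longrightarrow> u \<in> Obj (Hom W v w) \<Longrightarrow> \<phi> \<in> Arr (TObj F v) \<Longrightarrow>
      AMap (\<alpha> w) (AMap (T1 F v w u) \<phi>)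
        = comp2 K A (TObj G v) (TObj G w) (Ident (Hom K (TObj G v) (TObj G w)) (T1 G v w u)) (AMap (\<alpha> v) \<phi>)"
    by (simp add: G 2 flip: d(4))
  show "v \<in> Ob W \<Longrightarrow> w \<in> Ob W \<Longrightarrow> s \<in> Arr (Hom W v w) \<Longrightarrow> x \<in> Obj (TObj F v) \<Longrightarrow>
      AMap (\<alpha> w) (Cmp (T2 F v w s) x)
        = comp2 K A (TObj G v) (TObj G w) (T2 G v w s) (Ident (Hom K A (TObj G v)) (OMap (\<alpha> v) x))"
    by (simp add: G 2 flip: d(5))
qed

lemma cone_comp_simps [simp]:
  "w \<in> Ob W \<Longrightarrow> x \<in> Obj (TObj F w) \<Longrightarrow> OMap (cone_comp A B \<alpha> h w) x = comp1 K B A (TObj G w) (OMap (\<alpha> w) x) h"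
  "w \<in> Ob W \<Longrightarrow> \<phi> \<in> Arr (TObj F w) \<Longrightarrow>
     AMap (cone_comp A B \<alpha> h w) \<phi> = comp2 K B A (TObj G w) (AMap (\<alpha> w) \<phi>) (Ident (Hom K B A) h)"
  by (simp_all add: cone_comp_def)

lemma cone_comp2_simps [simp]:
  "Src (cone_comp2 A B \<alpha> t) = cone_comp A B \<alpha> (Dom (Hom K B A) t)"
  "Tgt (cone_comp2 A B \<alpha> t) = cone_comp A B \<alpha> (Cod (Hom K B A) t)"
  "w \<in> Ob W \<Longrightarrow> Src (Cmp (cone_comp2 A B \<alpha> t) w) = cone_comp A B \<alpha> (Dom (Hom K B A) t) w"
  "w \<in> Ob W \<Longrightarrow> Tgt (Cmp (cone_comp2 A B \<alpha> t) w) = cone_comp A B \<alpha> (Cod (Hom K B A) t) w"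
  "w \<in> Ob W \<Longrightarrow> x \<in> Obj (TObj F w) \<Longrightarrow> Cmp (Cmp (cone_comp2 A B \<alpha> t) w) x =
     comp2 K B A (TObj G w) (Ident (Hom K A (TObj G w)) (OMap (\<alpha> w) x)) t"
  by (simp_all add: cone_comp2_def)

lemma comp2_Comp_Ident:
  assumes "A \<in> Ob K" "B \<in> Ob K" "C \<in> Ob K" "h \<in> Obj (Hom K A B)"
    and "s \<in> Arr (Hom K B C)" "t \<in> Arr (Hom K B C)" "Cod (Hom K B C) s = Dom (Hom K B C) t"
  shows "comp2 K A B C (Comp (Hom K B C) t s) (Ident (Hom K A B) h)
    = Comp (Hom K A C) (comp2 K A B C t (Ident (Hom K A B) h)) (comp2 K A B C s (Ident (Hom K A B) h))"
  using kc(6)[OF assms(1-3), of "Ident (Hom K A B) h" "Ident (Hom K A B) h" s t] assms by (simp add: cc)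

lemma comp2_Ident_Comp:
  assumes "A \<in> Ob K" "B \<in> Ob K" "C \<in> Ob K" "h \<in> Obj (Hom K B C)"
    and "s \<in> Arr (Hom K A B)" "t \<in> Arr (Hom K A B)" "Cod (Hom K A B) s = Dom (Hom K A B) t"
  shows "comp2 K A B C (Ident (Hom K B C) h) (Comp (Hom K A B) t s)
    = Comp (Hom K A C) (comp2 K A B C (Ident (Hom K B C) h) t) (comp2 K A B C (Ident (Hom K B C) h) s)"
  using kc(6)[OF assms(1-3), of s t "Ident (Hom K B C) h" "Ident (Hom K B C) h"] assms by (simp add: cc)

text \<open>
  The action of the weight on a cone is by composition on the left, the restriction by composition
  on the right; so 2-naturality is inherited by associativity.
\<close>

lemma two_nat_cone_comp:
  assumes A: "A \<in> Ob K" and B: "B \<in> Ob K" and a: "two_nat W F (hom A) \<alpha>" and h: "h \<in> Obj (Hom K B A)"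
  shows "two_nat W F (hom B) (cone_comp A B \<alpha> h)"
proof -
  note d = coneD[OF A a]
  note [simp] = A B h
  have 1: "is_functor (TObj F w) (Hom K B (TObj G w)) (cone_comp A B \<alpha> h w)" if w: "w \<in> Ob W" for w
  proof -
    have "OMap (cone_comp A B \<alpha> h w) \<in> extensional (Obj (TObj F w))"
      "AMap (cone_comp A B \<alpha> h w) \<in> extensional (Arr (TObj F w))" using w by (auto simp: cone_comp_def)
    then show ?thesis
      unfolding is_functor_def PiE_def by (auto simp: w f d kc cc g catD[OF f(1)] comp2_Comp_Ident)
  qed
  moreover have "comp2 K B (TObj G v) (TObj G w) (T2 G v w s) (Ident (Hom K B (TObj G v)) (comp1 K B A (TObj G v) (OMap (\<alpha> v) x) h)) =
     comp2 K B A (TObj G w) (comp2 K A (TObj G v) (TObj G w) (T2 G v w s) (Ident (Hom K A (TObj G v)) (OMap (\<alpha> v) x))) (Ident (Hom K B A) h)"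
    if "v \<in> Ob W" "w \<in> Ob W" "s \<in> Arr (Hom W v w)" "x \<in> Obj (TObj F v)" for v w s x
    using that by (simp add: g ga d cc kas(2)[symmetric] kc(5))
  ultimately show ?thesis
    unfolding two_nat_iff[OF W F hom[OF B]]
    by (auto simp: G g ga d kc(1-4) kas cc f fo fa) (auto simp: cone_comp_def)
qed

lemma modification_cone_comp2:
  assumes A: "A \<in> Ob K" and B: "B \<in> Ob K" and a: "two_nat W F (hom A) \<alpha>" and t: "t \<in> Arr (Hom K B A)"
  shows "modification W F (hom B) (cone_comp2 A B \<alpha> t)"
proof -
  note d = coneD[OF A a]
  note [simp] = A B t
  have 0: "two_nat W F (hom B) (cone_comp A B \<alpha> (Dom (Hom K B A) t))"
    "two_nat W F (hom B) (cone_comp A B \<alpha> (Cod (Hom K B A) t))"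
    by (simp_all add: two_nat_cone_comp a cc)
  have 1: "is_nt (TObj F w) (Hom K B (TObj G w)) (Cmp (cone_comp2 A B \<alpha> t) w)" if w: "w \<in> Ob W" for w
  proof -
    have "Comp (Hom K B (TObj G w)) (comp2 K B A (TObj G w) (Ident (Hom K A (TObj G w)) (OMap (\<alpha> w) (Cod (TObj F w) \<phi>))) t)
          (comp2 K B A (TObj G w) (AMap (\<alpha> w) \<phi>) (Ident (Hom K B A) (Dom (Hom K B A) t))) =
        Comp (Hom K B (TObj G w)) (comp2 K B A (TObj G w) (AMap (\<alpha> w) \<phi>) (Ident (Hom K B A) (Cod (Hom K B A) t)))
          (comp2 K B A (TObj G w) (Ident (Hom K A (TObj G w)) (OMap (\<alpha> w) (Dom (TObj F w) \<phi>))) t)"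
      if p: "\<phi> \<in> Arr (TObj F w)" for \<phi>
      by (subst (1 2) kc(6)[symmetric]) (simp_all add: w p g d cc catD[OF f(1)])
    moreover have "Cmp (Cmp (cone_comp2 A B \<alpha> t) w) \<in> extensional (Obj (TObj F w))" using w by (simp add: cone_comp2_def)
    ultimately show ?thesis
      unfolding is_nt_def PiE_def using coneD(1)[OF B 0(1)] coneD(1)[OF B 0(2)]
      by (auto simp: w d kc cc g catD[OF f(1)])
  qed
  have "comp2 K B (TObj G v) (TObj G w) (Ident (Hom K (TObj G v) (TObj G w)) (T1 G v w u))
       (comp2 K B A (TObj G v) (Ident (Hom K A (TObj G v)) (OMap (\<alpha> v) x)) t) =
     comp2 K B A (TObj G w) (Ident (Hom K A (TObj G w)) (comp1 K A (TObj G v) (TObj G w) (T1 G v w u) (OMap (\<alpha> v) x))) t"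
    if "v \<in> Ob W" "w \<in> Ob W" "u \<in> Obj (Hom W v w)" "x \<in> Obj (TObj F v)" for v w u x
    using that by (subst kas(2)) (simp_all add: g ga d cc kc(5))
  then show ?thesis
    unfolding modification_iff[OF W F hom[OF B]] using 0 1
    by (auto simp: G g ga d kc(1-4) cc f fo fa) (auto simp: cone_comp2_def)
qed

lemma cones_TObj: "TObj (cones K W F G) A = two_nat_cat W F (hom A)"
  by (simp add: cones_def Let_def)

text \<open>
  The 2-functor of cones is defined by pasting with representables of the opposite 2-category; the next
  two lemmas evaluate it.
\<close>

lemma cones_1:
  assumes A: "A \<in> Ob K" and B: "B \<in> Ob K" and h: "h \<in> Obj (Hom K B A)"
  shows "two_nat W F (hom A) \<alpha> \<Longrightarrow> OMap (T1 (cones K W F G) A B h) \<alpha> = cone_comp A B \<alpha> h"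
    and "modification W F (hom A) m \<Longrightarrow> AMap (T1 (cones K W F G) A B h) m = modif_comp A B m h"
proof -
  have pre: "(\<lambda>w\<in>Ob W. functor_comp (TObj F w) (T1 (representable (op_two_cat K) (TObj G w)) A B h) (\<alpha> w)) = cone_comp A B \<alpha> h"
    if a: "two_nat W F (hom A) \<alpha>" for \<alpha>
    unfolding cone_comp_def functor_comp_def
    using h by (auto intro!: restrict_ext functr.equality simp: coneD[OF A a] g cc A B)
  show "two_nat W F (hom A) \<alpha> \<Longrightarrow> OMap (T1 (cones K W F G) A B h) \<alpha> = cone_comp A B \<alpha> h"
    using h pre by (simp add: cones_def Let_def)
  assume m: "modification W F (hom A) m"
  note md = modificationD[OF W F hom[OF A] m]
  have "hcomp (TObj F w) (Hom K B (TObj G w)) (nt_id (Hom K A (TObj G w)) (Hom K B (TObj G w))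
       (T1 (representable (op_two_cat K) (TObj G w)) A B h)) (Cmp m w) =
     \<lparr>Src = cone_comp A B (Src m) h w, Tgt = cone_comp A B (Tgt m) h w,
         Cmp = (\<lambda>x\<in>Obj (TObj F w).
           comp2 K B A (TObj G w) (Cmp (Cmp m w) x) (Ident (Hom K B A) h))\<rparr>" if w: "w \<in> Ob W" for w
  proof -
    have n: "is_nt (TObj F w) (Hom K A (TObj G w)) (Cmp m w)" using md(4) w by simp
    have T: "is_functor (Hom K A (TObj G w)) (Hom K B (TObj G w)) (T1 (representable (op_two_cat K) (TObj G w)) A B h)"
      using cat_valuedD(2)[OF two_functor_representable[OF two_category_op[OF K], of "TObj G w"], of A B h] A B h g w by simp
    have "hcomp (TObj F w) (Hom K B (TObj G w)) (nt_id (Hom K A (TObj G w)) (Hom K B (TObj G w))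
       (T1 (representable (op_two_cat K) (TObj G w)) A B h)) (Cmp m w) =
      \<lparr>Src = functor_comp (TObj F w) (T1 (representable (op_two_cat K) (TObj G w)) A B h) (Src (Cmp m w)),
       Tgt = functor_comp (TObj F w) (T1 (representable (op_two_cat K) (TObj G w)) A B h) (Tgt (Cmp m w)),
       Cmp = (\<lambda>x\<in>Obj (TObj F w). AMap (T1 (representable (op_two_cat K) (TObj G w)) A B h) (Cmp (Cmp m w) x))\<rparr>"
      by (rule whisker_left) (simp_all add: f k A B w g n T)
    then show ?thesis
      using fun_cong[OF pre[OF md(1)], of w] fun_cong[OF pre[OF md(2)], of w] w ntD(3)[OF n] h
      by (auto intro!: restrict_ext simp: md(5,6) cc A B)
  qed
  then show "AMap (T1 (cones K W F G) A B h) m = modif_comp A B m h"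
    using h m pre[OF md(1)] pre[OF md(2)] unfolding modif_comp_def by (auto simp: cones_def Let_def intro!: restrict_ext)
qed

lemma cones_2:
  assumes A: "A \<in> Ob K" and B: "B \<in> Ob K" and t: "t \<in> Arr (Hom K B A)"
  shows "Src (T2 (cones K W F G) A B t) = T1 (cones K W F G) A B (Dom (Hom K B A) t)"
    and "Tgt (T2 (cones K W F G) A B t) = T1 (cones K W F G) A B (Cod (Hom K B A) t)"
    and "two_nat W F (hom A) \<alpha> \<Longrightarrow> Cmp (T2 (cones K W F G) A B t) \<alpha> = cone_comp2 A B \<alpha> t"
proof -
  show "Src (T2 (cones K W F G) A B t) = T1 (cones K W F G) A B (Dom (Hom K B A) t)"
    "Tgt (T2 (cones K W F G) A B t) = T1 (cones K W F G) A B (Cod (Hom K B A) t)"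
    using t by (auto simp: cones_def Let_def cc A B)
  assume a: "two_nat W F (hom A) \<alpha>"
  note d = coneD[OF A a]
  have h: "Dom (Hom K B A) t \<in> Obj (Hom K B A)" "Cod (Hom K B A) t \<in> Obj (Hom K B A)" using t by (simp_all add: cc A B)
  have pre: "functor_comp (TObj F w) (T1 (representable (op_two_cat K) (TObj G w)) A B h) (\<alpha> w) = cone_comp A B \<alpha> h w"
    if w: "w \<in> Ob W" and h: "h \<in> Obj (Hom K B A)" for h w
    unfolding cone_comp_def functor_comp_def
    using h w by (auto intro!: restrict_ext functr.equality simp: d g cc A B)
  have "hcomp (TObj F w) (Hom K B (TObj G w)) (T2 (representable (op_two_cat K) (TObj G w)) A B t)
      (nt_id (TObj F w) (Hom K A (TObj G w)) (\<alpha> w)) = Cmp (cone_comp2 A B \<alpha> t) w" if w: "w \<in> Ob W" for w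
  proof -
    note R = cat_valuedD[OF two_functor_representable[OF two_category_op[OF K], of "TObj G w"]]
    have "hcomp (TObj F w) (Hom K B (TObj G w)) (T2 (representable (op_two_cat K) (TObj G w)) A B t)
      (nt_id (TObj F w) (Hom K A (TObj G w)) (\<alpha> w)) =
      \<lparr>Src = functor_comp (TObj F w) (Src (T2 (representable (op_two_cat K) (TObj G w)) A B t)) (\<alpha> w),
       Tgt = functor_comp (TObj F w) (Tgt (T2 (representable (op_two_cat K) (TObj G w)) A B t)) (\<alpha> w),
       Cmp = (\<lambda>x\<in>Obj (TObj F w). Cmp (T2 (representable (op_two_cat K) (TObj G w)) A B t) (OMap (\<alpha> w) x))\<rparr>"
      using R(3) by (intro whisker_right) (simp_all add: f k A B w g d t)
    then show ?thesis
      using w t R(4,5) by (auto intro!: restrict_ext simp: cone_comp2_def pre h A B d g cc)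
  qed
  then show "Cmp (T2 (cones K W F G) A B t) \<alpha> = cone_comp2 A B \<alpha> t"
    using t a by (auto simp: cones_def Let_def cone_comp2_def pre h intro!: restrict_ext)
     (auto simp: cone_comp_def pre h cong: restrict_cong)
qed


text \<open>The transformation \<open>K(-, L) \<rightarrow> [W, Cat](F, K(-, G))\<close> that corresponds to a cone under the Yoneda lemma.\<close>

definition yoneda :: "'o \<Rightarrow> ('w \<Rightarrow> ('p, 'b, 'a, 'c) functr) \<Rightarrow> 'o
    \<Rightarrow> ('a, 'c, 'w \<Rightarrow> ('p, 'b, 'a, 'c) functr, ('w, 'p, 'b, 'a, 'c) modif) functr" where
  "yoneda L \<kappa> A = \<lparr>OMap = (\<lambda>h\<in>Obj (Hom K A L). cone_comp L A \<kappa> h),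
                 AMap = (\<lambda>t\<in>Arr (Hom K A L). cone_comp2 L A \<kappa> t)\<rparr>"

lemma functor_yoneda:
  assumes L: "L \<in> Ob K" and l: "two_nat W F (hom L) \<kappa>" and A: "A \<in> Ob K"
  shows "is_functor (Hom K A L) (two_nat_cat W F (hom A)) (yoneda L \<kappa> A)"
proof -
  note d = coneD[OF L l]
  note C = category_two_nat_cat[OF W F hom[OF A]]
  note m = modification_cone_comp2[OF L A l] and o = two_nat_cone_comp[OF L A l]
  have 1: "cone_comp2 L A \<kappa> (Ident (Hom K A L) h) = Ident (two_nat_cat W F (hom A)) (cone_comp L A \<kappa> h)"
    if h: "h \<in> Obj (Hom K A L)" for h
    using catD(3)[OF C, of "cone_comp L A \<kappa> h"] h o[OF h]
    by (intro modification_eqI[OF W F hom[OF A] m]) (simp_all add: cc A L h d kc(5) g)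
  have 2: "cone_comp2 L A \<kappa> (Comp (Hom K A L) t s)
      = Comp (two_nat_cat W F (hom A)) (cone_comp2 L A \<kappa> t) (cone_comp2 L A \<kappa> s)"
    if s: "s \<in> Arr (Hom K A L)" "t \<in> Arr (Hom K A L)" "Cod (Hom K A L) s = Dom (Hom K A L) t" for s t
    using catD(6)[OF C, of "cone_comp2 L A \<kappa> s" "cone_comp2 L A \<kappa> t"] s m[OF s(1)] m[OF s(2)]
    by (intro modification_eqI[OF W F hom[OF A] m]) (simp_all add: cc A L d g comp2_Ident_Comp)
  show ?thesis
    unfolding is_functor_def yoneda_def using 1 2 by (auto simp: m o cc A L)
qed

text \<open>
  Restricting a cone along \<open>k\<close> and then along \<open>h\<close> is restricting it along \<open>k \<circ> h\<close>, and likewise for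
  2-cells. This is all that 2-naturality in the vertex amounts to.
\<close>

lemma two_nat_yoneda:
  assumes L: "L \<in> Ob K" and l: "two_nat W F (hom L) \<kappa>"
  shows "two_nat (op_two_cat K) (representable (op_two_cat K) L) (cones K W F G) (restrict (yoneda L \<kappa>) (Ob K))"
proof -
  let ?R = "representable (op_two_cat K) L"
  note d = coneD[OF L l]
  note R = cat_valuedD[OF two_functor_representable[OF two_category_op[OF K], of L], simplified, OF L]
  have as: "cone_comp A B (cone_comp L A \<kappa> k) h = cone_comp L B \<kappa> (comp1 K B A L k h)"
    if o: "A \<in> Ob K" "B \<in> Ob K" "h \<in> Obj (Hom K B A)" "k \<in> Obj (Hom K A L)" for A B h k
    unfolding cone_comp_def using o
    by (auto intro!: restrict_ext simp: cc L d g kas kc(5)[symmetric])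
  have mc: "modif_comp A B (cone_comp2 L A \<kappa> t) h = cone_comp2 L B \<kappa> (comp2 K B A L t (Ident (Hom K B A) h))"
    if o: "A \<in> Ob K" "B \<in> Ob K" "h \<in> Obj (Hom K B A)" "t \<in> Arr (Hom K A L)" for A B h t
    unfolding modif_comp_def cone_comp2_def using o
    by (auto intro!: restrict_ext simp: as cc kc(3,4) L d g kas(2))
  have c1: "functor_comp (Hom K A L) (T1 (cones K W F G) A B h) (yoneda L \<kappa> A)
      = functor_comp (Hom K A L) (yoneda L \<kappa> B) (T1 ?R A B h)"
    if o: "A \<in> Ob K" "B \<in> Ob K" and h: "h \<in> Obj (Hom K B A)" for A B h
    unfolding fcomp_eq_iff using o h
    by (auto simp: yoneda_def as mc cones_1 two_nat_cone_comp[OF L _ l] modification_cone_comp2[OF L _ l] kc(1,2) cc L)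
  have c2: "hcomp (Hom K A L) (two_nat_cat W F (hom B)) (T2 (cones K W F G) A B t)
       (nt_id (Hom K A L) (two_nat_cat W F (hom A)) (yoneda L \<kappa> A)) =
     hcomp (Hom K A L) (two_nat_cat W F (hom B))
       (nt_id (Hom K B L) (two_nat_cat W F (hom B)) (yoneda L \<kappa> B)) (T2 ?R A B t)"
    if o: "A \<in> Ob K" "B \<in> Ob K" and t: "t \<in> Arr (Hom K B A)" for A B t
  proof -
    note [simp] = L o t
    have h: "Dom (Hom K B A) t \<in> Obj (Hom K B A)" "Cod (Hom K B A) t \<in> Obj (Hom K B A)" by (simp_all add: cc)
    note C = category_two_nat_cat[OF W F hom[OF o(2)]]
    have r: "hcomp (Hom K A L) (two_nat_cat W F (hom B))
       (nt_id (Hom K B L) (two_nat_cat W F (hom B)) (yoneda L \<kappa> B)) (T2 ?R A B t) =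
       \<lparr>Src = functor_comp (Hom K A L) (yoneda L \<kappa> B) (Src (T2 ?R A B t)),
        Tgt = functor_comp (Hom K A L) (yoneda L \<kappa> B) (Tgt (T2 ?R A B t)),
        Cmp = (\<lambda>k\<in>Obj (Hom K A L). AMap (yoneda L \<kappa> B) (Cmp (T2 ?R A B t) k))\<rparr>"
      using R(3)[of A B t] by (intro whisker_left k functor_yoneda[OF L l] C) auto
    have id: "modif_comp A B (Ident (two_nat_cat W F (hom A)) \<alpha>) h = Ident (two_nat_cat W F (hom B)) (cone_comp A B \<alpha> h)"
      if "two_nat W F (hom A) \<alpha>" "h \<in> Obj (Hom K B A)" for \<alpha> h
      unfolding modif_comp_def two_nat_cat_def nt_id_def using that(2)
      by (auto intro!: restrict_ext simp: coneD[OF o(1) that(1)] kc(5) g)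
    have wh: "cone_comp2 A B (cone_comp L A \<kappa> k) t = cone_comp2 L B \<kappa> (comp2 K B A L (Ident (Hom K A L) k) t)"
      if k: "k \<in> Obj (Hom K A L)" for k
      unfolding cone_comp2_def using k
      by (auto intro!: restrict_ext simp: as cc kc(3,4) d g kas(2) kc(5)[symmetric])
    have "Comp (two_nat_cat W F (hom B)) (cone_comp2 A B (cone_comp L A \<kappa> k) t)
        (Ident (two_nat_cat W F (hom B)) (cone_comp A B (cone_comp L A \<kappa> k) (Dom (Hom K B A) t)))
        = cone_comp2 L B \<kappa> (comp2 K B A L (Ident (Hom K A L) k) t)" if k: "k \<in> Obj (Hom K A L)" for k
      using catD(9)[OF C, of "cone_comp2 A B (cone_comp L A \<kappa> k) t"] k wh[OF k]
        modification_cone_comp2[OF o two_nat_cone_comp[OF L o(1) l k] t]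
      by (simp add: as kc(3) cc h)
    then show ?thesis
      unfolding r unfolding hcomp_def
      using c1[OF o h(1)] c1[OF o h(2)] R(4)[of A B t] R(5)[of A B t] h
      by (auto intro!: restrict_ext simp: cones_2 cones_1 id yoneda_def kc(2) cc two_nat_cone_comp[OF L _ l]
         modification_cone_comp2[OF L _ l] catD(3)[OF category_two_nat_cat[OF W F hom[OF o(1)]], simplified])
  qed
  show ?thesis
    unfolding two_nat_def using functor_yoneda[OF L l] c1 c2 by (auto simp: cones_TObj)
qed

text \<open>
  A functor that is bijective on objects and on arrows is an isomorphism, so nothing about inverses or
  their naturality remains to be checked for a concrete cone.
\<close>

lemma weighted_limitI:
  assumes L: "L \<in> Ob K" and l: "two_nat W F (hom L) \<kappa>"
    and o: "\<And>A. A \<in> Ob K \<Longrightarrow> bij_betw (cone_comp L A \<kappa>) (Obj (Hom K A L)) {\<alpha>. two_nat W F (hom A) \<alpha>}"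
    and a: "\<And>A. A \<in> Ob K \<Longrightarrow> bij_betw (cone_comp2 L A \<kappa>) (Arr (Hom K A L)) {m. modification W F (hom A) m}"
  shows "is_weighted_limit K W F G L (restrict (yoneda L \<kappa>) (Ob K))"
proof -
  have "is_cat_iso (Hom K A L) (two_nat_cat W F (hom A)) (yoneda L \<kappa> A)" if A: "A \<in> Ob K" for A
    using o[OF A] a[OF A]
    by (intro cat_isoI functor_yoneda[OF L l A] k(1) A L category_two_nat_cat[OF W F hom[OF A]])
      (simp_all, simp_all add: yoneda_def cong: bij_betw_cong)
  then show ?thesis
    unfolding is_weighted_limit_def using L two_nat_yoneda[OF L l] by simp
qed

end


section \<open>Pullbacks up to isomorphism\<close>

lemma pullbackD:
  assumes "is_pullback C j f p q"
  shows "j \<in> Arr C" "f \<in> Arr C" "p \<in> Arr C" "q \<in> Arr C" "Cod C j = Cod C f" "Cod C p = Dom C f"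
    "Cod C q = Dom C j" "Dom C q = Dom C p" "Comp C f p = Comp C j q"
  using assms unfolding is_pullback_def by simp_all

lemma pullback_ex1:
  assumes "is_pullback C j f p q" "x \<in> Arr C" "y \<in> Arr C" "Dom C x = Dom C y" "Cod C x = Dom C f"
    "Cod C y = Dom C j" "Comp C f x = Comp C j y"
  shows "\<exists>!z. z \<in> Arr C \<and> Dom C z = Dom C x \<and> Cod C z = Dom C p \<and> Comp C p z = x \<and> Comp C q z = y"
  using assms unfolding is_pullback_def by blast

lemma pullback_factor:
  assumes "is_pullback C j f p q" "x \<in> Arr C" "y \<in> Arr C" "Dom C x = Dom C y" "Cod C x = Dom C f"
    "Cod C y = Dom C j" "Comp C f x = Comp C j y"
  obtains z where "z \<in> Arr C" "Dom C z = Dom C x" "Cod C z = Dom C p" "Comp C p z = x" "Comp C q z = y"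
  using pullback_ex1[OF assms] by blast

lemma pullback_jointly_monic:
  assumes C: "category C" and pb: "is_pullback C j f p q"
    and z: "z \<in> Arr C" "Cod C z = Dom C p" and z': "z' \<in> Arr C" "Cod C z' = Dom C p" and d: "Dom C z = Dom C z'"
    and e: "Comp C p z = Comp C p z'" "Comp C q z = Comp C q z'"
  shows "z = z'"
proof -
  note p = pullbackD[OF pb]
  have "Comp C f (Comp C p z) = Comp C j (Comp C q z)"
    using p z by (simp add: cat_assoc[OF C])
  then have "\<exists>!y. y \<in> Arr C \<and> Dom C y = Dom C (Comp C p z) \<and> Cod C y = Dom C p \<and> Comp C p y = Comp C p z \<and> Comp C q y = Comp C q z"
    using p z by (intro pullback_ex1[OF pb]) (simp_all add: catD[OF C])
  then show ?thesis using z z' d e p by (auto simp: catD[OF C])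
qed

lemma pullback_iso:
  assumes C: "category C" and pb: "is_pullback C j f p q"
    and k: "k \<in> Arr C" "k' \<in> Arr C" "Cod C k = Dom C p" "Dom C k' = Dom C p" "Cod C k' = Dom C k"
    and i: "Comp C k' k = Ident C (Dom C k)" "Comp C k k' = Ident C (Dom C p)"
  shows "is_pullback C j f (Comp C p k) (Comp C q k)"
proof -
  note p = pullbackD[OF pb]
  note [simp] = p k i catD[OF C]
  have 1: "\<exists>!z. z \<in> Arr C \<and> Dom C z = Dom C x \<and> Cod C z = Dom C k \<and>
              Comp C (Comp C p k) z = x \<and> Comp C (Comp C q k) z = y"
    if x: "x \<in> Arr C" "y \<in> Arr C" "Dom C x = Dom C y" "Cod C x = Dom C f" "Cod C y = Dom C j" "Comp C f x = Comp C j y" for x y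
  proof -
    obtain z where z: "z \<in> Arr C" "Dom C z = Dom C x" "Cod C z = Dom C p" "Comp C p z = x" "Comp C q z = y"
      using pullback_factor[OF pb x] .
    show ?thesis
    proof (intro ex1I[of _ "Comp C k' z"] conjI)
      have a: "Comp C k (Comp C k' z) = z" using z by (simp add: cat_assoc[OF C])
      show "Comp C (Comp C p k) (Comp C k' z) = x" "Comp C (Comp C q k) (Comp C k' z) = y"
        using z by (simp_all add: a flip: cat_assoc[OF C])
      fix z' assume z': "z' \<in> Arr C \<and> Dom C z' = Dom C x \<and> Cod C z' = Dom C k \<and>
              Comp C (Comp C p k) z' = x \<and> Comp C (Comp C q k) z' = y"
      have "Comp C k z' = z"
        by (rule pullback_jointly_monic[OF C pb]) (use z' z in \<open>simp_all add: cat_assoc[OF C]\<close>)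
      then have "Comp C k' z = Comp C k' (Comp C k z')" by simp
      also have "\<dots> = z'" using z' by (subst cat_assoc[OF C]) simp_all
      finally show "z' = Comp C k' z" by simp
    qed (use z in simp_all)
  qed
  have "Comp C f (Comp C p k) = Comp C j (Comp C q k)" by (simp add: cat_assoc[OF C])
  then show ?thesis unfolding is_pullback_def using 1 by simp
qed

lemma pullbacks_isomorphic:
  assumes C: "category C" and pb: "is_pullback C j f p q" and pb': "is_pullback C j f p' q'"
  obtains k k' where "k \<in> Arr C" "k' \<in> Arr C" "Dom C k = Dom C p" "Cod C k = Dom C p'" "Dom C k' = Dom C p'"
    "Cod C k' = Dom C p" "Comp C k' k = Ident C (Dom C p)" "Comp C k k' = Ident C (Dom C p')"
    "Comp C p' k = p" "Comp C q' k = q"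
proof -
  note p = pullbackD[OF pb] and p' = pullbackD[OF pb']
  note [simp] = p p' catD[OF C]
  obtain k where k: "k \<in> Arr C" "Dom C k = Dom C p" "Cod C k = Dom C p'" "Comp C p' k = p" "Comp C q' k = q"
    using pullback_factor[OF pb', of p q] by auto
  obtain k' where k': "k' \<in> Arr C" "Dom C k' = Dom C p'" "Cod C k' = Dom C p" "Comp C p k' = p'" "Comp C q k' = q'"
    using pullback_factor[OF pb, of p' q'] by auto
  have "Comp C k' k = Ident C (Dom C p)"
    by (rule pullback_jointly_monic[OF C pb]) (use k k' in \<open>simp_all add: cat_assoc[OF C]\<close>)
  moreover have "Comp C k k' = Ident C (Dom C p')"
    by (rule pullback_jointly_monic[OF C pb']) (use k k' in \<open>simp_all add: cat_assoc[OF C]\<close>)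
  ultimately show thesis using that k k' by blast
qed

section \<open>A pointwise base on the category of transformations\<close>

text \<open>Families of values made into a modification and into a 2-natural transformation, extensionally.\<close>

definition mk_modif :: "('o, 'a, 'c) two_cat \<Rightarrow> ('o, 'a, 'c, 'p, 'b) cat_valued
    \<Rightarrow> ('o \<Rightarrow> ('p, 'b, 'q, 'd) functr) \<Rightarrow> ('o \<Rightarrow> ('p, 'b, 'q, 'd) functr) \<Rightarrow> ('o \<Rightarrow> 'p \<Rightarrow> 'd)
    \<Rightarrow> ('o, 'p, 'b, 'q, 'd) modif" where
  "mk_modif W F \<alpha> \<beta> z = \<lparr>Src = \<alpha>, Tgt = \<beta>,
     Cmp = (\<lambda>w\<in>Ob W. \<lparr>Src = \<alpha> w, Tgt = \<beta> w, Cmp = (\<lambda>x\<in>Obj (TObj F w). z w x)\<rparr>)\<rparr>"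

lemma mk_modif_simps [simp]: "Src (mk_modif W F \<alpha> \<beta> z) = \<alpha>" "Tgt (mk_modif W F \<alpha> \<beta> z) = \<beta>"
  "w \<in> Ob W \<Longrightarrow> x \<in> Obj (TObj F w) \<Longrightarrow> Cmp (Cmp (mk_modif W F \<alpha> \<beta> z) w) x = z w x"
  by (auto simp: mk_modif_def)

lemma modification_mk_modif:
  assumes W: "two_category W" and F: "two_functor W CAT F" and H: "two_functor W CAT H"
    and a: "two_nat W F H \<alpha>" and b: "two_nat W F H \<beta>"
    and z: "\<And>w x. w \<in> Ob W \<Longrightarrow> x \<in> Obj (TObj F w) \<Longrightarrow> z w x \<in> Arr (TObj H w)"
      "\<And>w x. w \<in> Ob W \<Longrightarrow> x \<in> Obj (TObj F w) \<Longrightarrow> Dom (TObj H w) (z w x) = OMap (\<alpha> w) x"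
      "\<And>w x. w \<in> Ob W \<Longrightarrow> x \<in> Obj (TObj F w) \<Longrightarrow> Cod (TObj H w) (z w x) = OMap (\<beta> w) x"
    and n: "\<And>w \<phi>. w \<in> Ob W \<Longrightarrow> \<phi> \<in> Arr (TObj F w) \<Longrightarrow>
      Comp (TObj H w) (z w (Cod (TObj F w) \<phi>)) (AMap (\<alpha> w) \<phi>) = Comp (TObj H w) (AMap (\<beta> w) \<phi>) (z w (Dom (TObj F w) \<phi>))"
    and c: "\<And>v w u x. v \<in> Ob W \<Longrightarrow> w \<in> Ob W \<Longrightarrow> u \<in> Obj (Hom W v w) \<Longrightarrow> x \<in> Obj (TObj F v) \<Longrightarrow>
      AMap (T1 H v w u) (z v x) = z w (OMap (T1 F v w u) x)"
  shows "modification W F H (mk_modif W F \<alpha> \<beta> z)"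
proof -
  note f = cat_valuedD[OF F]
  have "is_nt (TObj F w) (TObj H w) (Cmp (mk_modif W F \<alpha> \<beta> z) w)" if w: "w \<in> Ob W" for w
    using w two_natD(2)[OF W F H a w] two_natD(2)[OF W F H b w]
    unfolding is_nt_def by (auto simp: mk_modif_def z n catD[OF f(1)])
  then show ?thesis
    unfolding modification_iff[OF W F H] using a b
    by (auto simp: c functorD[OF f(2)]) (auto simp: mk_modif_def)
qed

definition mk_two_nat :: "('o, 'a, 'c) two_cat \<Rightarrow> ('o, 'a, 'c, 'p, 'b) cat_valued
    \<Rightarrow> ('o \<Rightarrow> 'p \<Rightarrow> 'q) \<Rightarrow> ('o \<Rightarrow> 'b \<Rightarrow> 'd) \<Rightarrow> 'o \<Rightarrow> ('p, 'b, 'q, 'd) functr" where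
  "mk_two_nat W F O' A = (\<lambda>w\<in>Ob W. \<lparr>OMap = restrict (O' w) (Obj (TObj F w)), AMap = restrict (A w) (Arr (TObj F w))\<rparr>)"

lemma mk_two_nat_simps [simp]:
  "w \<in> Ob W \<Longrightarrow> x \<in> Obj (TObj F w) \<Longrightarrow> OMap (mk_two_nat W F O' A w) x = O' w x"
  "w \<in> Ob W \<Longrightarrow> \<phi> \<in> Arr (TObj F w) \<Longrightarrow> AMap (mk_two_nat W F O' A w) \<phi> = A w \<phi>"
  by (auto simp: mk_two_nat_def)

lemma two_nat_mk_two_nat:
  assumes W: "two_category W" and F: "two_functor W CAT F" and H: "two_functor W CAT H"
    and o: "\<And>w x. w \<in> Ob W \<Longrightarrow> x \<in> Obj (TObj F w) \<Longrightarrow> O' w x \<in> Obj (TObj H w)"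
    and a: "\<And>w \<phi>. w \<in> Ob W \<Longrightarrow> \<phi> \<in> Arr (TObj F w) \<Longrightarrow> A w \<phi> \<in> Arr (TObj H w)"
      "\<And>w \<phi>. w \<in> Ob W \<Longrightarrow> \<phi> \<in> Arr (TObj F w) \<Longrightarrow> Dom (TObj H w) (A w \<phi>) = O' w (Dom (TObj F w) \<phi>)"
      "\<And>w \<phi>. w \<in> Ob W \<Longrightarrow> \<phi> \<in> Arr (TObj F w) \<Longrightarrow> Cod (TObj H w) (A w \<phi>) = O' w (Cod (TObj F w) \<phi>)"
      "\<And>w x. w \<in> Ob W \<Longrightarrow> x \<in> Obj (TObj F w) \<Longrightarrow> A w (Ident (TObj F w) x) = Ident (TObj H w) (O' w x)"
      "\<And>w \<phi> \<psi>. w \<in> Ob W \<Longrightarrow> \<phi> \<in> Arr (TObj F w) \<Longrightarrow> \<psi> \<in> Arr (TObj F w) \<Longrightarrow> Cod (TObj F w) \<phi> = Dom (TObj F w) \<psi> \<Longrightarrow>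
         A w (Comp (TObj F w) \<psi> \<phi>) = Comp (TObj H w) (A w \<psi>) (A w \<phi>)"
    and u: "\<And>v w u x. v \<in> Ob W \<Longrightarrow> w \<in> Ob W \<Longrightarrow> u \<in> Obj (Hom W v w) \<Longrightarrow> x \<in> Obj (TObj F v) \<Longrightarrow>
         OMap (T1 H v w u) (O' v x) = O' w (OMap (T1 F v w u) x)"
      "\<And>v w u \<phi>. v \<in> Ob W \<Longrightarrow> w \<in> Ob W \<Longrightarrow> u \<in> Obj (Hom W v w) \<Longrightarrow> \<phi> \<in> Arr (TObj F v) \<Longrightarrow>
         AMap (T1 H v w u) (A v \<phi>) = A w (AMap (T1 F v w u) \<phi>)"
      "\<And>v w s x. v \<in> Ob W \<Longrightarrow> w \<in> Ob W \<Longrightarrow> s \<in> Arr (Hom W v w) \<Longrightarrow> x \<in> Obj (TObj F v) \<Longrightarrow>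
         Cmp (T2 H v w s) (O' v x) = A w (Cmp (T2 F v w s) x)"
  shows "two_nat W F H (mk_two_nat W F O' A)"
proof -
  note f = cat_valuedD[OF F]
  have "is_functor (TObj F w) (TObj H w) (mk_two_nat W F O' A w)" if w: "w \<in> Ob W" for w
    unfolding is_functor_def using w by (auto simp: mk_two_nat_def o a catD[OF f(1)])
  then show ?thesis
    unfolding two_nat_iff[OF W F H]
    by (auto simp: u functorD[OF f(2)] ntD[OF f(3)]) (auto simp: mk_two_nat_def)
qed

lemma base_pullback_exists:
  assumes "base_of_computability C B" "a \<in> Obj C" "b \<in> Obj C" "i \<in> B a" "j \<in> B b" "f \<in> Arr C"
    "Dom C f = Dom C i" "Cod C f = b"
  shows "\<exists>p q. is_pullback C j f p q \<and> Comp C i p \<in> B a"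
  using assms unfolding base_of_computability_def by blast

text \<open>
  A diagram \<open>H\<close> of categories carrying bases \<open>B\<close>, on which the 1-cells of the weight act by transfers.
  The types of \<open>H\<close> are arbitrary: smallness only matters for a copy of the limit inside the universe.
\<close>

locale diagram_of_bases =
  fixes W :: "('w, 'x, 'y) two_cat" and F :: "('w, 'x, 'y, 'p, 'b) cat_valued"
    and H :: "('w, 'x, 'y, 'q, 'd) cat_valued" and B :: "'w \<Rightarrow> 'q \<Rightarrow> 'd set"
  assumes W: "two_category W" and F: "two_functor W CAT F" and H: "two_functor W CAT H"
    and base: "\<And>w. w \<in> Ob W \<Longrightarrow> base_of_computability (TObj H w) (B w)"
    and transfer: "\<And>v w u. v \<in> Ob W \<Longrightarrow> w \<in> Ob W \<Longrightarrow> u \<in> Obj (Hom W v w) \<Longrightarrow>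
      computability_transfer (TObj H v, B v) (TObj H w, B w) (T1 H v w u)"
    and pie: "coproduct_of_representables W (\<lambda>w. Obj (TObj F w)) (\<lambda>v w u. OMap (T1 F v w u))"
begin

abbreviation "Lim \<equiv> two_nat_cat W F H"

definition lim_base :: "('w \<Rightarrow> ('p, 'b, 'q, 'd) functr) \<Rightarrow> ('w, 'p, 'b, 'q, 'd) modif set" where
  "lim_base \<alpha> = {m. modification W F H m \<and> Tgt m = \<alpha> \<and>
     (\<forall>w\<in>Ob W. \<forall>x\<in>Obj (TObj F w). Cmp (Cmp m w) x \<in> B w (OMap (\<alpha> w) x))}"

lemmas f = cat_valuedD[OF F] and h = cat_valuedD[OF H]
lemmas fo = functorD[OF cat_valuedD(2)[OF F]] and fa = ntD[OF cat_valuedD(3)[OF F]]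
lemmas ho = functorD[OF cat_valuedD(2)[OF H]] and ha = ntD[OF cat_valuedD(3)[OF H]]
lemmas fc = catD[OF cat_valuedD(1)[OF F]] and hc = catD[OF cat_valuedD(1)[OF H]]
lemmas hassoc = cat_assoc[OF cat_valuedD(1)[OF H]]
lemmas td = two_natD[OF W F H] and md = modificationD[OF W F H]
lemmas tdf = functorD[OF two_natD(2)[OF W F H]]
lemmas meq = modification_eqI[OF W F H] and teq = two_nat_eqI[OF W F H]
lemmas wc = two_catD[OF W] and wcomp = two_cat_hcomp[OF W] and wcc = catD[OF two_catD(1)[OF W]]
lemmas catL = category_two_nat_cat[OF W F H]

lemma mdc:
  assumes m: "modification W F H m" and v: "v \<in> Ob W"
  shows "x \<in> Obj (TObj F v) \<Longrightarrow> Cmp (Cmp m v) x \<in> Arr (TObj H v)"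
    and "x \<in> Obj (TObj F v) \<Longrightarrow> Dom (TObj H v) (Cmp (Cmp m v) x) = OMap (Src m v) x"
    and "x \<in> Obj (TObj F v) \<Longrightarrow> Cod (TObj H v) (Cmp (Cmp m v) x) = OMap (Tgt m v) x"
    and "\<phi> \<in> Arr (TObj F v) \<Longrightarrow>
      Comp (TObj H v) (Cmp (Cmp m v) (Cod (TObj F v) \<phi>)) (AMap (Src m v) \<phi>)
        = Comp (TObj H v) (AMap (Tgt m v) \<phi>) (Cmp (Cmp m v) (Dom (TObj F v) \<phi>))"
  using ntD[OF md(4)[OF m v]] md(5,6)[OF m v] by auto

text \<open>
  The mediating arrows at the various \<open>(w, x)\<close> form a modification: each of its equations holds after
  composition with both projections of the pullback at the relevant object of the weight.
\<close>

lemma pullback_if_pointwise: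
  assumes m: "modification W F H j" "modification W F H g" "modification W F H p" "modification W F H q"
    and e: "Tgt j = Tgt g" "Tgt p = Src g" "Tgt q = Src j" "Src q = Src p"
    and pb: "\<And>w x. w \<in> Ob W \<Longrightarrow> x \<in> Obj (TObj F w) \<Longrightarrow>
      is_pullback (TObj H w) (Cmp (Cmp j w) x) (Cmp (Cmp g w) x) (Cmp (Cmp p w) x) (Cmp (Cmp q w) x)"
  shows "is_pullback Lim j g p q"
proof -
  note c = mdc(1-3)[OF m(1)] mdc(1-3)[OF m(2)] mdc(1-3)[OF m(3)] mdc(1-3)[OF m(4)]
  have comm: "Comp Lim g p = Comp Lim j q"
    using catD(6)[OF catL, of p g] catD(6)[OF catL, of q j] m e
    by (intro meq) (simp_all add: pullbackD(9)[OF pb])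
  have "\<exists>!z. modification W F H z \<and> Src z = Src m \<and> Tgt z = Src p \<and> Comp Lim p z = m \<and> Comp Lim q z = n"
    if mn: "modification W F H m" "modification W F H n" "Src m = Src n" "Tgt m = Src g" "Tgt n = Src j"
      "Comp Lim g m = Comp Lim j n" for m n
  proof -
    note c' = mdc(1-3)[OF mn(1)] mdc(1-3)[OF mn(2)]
    have "Comp (TObj H w) (Cmp (Cmp g w) x) (Cmp (Cmp m w) x) = Comp (TObj H w) (Cmp (Cmp j w) x) (Cmp (Cmp n w) x)"
      if "w \<in> Ob W" "x \<in> Obj (TObj F w)" for w x
      using arg_cong[OF mn(6), of "\<lambda>m. Cmp (Cmp m w) x"] that by simp
    then have ex: "\<exists>z. z \<in> Arr (TObj H w) \<and> Dom (TObj H w) z = OMap (Src m w) x \<and> Cod (TObj H w) z = OMap (Src p w) x \<and>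
       Comp (TObj H w) (Cmp (Cmp p w) x) z = Cmp (Cmp m w) x \<and> Comp (TObj H w) (Cmp (Cmp q w) x) z = Cmp (Cmp n w) x"
      if "w \<in> Ob W" "x \<in> Obj (TObj F w)" for w x
      using pullback_factor[OF pb[OF that], of "Cmp (Cmp m w) x" "Cmp (Cmp n w) x"] that c c' mn(3-5)
      by (smt (verit))
    define z where "z w x = (SOME z. z \<in> Arr (TObj H w) \<and> Dom (TObj H w) z = OMap (Src m w) x \<and> Cod (TObj H w) z = OMap (Src p w) x \<and>
       Comp (TObj H w) (Cmp (Cmp p w) x) z = Cmp (Cmp m w) x \<and> Comp (TObj H w) (Cmp (Cmp q w) x) z = Cmp (Cmp n w) x)" for w x
    have z: "\<And>w x. w \<in> Ob W \<Longrightarrow> x \<in> Obj (TObj F w) \<Longrightarrow> z w x \<in> Arr (TObj H w)"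
       "\<And>w x. w \<in> Ob W \<Longrightarrow> x \<in> Obj (TObj F w) \<Longrightarrow> Dom (TObj H w) (z w x) = OMap (Src m w) x"
       "\<And>w x. w \<in> Ob W \<Longrightarrow> x \<in> Obj (TObj F w) \<Longrightarrow> Cod (TObj H w) (z w x) = OMap (Src p w) x"
       "\<And>w x. w \<in> Ob W \<Longrightarrow> x \<in> Obj (TObj F w) \<Longrightarrow> Comp (TObj H w) (Cmp (Cmp p w) x) (z w x) = Cmp (Cmp m w) x"
       "\<And>w x. w \<in> Ob W \<Longrightarrow> x \<in> Obj (TObj F w) \<Longrightarrow> Comp (TObj H w) (Cmp (Cmp q w) x) (z w x) = Cmp (Cmp n w) x"
      using someI_ex[OF ex] unfolding z_def by blast+
    let ?z = "mk_modif W F (Src m) (Src p) z"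
    have sm: "two_nat W F H (Src m)" "two_nat W F H (Src p)" using md mn m by auto
    note [simp] = tdf[OF sm(1)] tdf[OF sm(2)]
    have zmod: "modification W F H ?z"
    proof (rule modification_mk_modif[OF W F H sm]; (simp add: z)?)
      fix w \<phi> assume w: "w \<in> Ob W" and p: "\<phi> \<in> Arr (TObj F w)"
      note [simp] = w p fc hc z c c'
      let ?a = "Dom (TObj F w) \<phi>" and ?b = "Cod (TObj F w) \<phi>"
      have "Comp (TObj H w) (Cmp (Cmp r w) ?b) (Comp (TObj H w) (z w ?b) (AMap (Src m w) \<phi>)) =
         Comp (TObj H w) (Cmp (Cmp r w) ?b) (Comp (TObj H w) (AMap (Src p w) \<phi>) (z w ?a))"
        if r: "modification W F H r" "Src r = Src p" "modification W F H l" "Src l = Src m" "Tgt l = Tgt r"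
          and rz: "\<And>x. x \<in> Obj (TObj F w) \<Longrightarrow> Comp (TObj H w) (Cmp (Cmp r w) x) (z w x) = Cmp (Cmp l w) x" for r l
      proof -
        note [simp] = mdc(1-3)[OF r(1)] mdc(1-3)[OF r(3)] r(2,4,5)
        note [simp] = tdf[OF md(2)[OF r(1)]]
        have "Comp (TObj H w) (Cmp (Cmp r w) ?b) (Comp (TObj H w) (z w ?b) (AMap (Src m w) \<phi>))
          = Comp (TObj H w) (Cmp (Cmp l w) ?b) (AMap (Src l w) \<phi>)" by (subst hassoc) (simp_all add: rz)
        also have "\<dots> = Comp (TObj H w) (AMap (Tgt r w) \<phi>) (Cmp (Cmp l w) ?a)" by (subst mdc(4)[OF r(3)]) simp_all
        also have "\<dots> = Comp (TObj H w) (Comp (TObj H w) (AMap (Tgt r w) \<phi>) (Cmp (Cmp r w) ?a)) (z w ?a)"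
          by (subst hassoc[symmetric]) (simp_all add: rz)
        also have "\<dots> = Comp (TObj H w) (Comp (TObj H w) (Cmp (Cmp r w) ?b) (AMap (Src p w) \<phi>)) (z w ?a)"
          using mdc(4)[OF r(1) w p] by simp
        also have "\<dots> = Comp (TObj H w) (Cmp (Cmp r w) ?b) (Comp (TObj H w) (AMap (Src p w) \<phi>) (z w ?a))"
          by (rule hassoc[symmetric]) simp_all
        finally show ?thesis .
      qed
      note eq = this[OF m(3) refl mn(1) refl _ z(4)[OF w]] this[OF m(4) e(4) mn(2) mn(3)[symmetric] _ z(5)[OF w]]
      have "Comp (TObj H w) (Cmp (Cmp p w) ?b) (Comp (TObj H w) (z w ?b) (AMap (Src m w) \<phi>)) =
         Comp (TObj H w) (Cmp (Cmp p w) ?b) (Comp (TObj H w) (AMap (Src p w) \<phi>) (z w ?a))"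
        "Comp (TObj H w) (Cmp (Cmp q w) ?b) (Comp (TObj H w) (z w ?b) (AMap (Src m w) \<phi>)) =
         Comp (TObj H w) (Cmp (Cmp q w) ?b) (Comp (TObj H w) (AMap (Src p w) \<phi>) (z w ?a))"
        by (rule eq; simp add: e mn)+
      then show "Comp (TObj H w) (z w ?b) (AMap (Src m w) \<phi>) = Comp (TObj H w) (AMap (Src p w) \<phi>) (z w ?a)"
        by (rule pullback_jointly_monic[OF h(1) pb[of w ?b], rotated 8]) simp_all
    next
      fix v w u x assume v: "v \<in> Ob W" "w \<in> Ob W" "u \<in> Obj (Hom W v w)" "x \<in> Obj (TObj F v)"
      note [simp] = v fc hc z c c' fo ho
      have "Comp (TObj H w) (Cmp (Cmp r w) (OMap (T1 F v w u) x)) (AMap (T1 H v w u) (z v x)) = Cmp (Cmp l w) (OMap (T1 F v w u) x)"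
        if r: "modification W F H r" "Src r = Src p" "modification W F H l"
          and rz: "Comp (TObj H v) (Cmp (Cmp r v) x) (z v x) = Cmp (Cmp l v) x" for r l
      proof -
        have "AMap (T1 H v w u) (Comp (TObj H v) (Cmp (Cmp r v) x) (z v x)) = Comp (TObj H w) (AMap (T1 H v w u) (Cmp (Cmp r v) x)) (AMap (T1 H v w u) (z v x))"
          using r mdc(1-3)[OF r(1)] by (intro ho(6)) simp_all
        then show ?thesis by (simp only: rz md(7)[OF r(1) v] md(7)[OF r(3) v])
      qed
      note eq = this[OF m(3) refl mn(1) z(4)[OF v(1,4)]] this[OF m(4) e(4) mn(2) z(5)[OF v(1,4)]]
      show "AMap (T1 H v w u) (z v x) = z w (OMap (T1 F v w u) x)"
        by (rule pullback_jointly_monic[OF h(1) pb[of w "OMap (T1 F v w u) x"]])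
          (simp_all add: eq td(3)[OF sm(1)] td(3)[OF sm(2)])
    qed
    show ?thesis
    proof (intro ex1I[of _ ?z] conjI zmod)
      show "Comp Lim p ?z = m" "Comp Lim q ?z = n"
        using catD(6)[OF catL, of ?z p] catD(6)[OF catL, of ?z q] zmod m mn e by (auto intro!: meq simp: z)
      fix y assume y: "modification W F H y \<and> Src y = Src m \<and> Tgt y = Src p \<and> Comp Lim p y = m \<and> Comp Lim q y = n"
      show "y = ?z"
      proof (rule meq)
        fix w x assume w: "w \<in> Ob W" "x \<in> Obj (TObj F w)"
        have e1: "Comp (TObj H w) (Cmp (Cmp p w) x) (Cmp (Cmp y w) x) = Cmp (Cmp m w) x"
          "Comp (TObj H w) (Cmp (Cmp q w) x) (Cmp (Cmp y w) x) = Cmp (Cmp n w) x"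
          using y w by (metis comp_two_nat_cat(3) vcomp_simps(3))+
        have y': "modification W F H y" "Src y = Src m" "Tgt y = Src p" using y by auto
        show "Cmp (Cmp y w) x = Cmp (Cmp ?z w) x"
          by (rule pullback_jointly_monic[OF h(1) pb[OF w]])
            (simp_all add: e1 w z c y' mdc(1-3)[OF y'(1)])
      qed (use y zmod in simp_all)
    qed simp_all
  qed
  then show ?thesis
    unfolding is_pullback_def using m e comm by simp
qed


text \<open>
  The set-valued functor of objects of a pie weight is freely generated: by naturality of the bijection
  with a coproduct of representables, \<open>r i\<close> is the place of the generator \<open>g i\<close>, the image of the
  identity of \<open>r i\<close>. The pair \<open>d w x\<close> decomposes \<open>x\<close> into the index of a generator and the 1-cell that
  carries this generator to \<open>x\<close>. Uniqueness of the decomposition is what makes \<open>d\<close> compatible with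
  the action of 1-cells in the last equation.
\<close>

lemma generators:
  obtains I :: "('w \<times> 'p) set" and r g d where
    "\<And>i. i \<in> I \<Longrightarrow> r i \<in> Ob W" "\<And>i. i \<in> I \<Longrightarrow> g i \<in> Obj (TObj F (r i))"
    "\<And>w x. w \<in> Ob W \<Longrightarrow> x \<in> Obj (TObj F w) \<Longrightarrow> fst (d w x) \<in> I"
    "\<And>w x. w \<in> Ob W \<Longrightarrow> x \<in> Obj (TObj F w) \<Longrightarrow> snd (d w x) \<in> Obj (Hom W (r (fst (d w x))) w)"
    "\<And>w x. w \<in> Ob W \<Longrightarrow> x \<in> Obj (TObj F w) \<Longrightarrow>
       OMap (T1 F (r (fst (d w x))) w (snd (d w x))) (g (fst (d w x))) = x"
    "\<And>v w u x. v \<in> Ob W \<Longrightarrow> w \<in> Ob W \<Longrightarrow> u \<in> Obj (Hom W v w) \<Longrightarrow> x \<in> Obj (TObj F v) \<Longrightarrow>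
       d w (OMap (T1 F v w u) x) = (fst (d v x), comp1 W (r (fst (d v x))) v w u (snd (d v x)))"
proof -
  from pie obtain I :: "('w \<times> 'p) set" and r e where pie': "(\<forall>i\<in>I. r i \<in> Ob W) \<and>
        (\<forall>w\<in>Ob W. bij_betw (e w) (SIGMA i:I. Obj (Hom W (r i) w)) (Obj (TObj F w))) \<and>
        (\<forall>v\<in>Ob W. \<forall>w\<in>Ob W. \<forall>u\<in>Obj (Hom W v w). \<forall>i\<in>I. \<forall>f\<in>Obj (Hom W (r i) v).
           e w (i, comp1 W (r i) v w u f) = OMap (T1 F v w u) (e v (i, f)))"
    unfolding coproduct_of_representables_def by (elim exE) (rule that)
  then have r: "\<And>i. i \<in> I \<Longrightarrow> r i \<in> Ob W"
    and e: "\<And>w. w \<in> Ob W \<Longrightarrow> bij_betw (e w) (SIGMA i:I. Obj (Hom W (r i) w)) (Obj (TObj F w))"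
    and n: "\<And>v w u i f. v \<in> Ob W \<Longrightarrow> w \<in> Ob W \<Longrightarrow> u \<in> Obj (Hom W v w) \<Longrightarrow> i \<in> I \<Longrightarrow> f \<in> Obj (Hom W (r i) v) \<Longrightarrow>
          e w (i, comp1 W (r i) v w u f) = OMap (T1 F v w u) (e v (i, f))" by simp_all
  \<comment> \<open>as in the Yoneda lemma, the summand \<open>i\<close> is generated by the image of the identity\<close>
  let ?g = "\<lambda>i. e (r i) (i, HId W (r i))"
  let ?d = "\<lambda>w. inv_into (SIGMA i:I. Obj (Hom W (r i) w)) (e w)"
  have g: "?g i \<in> Obj (TObj F (r i))" if "i \<in> I" for i
    using bij_betwE[OF e[OF r[OF that]]] that r wc(2) by auto
  have d: "?d w x \<in> (SIGMA i:I. Obj (Hom W (r i) w))" "e w (?d w x) = x" if "w \<in> Ob W" "x \<in> Obj (TObj F w)" for w x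
    using e[OF that(1)] that(2) by (metis bij_betw_imp_surj_on inv_into_into, metis bij_betw_inv_into_right)
  have d1: "fst (?d w x) \<in> I" "snd (?d w x) \<in> Obj (Hom W (r (fst (?d w x))) w)"
    if "w \<in> Ob W" "x \<in> Obj (TObj F w)" for w x
    using d(1)[OF that] by auto
  have d2: "OMap (T1 F (r (fst (?d w x))) w (snd (?d w x))) (?g (fst (?d w x))) = x"
    if "w \<in> Ob W" "x \<in> Obj (TObj F w)" for w x
    using n[OF r[OF d1(1)[OF that]] that(1) d1(2)[OF that] d1(1)[OF that], of "HId W (r (fst (?d w x)))"]
      d1[OF that] r[OF d1(1)[OF that]] d(2)[OF that] by (simp add: wc that)
  have d3: "?d w (OMap (T1 F v w u) x) = (fst (?d v x), comp1 W (r (fst (?d v x))) v w u (snd (?d v x)))"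
    if v: "v \<in> Ob W" "w \<in> Ob W" "u \<in> Obj (Hom W v w)" "x \<in> Obj (TObj F v)" for v w u x
  proof (rule inv_into_f_eq)
    show "inj_on (e w) (SIGMA i:I. Obj (Hom W (r i) w))" using e[OF v(2)] by (rule bij_betw_imp_inj_on)
    show "(fst (?d v x), comp1 W (r (fst (?d v x))) v w u (snd (?d v x))) \<in> (SIGMA i:I. Obj (Hom W (r i) w))"
      using d1[OF v(1,4)] r v by (auto simp: wcomp)
    show "e w (fst (?d v x), comp1 W (r (fst (?d v x))) v w u (snd (?d v x))) = OMap (T1 F v w u) x"
      using n[OF v(1-3) d1[OF v(1,4)]] d(2)[OF v(1,4)] by simp
  qed
  show thesis by (rule that[of I r ?g ?d]) (fact r g d1 d2 d3)+
qed

lemma base_mono: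
  assumes "w \<in> Ob W" "a \<in> Obj (TObj H w)" "i \<in> B w a"
  shows "is_mono (TObj H w) i"
  using base[OF assms(1)] assms(2,3) unfolding base_of_computability_def by blast

lemma transferD:
  assumes "v \<in> Ob W" "w \<in> Ob W" "u \<in> Obj (Hom W v w)"
  shows "a \<in> Obj (TObj H v) \<Longrightarrow> i \<in> B v a \<Longrightarrow> AMap (T1 H v w u) i \<in> B w (OMap (T1 H v w u) a)"
    and "b \<in> Obj (TObj H v) \<Longrightarrow> j \<in> B v b \<Longrightarrow> is_pullback (TObj H v) j g p q \<Longrightarrow>
      is_pullback (TObj H w) (AMap (T1 H v w u) j) (AMap (T1 H v w u) g) (AMap (T1 H v w u) p) (AMap (T1 H v w u) q)"
  using transfer[OF assms] unfolding computability_transfer_def by auto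

lemma lim_baseD:
  assumes "i \<in> lim_base \<alpha>"
  shows "modification W F H i" "Tgt i = \<alpha>" "two_nat W F H \<alpha>"
    "w \<in> Ob W \<Longrightarrow> x \<in> Obj (TObj F w) \<Longrightarrow> Cmp (Cmp i w) x \<in> B w (OMap (\<alpha> w) x)"
  using assms md(2)[of i] unfolding lim_base_def by auto

text \<open>
  Pullbacks are chosen at the generators and transported along \<open>H u\<close>. The family is strictly
  natural because \<open>H\<close> preserves composition and the decomposition of \<open>F u x\<close> is that of \<open>x\<close>
  followed by \<open>u\<close>; an independent choice at each object would be natural up to isomorphism only.
\<close>

lemma pullbacks_along_weight:
  assumes i: "i \<in> lim_base \<alpha>" and j: "j \<in> lim_base \<beta>" and g: "modification W F H g" "Src g = Src i" "Tgt g = \<beta>"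
  obtains p q where
    "\<And>w x. w \<in> Ob W \<Longrightarrow> x \<in> Obj (TObj F w) \<Longrightarrow> is_pullback (TObj H w) (Cmp (Cmp j w) x) (Cmp (Cmp g w) x) (p w x) (q w x)"
    "\<And>w x. w \<in> Ob W \<Longrightarrow> x \<in> Obj (TObj F w) \<Longrightarrow> Comp (TObj H w) (Cmp (Cmp i w) x) (p w x) \<in> B w (OMap (\<alpha> w) x)"
    "\<And>v w u x. v \<in> Ob W \<Longrightarrow> w \<in> Ob W \<Longrightarrow> u \<in> Obj (Hom W v w) \<Longrightarrow> x \<in> Obj (TObj F v) \<Longrightarrow>
       AMap (T1 H v w u) (p v x) = p w (OMap (T1 F v w u) x)"
    "\<And>v w u x. v \<in> Ob W \<Longrightarrow> w \<in> Ob W \<Longrightarrow> u \<in> Obj (Hom W v w) \<Longrightarrow> x \<in> Obj (TObj F v) \<Longrightarrow>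
       AMap (T1 H v w u) (q v x) = q w (OMap (T1 F v w u) x)"
proof -
  note ib = lim_baseD[OF i] and jb = lim_baseD[OF j]
  obtain I :: "('w \<times> 'p) set" and r y d where
    r: "\<And>i. i \<in> I \<Longrightarrow> r i \<in> Ob W" and y: "\<And>i. i \<in> I \<Longrightarrow> y i \<in> Obj (TObj F (r i))"
    and d: "\<And>w x. w \<in> Ob W \<Longrightarrow> x \<in> Obj (TObj F w) \<Longrightarrow> fst (d w x) \<in> I"
    "\<And>w x. w \<in> Ob W \<Longrightarrow> x \<in> Obj (TObj F w) \<Longrightarrow> snd (d w x) \<in> Obj (Hom W (r (fst (d w x))) w)"
    "\<And>w x. w \<in> Ob W \<Longrightarrow> x \<in> Obj (TObj F w) \<Longrightarrow>
       OMap (T1 F (r (fst (d w x))) w (snd (d w x))) (y (fst (d w x))) = x"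
    "\<And>v w u x. v \<in> Ob W \<Longrightarrow> w \<in> Ob W \<Longrightarrow> u \<in> Obj (Hom W v w) \<Longrightarrow> x \<in> Obj (TObj F v) \<Longrightarrow>
       d w (OMap (T1 F v w u) x) = (fst (d v x), comp1 W (r (fst (d v x))) v w u (snd (d v x)))"
    by (rule generators) blast
  have "\<exists>p q. is_pullback (TObj H (r k)) (Cmp (Cmp j (r k)) (y k)) (Cmp (Cmp g (r k)) (y k)) p q \<and>
      Comp (TObj H (r k)) (Cmp (Cmp i (r k)) (y k)) p \<in> B (r k) (OMap (\<alpha> (r k)) (y k))" if k: "k \<in> I" for k
    using mdc[OF g(1) r[OF k]] mdc[OF ib(1) r[OF k]] mdc[OF jb(1) r[OF k]] r[OF k] y[OF k] ib jb g tdf(1)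
    by (intro base_pullback_exists[OF base[OF r[OF k]], where b = "OMap (\<beta> (r k)) (y k)"]) auto
  then obtain P Q where P: "\<And>k. k \<in> I \<Longrightarrow> is_pullback (TObj H (r k)) (Cmp (Cmp j (r k)) (y k)) (Cmp (Cmp g (r k)) (y k)) (P k) (Q k)"
      "\<And>k. k \<in> I \<Longrightarrow> Comp (TObj H (r k)) (Cmp (Cmp i (r k)) (y k)) (P k) \<in> B (r k) (OMap (\<alpha> (r k)) (y k))"
    by metis
  let ?p = "\<lambda>P w x. AMap (T1 H (r (fst (d w x))) w (snd (d w x))) (P (fst (d w x)))"
  have nat: "AMap (T1 H v w u) (?p P v x) = ?p P w (OMap (T1 F v w u) x)"
    if v: "v \<in> Ob W" "w \<in> Ob W" "u \<in> Obj (Hom W v w)" "x \<in> Obj (TObj F v)"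
      and P: "\<And>k. k \<in> I \<Longrightarrow> P k \<in> Arr (TObj H (r k))" for P v w u x
    using v d(1,2)[OF v(1,4)] r[OF d(1)[OF v(1,4)]] P[OF d(1)[OF v(1,4)]] by (simp add: d(4) h(7) functor_comp_def)
  show thesis
  proof (rule that[of "?p P" "?p Q"])
    fix w x assume w: "w \<in> Ob W" and x: "x \<in> Obj (TObj F w)"
    let ?k = "fst (d w x)" and ?u = "snd (d w x)"
    note D = d(1-3)[OF w x]
    have k: "r ?k \<in> Ob W" "?u \<in> Obj (Hom W (r ?k) w)" "y ?k \<in> Obj (TObj F (r ?k))" using r y D by auto
    note Pk = P[OF D(1)]
    note n1 = md(7)[OF ib(1) k(1) w k(2,3)] md(7)[OF jb(1) k(1) w k(2,3)] md(7)[OF g(1) k(1) w k(2,3)]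
      td(3)[OF ib(3) k(1) w k(2,3)]
    show "is_pullback (TObj H w) (Cmp (Cmp j w) x) (Cmp (Cmp g w) x) (?p P w x) (?p Q w x)"
      using transferD(2)[OF k(1) w k(2) _ jb(4)[OF k(1,3)] Pk(1)] tdf(1)[OF jb(3) k(1) k(3)] by (simp add: n1 D(3))
    have "AMap (T1 H (r ?k) w ?u) (Comp (TObj H (r ?k)) (Cmp (Cmp i (r ?k)) (y ?k)) (P ?k)) =
       Comp (TObj H w) (Cmp (Cmp i w) x) (?p P w x)"
      using pullbackD[OF Pk(1)] mdc(1-3)[OF ib(1) k(1) k(3)] mdc(1-3)[OF g(1) k(1) k(3)] g(2) k w
      by (subst ho(6)) (simp_all add: n1 D(3))
    then show "Comp (TObj H w) (Cmp (Cmp i w) x) (?p P w x) \<in> B w (OMap (\<alpha> w) x)"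
      using transferD(1)[OF k(1) w k(2) _ Pk(2)] tdf(1)[OF ib(3) k(1) k(3)] by (simp add: n1 D(3))
  qed (use nat pullbackD[OF P(1)] in auto)
qed

text \<open>
  The domains \<open>O' w x\<close> of the chosen pullbacks are the values on objects of a 2-natural transformation.
  Its value \<open>A w \<phi>\<close> at an arrow is the unique arrow between pullbacks over the arrows induced by \<open>\<phi>\<close>,
  and every equation required of it follows from this uniqueness (\<open>A_eq\<close>).
\<close>

lemma lim_base_pullback:
  assumes i: "i \<in> lim_base \<alpha>" and j: "j \<in> lim_base \<beta>" and g: "modification W F H g" "Src g = Src i" "Tgt g = \<beta>"
  obtains p q where "modification W F H p" "modification W F H q" "Src q = Src p" "Tgt p = Src g" "Tgt q = Src j"
    "\<And>w x. w \<in> Ob W \<Longrightarrow> x \<in> Obj (TObj F w) \<Longrightarrow>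
      is_pullback (TObj H w) (Cmp (Cmp j w) x) (Cmp (Cmp g w) x) (Cmp (Cmp p w) x) (Cmp (Cmp q w) x)"
    "Comp Lim i p \<in> lim_base \<alpha>"
proof (rule pullbacks_along_weight[OF i j g])
  note ib = lim_baseD[OF i] and jb = lim_baseD[OF j]
  fix p q
  assume pb: "\<And>w x. w \<in> Ob W \<Longrightarrow> x \<in> Obj (TObj F w) \<Longrightarrow> is_pullback (TObj H w) (Cmp (Cmp j w) x) (Cmp (Cmp g w) x) (p w x) (q w x)"
    and ip: "\<And>w x. w \<in> Ob W \<Longrightarrow> x \<in> Obj (TObj F w) \<Longrightarrow> Comp (TObj H w) (Cmp (Cmp i w) x) (p w x) \<in> B w (OMap (\<alpha> w) x)"
    and pn: "\<And>v w u x. v \<in> Ob W \<Longrightarrow> w \<in> Ob W \<Longrightarrow> u \<in> Obj (Hom W v w) \<Longrightarrow> x \<in> Obj (TObj F v) \<Longrightarrow>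
       AMap (T1 H v w u) (p v x) = p w (OMap (T1 F v w u) x)"
    and qn: "\<And>v w u x. v \<in> Ob W \<Longrightarrow> w \<in> Ob W \<Longrightarrow> u \<in> Obj (Hom W v w) \<Longrightarrow> x \<in> Obj (TObj F v) \<Longrightarrow>
       AMap (T1 H v w u) (q v x) = q w (OMap (T1 F v w u) x)"
  let ?\<gamma> = "Src g" and ?\<delta> = "Src j"
  have sm: "two_nat W F H ?\<gamma>" "two_nat W F H ?\<delta>" using md(1)[OF g(1)] md(1)[OF jb(1)] by simp_all
  define O' where "O' w x = Dom (TObj H w) (p w x)" for w x
  note pD = pullbackD[OF pb]
  note jc = mdc(1-3)[OF jb(1)] and gc = mdc(1-3)[OF g(1)]
  have c: "p w x \<in> Arr (TObj H w)" "Dom (TObj H w) (p w x) = O' w x" "Cod (TObj H w) (p w x) = OMap (?\<gamma> w) x"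
      "q w x \<in> Arr (TObj H w)" "Dom (TObj H w) (q w x) = O' w x" "Cod (TObj H w) (q w x) = OMap (?\<delta> w) x"
      "O' w x \<in> Obj (TObj H w)"
    if "w \<in> Ob W" "x \<in> Obj (TObj F w)" for w x
    using that hc(1)[OF that(1) pD(3)[OF that]] by (simp_all add: O'_def pD(3,4,6,7,8)[OF that] jc gc)
  note jm = pullback_jointly_monic[OF h(1) pb]
  let ?P = "\<lambda>w \<phi> z. z \<in> Arr (TObj H w) \<and> Dom (TObj H w) z = O' w (Dom (TObj F w) \<phi>) \<and> Cod (TObj H w) z = O' w (Cod (TObj F w) \<phi>) \<and>
      Comp (TObj H w) (p w (Cod (TObj F w) \<phi>)) z = Comp (TObj H w) (AMap (?\<gamma> w) \<phi>) (p w (Dom (TObj F w) \<phi>)) \<and>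
      Comp (TObj H w) (q w (Cod (TObj F w) \<phi>)) z = Comp (TObj H w) (AMap (?\<delta> w) \<phi>) (q w (Dom (TObj F w) \<phi>))"
  have ex: "\<exists>z. ?P w \<phi> z" if w: "w \<in> Ob W" and p: "\<phi> \<in> Arr (TObj F w)" for w \<phi>
  proof -
    let ?a = "Dom (TObj F w) \<phi>" and ?b = "Cod (TObj F w) \<phi>"
    note [simp] = w p fc hc c jc gc tdf[OF sm(1)] tdf[OF sm(2)] tdf[OF jb(3)] jb(2) g(3)
    have "Comp (TObj H w) (Cmp (Cmp g w) ?b) (Comp (TObj H w) (AMap (?\<gamma> w) \<phi>) (p w ?a)) =
        Comp (TObj H w) (Comp (TObj H w) (AMap (\<beta> w) \<phi>) (Cmp (Cmp g w) ?a)) (p w ?a)"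
      using mdc(4)[OF g(1) w p] by (simp add: hassoc)
    also have "\<dots> = Comp (TObj H w) (AMap (\<beta> w) \<phi>) (Comp (TObj H w) (Cmp (Cmp j w) ?a) (q w ?a))"
      by (subst hassoc[symmetric]) (simp_all add: pD(9))
    also have "\<dots> = Comp (TObj H w) (Comp (TObj H w) (Cmp (Cmp j w) ?b) (AMap (?\<delta> w) \<phi>)) (q w ?a)"
      using mdc(4)[OF jb(1) w p] by (simp add: hassoc)
    also have "\<dots> = Comp (TObj H w) (Cmp (Cmp j w) ?b) (Comp (TObj H w) (AMap (?\<delta> w) \<phi>) (q w ?a))"
      by (rule hassoc[symmetric]) simp_all
    finally have eq: "Comp (TObj H w) (Cmp (Cmp g w) ?b) (Comp (TObj H w) (AMap (?\<gamma> w) \<phi>) (p w ?a)) =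
        Comp (TObj H w) (Cmp (Cmp j w) ?b) (Comp (TObj H w) (AMap (?\<delta> w) \<phi>) (q w ?a))" .
    have "\<exists>!z. z \<in> Arr (TObj H w) \<and> Dom (TObj H w) z = Dom (TObj H w) (Comp (TObj H w) (AMap (?\<gamma> w) \<phi>) (p w ?a)) \<and>
      Cod (TObj H w) z = Dom (TObj H w) (p w ?b) \<and> Comp (TObj H w) (p w ?b) z = Comp (TObj H w) (AMap (?\<gamma> w) \<phi>) (p w ?a) \<and>
      Comp (TObj H w) (q w ?b) z = Comp (TObj H w) (AMap (?\<delta> w) \<phi>) (q w ?a)"
      by (rule pullback_ex1[OF pb[of w ?b] _ _ _ _ _ eq]) simp_all
    then show ?thesis by auto
  qed
  define A where "A w \<phi> = (SOME z. ?P w \<phi> z)" for w \<phi>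
  have A: "A w \<phi> \<in> Arr (TObj H w)" "Dom (TObj H w) (A w \<phi>) = O' w (Dom (TObj F w) \<phi>)" "Cod (TObj H w) (A w \<phi>) = O' w (Cod (TObj F w) \<phi>)"
      "Comp (TObj H w) (p w (Cod (TObj F w) \<phi>)) (A w \<phi>) = Comp (TObj H w) (AMap (?\<gamma> w) \<phi>) (p w (Dom (TObj F w) \<phi>))"
      "Comp (TObj H w) (q w (Cod (TObj F w) \<phi>)) (A w \<phi>) = Comp (TObj H w) (AMap (?\<delta> w) \<phi>) (q w (Dom (TObj F w) \<phi>))"
    if "w \<in> Ob W" "\<phi> \<in> Arr (TObj F w)" for w \<phi>
    using someI_ex[OF ex[OF that]] unfolding A_def by blast+
  have A_eq: "z = A w \<phi>" if w: "w \<in> Ob W" "\<phi> \<in> Arr (TObj F w)" "z \<in> Arr (TObj H w)"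
      "Dom (TObj H w) z = O' w (Dom (TObj F w) \<phi>)" "Cod (TObj H w) z = O' w (Cod (TObj F w) \<phi>)"
      "Comp (TObj H w) (p w (Cod (TObj F w) \<phi>)) z = Comp (TObj H w) (AMap (?\<gamma> w) \<phi>) (p w (Dom (TObj F w) \<phi>))"
      "Comp (TObj H w) (q w (Cod (TObj F w) \<phi>)) z = Comp (TObj H w) (AMap (?\<delta> w) \<phi>) (q w (Dom (TObj F w) \<phi>))" for w \<phi> z
    by (rule jm[of w "Cod (TObj F w) \<phi>"]) (simp_all add: w A fc c)
  let ?\<epsilon> = "mk_two_nat W F O' A"
  have eps: "two_nat W F H ?\<epsilon>"
  proof (rule two_nat_mk_two_nat[OF W F H])
    fix w x assume w: "w \<in> Ob W" "x \<in> Obj (TObj F w)"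
    show "A w (Ident (TObj F w) x) = Ident (TObj H w) (O' w x)"
      by (rule A_eq[symmetric]) (simp_all add: w fc hc c tdf(5)[OF sm(1)] tdf(5)[OF sm(2)])
  next
    fix w \<phi> \<psi> assume w: "w \<in> Ob W" and p: "\<phi> \<in> Arr (TObj F w)" "\<psi> \<in> Arr (TObj F w)" "Cod (TObj F w) \<phi> = Dom (TObj F w) \<psi>"
    note [simp] = w p fc hc c A tdf[OF sm(1)] tdf[OF sm(2)]
    have "Comp (TObj H w) (r (Cod (TObj F w) \<psi>)) (Comp (TObj H w) (A w \<psi>) (A w \<phi>)) =
       Comp (TObj H w) (AMap (\<kappa> w) (Comp (TObj F w) \<psi> \<phi>)) (r (Dom (TObj F w) \<phi>))"
      if r: "\<And>x. x \<in> Obj (TObj F w) \<Longrightarrow> r x \<in> Arr (TObj H w)" "\<And>x. x \<in> Obj (TObj F w) \<Longrightarrow> Dom (TObj H w) (r x) = O' w x"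
          "\<And>x. x \<in> Obj (TObj F w) \<Longrightarrow> Cod (TObj H w) (r x) = OMap (\<kappa> w) x"
        and k: "two_nat W F H \<kappa>"
        and e: "\<And>\<phi>. \<phi> \<in> Arr (TObj F w) \<Longrightarrow> Comp (TObj H w) (r (Cod (TObj F w) \<phi>)) (A w \<phi>) = Comp (TObj H w) (AMap (\<kappa> w) \<phi>) (r (Dom (TObj F w) \<phi>))"
      for r \<kappa>
    proof -
      note [simp] = r tdf[OF k]
      have "Comp (TObj H w) (r (Cod (TObj F w) \<psi>)) (Comp (TObj H w) (A w \<psi>) (A w \<phi>)) =
        Comp (TObj H w) (Comp (TObj H w) (AMap (\<kappa> w) \<psi>) (r (Dom (TObj F w) \<psi>))) (A w \<phi>)"
        using e[OF p(2)] by (simp add: hassoc)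
      also have "\<dots> = Comp (TObj H w) (AMap (\<kappa> w) \<psi>) (Comp (TObj H w) (r (Dom (TObj F w) \<psi>)) (A w \<phi>))"
        by (rule hassoc[symmetric]) simp_all
      also have "\<dots> = Comp (TObj H w) (AMap (\<kappa> w) (Comp (TObj F w) \<psi> \<phi>)) (r (Dom (TObj F w) \<phi>))"
        using e[OF p(1)] by (simp add: hassoc)
      finally show ?thesis .
    qed
    from this[of "p w" ?\<gamma>] this[of "q w" ?\<delta>]
    show "A w (Comp (TObj F w) \<psi> \<phi>) = Comp (TObj H w) (A w \<psi>) (A w \<phi>)"
      by (intro A_eq[symmetric]) (simp_all add: sm)
  next
    fix v w u x assume v: "v \<in> Ob W" "w \<in> Ob W" "u \<in> Obj (Hom W v w)" "x \<in> Obj (TObj F v)"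
    show "OMap (T1 H v w u) (O' v x) = O' w (OMap (T1 F v w u) x)"
      using ho(3)[OF v(1-3) c(1)[OF v(1,4)]] v by (simp add: pn c fo)
  next
    fix v w u \<phi> assume v: "v \<in> Ob W" "w \<in> Ob W" "u \<in> Obj (Hom W v w)" and p: "\<phi> \<in> Arr (TObj F v)"
    note [simp] = v p fc hc c fo ho A tdf[OF sm(1)] tdf[OF sm(2)]
    have O: "OMap (T1 H v w u) (O' v x) = O' w (OMap (T1 F v w u) x)" if "x \<in> Obj (TObj F v)" for x
      using ho(3)[OF v(1-3) c(1)[OF v(1) that]] that by (simp add: pn)
    have "Comp (TObj H w) (AMap (T1 H v w u) (p v (Cod (TObj F v) \<phi>))) (AMap (T1 H v w u) (A v \<phi>)) =
      Comp (TObj H w) (AMap (T1 H v w u) (AMap (?\<gamma> v) \<phi>)) (AMap (T1 H v w u) (p v (Dom (TObj F v) \<phi>)))"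
      "Comp (TObj H w) (AMap (T1 H v w u) (q v (Cod (TObj F v) \<phi>))) (AMap (T1 H v w u) (A v \<phi>)) =
      Comp (TObj H w) (AMap (T1 H v w u) (AMap (?\<delta> v) \<phi>)) (AMap (T1 H v w u) (q v (Dom (TObj F v) \<phi>)))"
      by (subst (1 2) ho(6)[symmetric]; simp)+
    then show "AMap (T1 H v w u) (A v \<phi>) = A w (AMap (T1 F v w u) \<phi>)"
      by (intro A_eq) (simp_all add: pn qn O td(4)[OF sm(1) v] td(4)[OF sm(2) v])
  next
    fix v w s x assume v: "v \<in> Ob W" "w \<in> Ob W" and s: "s \<in> Arr (Hom W v w)" and x: "x \<in> Obj (TObj F v)"
    note [simp] = v s x fc hc c fo ho fa ha f(4,5) h(4,5) wcc tdf[OF sm(1)] tdf[OF sm(2)]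
    have O: "OMap (T1 H v w u) (O' v x) = O' w (OMap (T1 F v w u) x)" if "u \<in> Obj (Hom W v w)" for u
      using ho(3)[OF v that c(1)[OF v(1) x]] that by (simp add: pn)
    show "Cmp (T2 H v w s) (O' v x) = A w (Cmp (T2 F v w s) x)"
      using ha(6)[OF v s c(1)[OF v(1) x]] ha(6)[OF v s c(4)[OF v(1) x]]
      by (intro A_eq) (simp_all add: O pn qn td(5)[OF sm(1) v s] td(5)[OF sm(2) v s])
  qed (simp_all add: c A)
  let ?p = "mk_modif W F ?\<epsilon> ?\<gamma> p" and ?q = "mk_modif W F ?\<epsilon> ?\<delta> q"
  have pm: "modification W F H ?p" by (rule modification_mk_modif[OF W F H eps sm(1)]) (simp_all add: c A pn fc)
  have qm: "modification W F H ?q" by (rule modification_mk_modif[OF W F H eps sm(2)]) (simp_all add: c A qn fc)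
  have "Comp Lim i ?p \<in> lim_base \<alpha>"
    using catD(6)[OF catL, of ?p i] pm ib g(2) unfolding lim_base_def by (simp add: ip)
  then show thesis by (rule that[OF pm qm, rotated 4]) (simp_all add: pb)
qed

text \<open>
  The second base axiom, applied with an identity for \<open>i\<close>, gives one pullback of \<open>j\<close> along \<open>g\<close> that is
  pointwise. Any other one differs from it by an isomorphism, whose components are isomorphisms.
\<close>

lemma pointwise_if_pullback:
  assumes j: "j \<in> lim_base \<beta>" and pb: "is_pullback Lim j g p q" and w: "w \<in> Ob W" "x \<in> Obj (TObj F w)"
  shows "is_pullback (TObj H w) (Cmp (Cmp j w) x) (Cmp (Cmp g w) x) (Cmp (Cmp p w) x) (Cmp (Cmp q w) x)"
proof -
  note jb = lim_baseD[OF j]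
  have m: "modification W F H g" "modification W F H p" "modification W F H q" "Tgt g = \<beta>" "Src p = Src q" "Tgt p = Src g"
    using pullbackD[OF pb] jb by auto
  have i: "Ident Lim (Src g) \<in> lim_base (Src g)"
    using catD(3)[OF catL, of "Src g"] md(1)[OF m(1)] base tdf(1)[OF md(1)[OF m(1)]]
    unfolding lim_base_def base_of_computability_def by simp
  obtain p' q' where p': "modification W F H p'" "modification W F H q'" "Src q' = Src p'" "Tgt p' = Src g" "Tgt q' = Src j"
    and pw: "\<And>w x. w \<in> Ob W \<Longrightarrow> x \<in> Obj (TObj F w) \<Longrightarrow>
      is_pullback (TObj H w) (Cmp (Cmp j w) x) (Cmp (Cmp g w) x) (Cmp (Cmp p' w) x) (Cmp (Cmp q' w) x)"
    using lim_base_pullback[OF i j m(1)] m(4) by (metis ident_two_nat_cat(1))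
  have pb': "is_pullback Lim j g p' q'"
    by (rule pullback_if_pointwise[OF jb(1) m(1) p'(1,2)]) (simp_all add: jb m p' pw)
  obtain k k' where k: "k \<in> Arr Lim" "k' \<in> Arr Lim" "Dom Lim k = Dom Lim p" "Cod Lim k = Dom Lim p'" "Dom Lim k' = Dom Lim p'"
    "Cod Lim k' = Dom Lim p" "Comp Lim k' k = Ident Lim (Dom Lim p)" "Comp Lim k k' = Ident Lim (Dom Lim p')"
    "Comp Lim p' k = p" "Comp Lim q' k = q" by (rule pullbacks_isomorphic[OF catL pb pb'])
  have km: "modification W F H k" "modification W F H k'" using k by auto
  have "is_pullback (TObj H w) (Cmp (Cmp j w) x) (Cmp (Cmp g w) x)
     (Comp (TObj H w) (Cmp (Cmp p' w) x) (Cmp (Cmp k w) x)) (Comp (TObj H w) (Cmp (Cmp q' w) x) (Cmp (Cmp k w) x))"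
    using arg_cong[OF k(7), of "\<lambda>m. Cmp (Cmp m w) x"] arg_cong[OF k(8), of "\<lambda>m. Cmp (Cmp m w) x"] k(3-6) w
      mdc(1-3)[OF km(1)] mdc(1-3)[OF km(2)] mdc(1-3)[OF p'(1)]
    by (intro pullback_iso[OF h(1) pw, where k' = "Cmp (Cmp k' w) x"]) simp_all
  then show ?thesis using w unfolding k(9,10)[symmetric] by simp
qed

lemma base_of_computability_lim: "base_of_computability Lim lim_base"
proof -
  have mono: "is_mono Lim i" if i: "i \<in> lim_base \<alpha>" for \<alpha> i
  proof -
    note ib = lim_baseD[OF i]
    have "m = n" if m: "modification W F H m" "modification W F H n" "Src m = Src n" "Tgt m = Src i" "Tgt n = Src i" "Comp Lim i m = Comp Lim i n" for m n
    proof (rule meq[OF m(1,2,3)])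
      fix w x assume w: "w \<in> Ob W" "x \<in> Obj (TObj F w)"
      have "Comp (TObj H w) (Cmp (Cmp i w) x) (Cmp (Cmp m w) x) = Comp (TObj H w) (Cmp (Cmp i w) x) (Cmp (Cmp n w) x)"
        using arg_cong[OF m(6), of "\<lambda>m. Cmp (Cmp m w) x"] w by simp
      then show "Cmp (Cmp m w) x = Cmp (Cmp n w) x"
        using base_mono[OF w(1) _ ib(4)[OF w]] tdf(1)[OF ib(3) w] mdc(1-3)[OF m(1) w] mdc(1-3)[OF m(2) w] mdc(1-3)[OF ib(1) w] m(3-5)
        unfolding is_mono_def by auto
    qed (simp add: m)
    then show ?thesis unfolding is_mono_def using ib by simp
  qed
  have "Ident Lim \<alpha> \<in> lim_base \<alpha>" if "two_nat W F H \<alpha>" for \<alpha>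
    using catD(3)[OF catL, of \<alpha>] that base tdf(1)[OF that]
    unfolding lim_base_def base_of_computability_def by simp
  moreover have "\<exists>p q. is_pullback Lim j g p q \<and> Comp Lim i p \<in> lim_base \<alpha>"
    if i: "i \<in> lim_base \<alpha>" and j: "j \<in> lim_base \<beta>" and g: "modification W F H g" "Src g = Src i" "Tgt g = \<beta>" for i j g \<alpha> \<beta>
    using lim_base_pullback[OF i j g] pullback_if_pointwise[OF lim_baseD(1)[OF j] g(1)] lim_baseD(2)[OF j] g(3)
    by (smt (verit))
  ultimately show ?thesis
    unfolding base_of_computability_def using mono lim_baseD(2) by auto
qed

end


section \<open>Coding by elements of the universe\<close>

text \<open>
  A family indexed by a small family of small sets is coded in two steps: code it over each
  \<open>S i\<close>, then code the resulting family of codes. This is closure of smallness under sums.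
\<close>

lemma small_families_code:
  assumes I: "small TYPE('u) I" and S: "\<And>i. i \<in> I \<Longrightarrow> small TYPE('u) (S i)"
  shows "\<exists>c :: ('i \<Rightarrow> 's \<Rightarrow> 'u) \<Rightarrow> 'u. \<forall>f g. c f = c g \<longrightarrow> (\<forall>i\<in>I. \<forall>x\<in>S i. f i x = g i x)"
proof -
  obtain k :: "('i \<Rightarrow> 'u) \<Rightarrow> 'u" where k: "inj_on k (I \<rightarrow>\<^sub>E UNIV)" using I unfolding small_def by blast
  have "\<forall>i\<in>I. \<exists>k :: ('s \<Rightarrow> 'u) \<Rightarrow> 'u. inj_on k (S i \<rightarrow>\<^sub>E UNIV)" using S unfolding small_def by blast
  then obtain l :: "'i \<Rightarrow> ('s \<Rightarrow> 'u) \<Rightarrow> 'u" where l: "\<And>i. i \<in> I \<Longrightarrow> inj_on (l i) (S i \<rightarrow>\<^sub>E UNIV)" by metis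
  let ?c = "\<lambda>f. k (\<lambda>i\<in>I. l i (restrict (f i) (S i)))"
  have "f i x = g i x" if e: "k (\<lambda>i\<in>I. l i (restrict (f i) (S i))) = k (\<lambda>i\<in>I. l i (restrict (g i) (S i)))" and i: "i \<in> I" "x \<in> S i" for f g i x
  proof -
    have "(\<lambda>i\<in>I. l i (restrict (f i) (S i))) = (\<lambda>i\<in>I. l i (restrict (g i) (S i)))"
      using e by (rule inj_onD[OF k]) (simp_all add: PiE_def)
    from fun_cong[OF this, of i] have "l i (restrict (f i) (S i)) = l i (restrict (g i) (S i))"
      using i by simp
    then have "restrict (f i) (S i) = restrict (g i) (S i)"
      by (rule inj_onD[OF l[OF i(1)]]) (simp_all add: PiE_def)
    from fun_cong[OF this, of x] show ?thesis using i by simp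
  qed
  then show ?thesis by (intro exI[of _ ?c] allI impI ballI)
qed

lemma infinite_pairing:
  assumes "infinite (UNIV :: 'u set)"
  obtains p :: "'u \<times> 'u \<Rightarrow> 'u" where "inj p"
proof -
  obtain p :: "'u \<times> 'u \<Rightarrow> 'u" where "bij_betw p (UNIV \<times> UNIV) UNIV"
    using card_of_Times_same_infinite[OF assms] unfolding card_of_ordIso[symmetric] by blast
  then have "inj p" by (simp add: bij_betw_def)
  then show thesis by (rule that)
qed

text \<open>
  A transformation is determined by its values on the objects and the arrows of the weight, and a
  modification by its source, its target and its values on the objects: two or three small
  families, whose codes can be paired.
\<close>

lemma two_nat_cat_codes:
  fixes H :: "('w, 'x, 'y, 'u, 'u) cat_valued" and F :: "('w, 'x, 'y, 'p, 'b) cat_valued"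
  assumes W: "two_category W" and F: "two_functor W CAT F" and H: "two_functor W CAT H"
    and u: "infinite (UNIV :: 'u set)" and s: "small TYPE('u) (Ob W)"
    and sF: "\<And>w. w \<in> Ob W \<Longrightarrow> small_cat TYPE('u) (TObj F w)"
  shows "\<exists>c :: _ \<Rightarrow> 'u. inj_on c (Obj (two_nat_cat W F H))" "\<exists>d :: _ \<Rightarrow> 'u. inj_on d (Arr (two_nat_cat W F H))"
proof -
  obtain p :: "'u \<times> 'u \<Rightarrow> 'u" where p: "inj p" using infinite_pairing[OF u] .
  obtain k :: "('w \<Rightarrow> 'p \<Rightarrow> 'u) \<Rightarrow> 'u" where k: "\<And>f g i x. k f = k g \<Longrightarrow> i \<in> Ob W \<Longrightarrow> x \<in> Obj (TObj F i) \<Longrightarrow> f i x = g i x"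
    using small_families_code[OF s, of "\<lambda>w. Obj (TObj F w)"] sF unfolding small_cat_def by metis
  obtain l :: "('w \<Rightarrow> 'b \<Rightarrow> 'u) \<Rightarrow> 'u" where l: "\<And>f g i x. l f = l g \<Longrightarrow> i \<in> Ob W \<Longrightarrow> x \<in> Arr (TObj F i) \<Longrightarrow> f i x = g i x"
    using small_families_code[OF s, of "\<lambda>w. Arr (TObj F w)"] sF unfolding small_cat_def by metis
  define c where "c \<alpha> = p (k (\<lambda>w. OMap (\<alpha> w)), l (\<lambda>w. AMap (\<alpha> w)))" for \<alpha> :: "'w \<Rightarrow> ('p, 'b, 'u, 'u) functr"
  define d where "d m = p (p (c (Src m), c (Tgt m)), k (\<lambda>w. Cmp (Cmp m w)))" for m :: "('w, 'p, 'b, 'u, 'u) modif"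
  have c: "inj_on c (Obj (two_nat_cat W F H))"
  proof (rule inj_onI)
    fix \<alpha> \<beta> assume a: "\<alpha> \<in> Obj (two_nat_cat W F H)" "\<beta> \<in> Obj (two_nat_cat W F H)" and e: "c \<alpha> = c \<beta>"
    then have "k (\<lambda>w. OMap (\<alpha> w)) = k (\<lambda>w. OMap (\<beta> w))" "l (\<lambda>w. AMap (\<alpha> w)) = l (\<lambda>w. AMap (\<beta> w))"
      using injD[OF p] unfolding c_def by blast+
    then show "\<alpha> = \<beta>" using a k l by (intro two_nat_eqI[OF W F H]) auto
  qed
  then show "\<exists>c :: _ \<Rightarrow> 'u. inj_on c (Obj (two_nat_cat W F H))" by blast
  have "inj_on d (Arr (two_nat_cat W F H))"
  proof (rule inj_onI)
    fix m n assume m: "m \<in> Arr (two_nat_cat W F H)" "n \<in> Arr (two_nat_cat W F H)" and e: "d m = d n"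
    then have "c (Src m) = c (Src n)" "c (Tgt m) = c (Tgt n)" "k (\<lambda>w. Cmp (Cmp m w)) = k (\<lambda>w. Cmp (Cmp n w))"
      using injD[OF p] unfolding d_def by blast+
    moreover from this have "Src m = Src n" "Tgt m = Tgt n"
      using inj_onD[OF c, of "Src m" "Src n"] inj_onD[OF c, of "Tgt m" "Tgt n"] m modificationD(1,2)[OF W F H] by auto
    ultimately show "m = n" using m k by (intro modification_eqI[OF W F H]) auto
  qed
  then show "\<exists>d :: _ \<Rightarrow> 'u. inj_on d (Arr (two_nat_cat W F H))" by blast
qed

lemma category_copy:
  fixes c :: "'o \<Rightarrow> 'p" and d :: "'a \<Rightarrow> 'b"
  assumes C: "category C" and c: "inj_on c (Obj C)" and d: "inj_on d (Arr C)"
  obtains L :: "('p, 'b) cat" and D where "category L" "is_functor L C D"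
    "bij_betw (OMap D) (Obj L) (Obj C)" "bij_betw (AMap D) (Arr L) (Arr C)"
proof -
  let ?c = "inv_into (Obj C) c" and ?d = "inv_into (Arr C) d"
  define L where "L = \<lparr>Obj = c ` Obj C, Arr = d ` Arr C, Dom = (\<lambda>f. c (Dom C (?d f))), Cod = (\<lambda>f. c (Cod C (?d f))),
     Ident = (\<lambda>a. d (Ident C (?c a))), Comp = (\<lambda>g f. d (Comp C (?d g) (?d f)))\<rparr>"
  define D where "D = \<lparr>OMap = restrict ?c (Obj L), AMap = restrict ?d (Arr L)\<rparr>"
  note [simp] = inv_into_f_f[OF c] inv_into_f_f[OF d] catD[OF C] inj_on_eq_iff[OF c] inj_on_eq_iff[OF d]
  have "category L"
    unfolding category_def L_def by (auto intro: arg_cong[of _ _ d] cat_assoc[OF C])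
  moreover have "is_functor L C D" unfolding is_functor_def D_def by (auto simp: L_def)
  moreover have o: "Obj L = c ` Obj C" "Arr L = d ` Arr C" by (simp_all add: L_def)
  have "bij_betw (OMap D) (Obj L) (Obj C)" "bij_betw (AMap D) (Arr L) (Arr C)"
    using bij_betw_inv_into[OF inj_on_imp_bij_betw[OF c]] bij_betw_inv_into[OF inj_on_imp_bij_betw[OF d]]
    unfolding D_def o by (auto simp: bij_betw_def inj_on_def)
  ultimately show thesis by (rule that)
qed

section \<open>Transport along an isomorphism of categories\<close>

locale category_iso =
  fixes L :: "('p, 'b) cat" and C :: "('o, 'a) cat" and D
  assumes L: "category L" and C: "category C" and D: "is_functor L C D"
    and bO: "bij_betw (OMap D) (Obj L) (Obj C)" and bA: "bij_betw (AMap D) (Arr L) (Arr C)"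
begin

definition "inv_obj = inv_into (Obj L) (OMap D)"
definition "inv_arr = inv_into (Arr L) (AMap D)"

lemma inv_simps:
  "a \<in> Obj C \<Longrightarrow> inv_obj a \<in> Obj L" "a \<in> Obj C \<Longrightarrow> OMap D (inv_obj a) = a"
  "i \<in> Arr C \<Longrightarrow> inv_arr i \<in> Arr L" "i \<in> Arr C \<Longrightarrow> AMap D (inv_arr i) = i"
  "b \<in> Obj L \<Longrightarrow> inv_obj (OMap D b) = b" "j \<in> Arr L \<Longrightarrow> inv_arr (AMap D j) = j"
  unfolding inv_obj_def inv_arr_def
  by (simp_all add: bij_betwE[OF bij_betw_inv_into[OF bO], rule_format] bij_betwE[OF bij_betw_inv_into[OF bA], rule_format]
     bij_betw_inv_into_right[OF bO] bij_betw_inv_into_left[OF bO] bij_betw_inv_into_right[OF bA] bij_betw_inv_into_left[OF bA])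

lemmas D' = functorD[OF D]
lemmas injO = inj_onD[OF bij_betw_imp_inj_on[OF bO]] and injA = inj_onD[OF bij_betw_imp_inj_on[OF bA]]
lemmas eqO = inj_on_eq_iff[OF bij_betw_imp_inj_on[OF bO]] and eqA = inj_on_eq_iff[OF bij_betw_imp_inj_on[OF bA]]

lemma inv_dom:
  "i \<in> Arr C \<Longrightarrow> Dom L (inv_arr i) = inv_obj (Dom C i)" "i \<in> Arr C \<Longrightarrow> Cod L (inv_arr i) = inv_obj (Cod C i)"
proof -
  assume i: "i \<in> Arr C"
  have "OMap D (Dom L (inv_arr i)) = Dom C i" "OMap D (Cod L (inv_arr i)) = Cod C i"
    using D'(3,4)[OF inv_simps(3)[OF i]] by (simp_all add: inv_simps(4)[OF i])
  then show "Dom L (inv_arr i) = inv_obj (Dom C i)" "Cod L (inv_arr i) = inv_obj (Cod C i)"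
    using inv_simps(5)[OF catD(1)[OF L inv_simps(3)[OF i]]] inv_simps(5)[OF catD(2)[OF L inv_simps(3)[OF i]]] by simp_all
qed

lemma pullback_iff:
  assumes a: "j \<in> Arr L" "f \<in> Arr L" "p \<in> Arr L" "q \<in> Arr L"
  shows "is_pullback L j f p q \<longleftrightarrow> is_pullback C (AMap D j) (AMap D f) (AMap D p) (AMap D q)"
proof -
  note l = catD[OF L]
  have A: "(\<forall>x\<in>Arr C. P x) \<longleftrightarrow> (\<forall>x\<in>Arr L. P (AMap D x))" for P
    using bA by (metis bij_betw_imp_surj_on imageE imageI)
  have E: "(\<exists>!z. z \<in> Arr C \<and> P z) \<longleftrightarrow> (\<exists>!z. z \<in> Arr L \<and> P (AMap D z))" for P
    using inv_simps D'(2) injA by (smt (verit))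
  have c: "(Comp C (AMap D g) (AMap D h) = Comp C (AMap D g') (AMap D h')) \<longleftrightarrow> Comp L g h = Comp L g' h'"
    if "g \<in> Arr L" "h \<in> Arr L" "Cod L h = Dom L g" "g' \<in> Arr L" "h' \<in> Arr L" "Cod L h' = Dom L g'" for g h g' h'
    using that D'(6) eqA l(6) by metis
  have c1: "(Comp C (AMap D g) (AMap D h) = AMap D k) \<longleftrightarrow> Comp L g h = k"
    if "g \<in> Arr L" "h \<in> Arr L" "Cod L h = Dom L g" "k \<in> Arr L" for g h k
    using that D'(6) eqA l(6) by metis
  show ?thesis
    unfolding is_pullback_def A E using a
    by (simp add: D' l eqO c c1 cong: conj_cong imp_cong ball_cong)
qed

lemma base_copy:
  assumes B: "base_of_computability C B"
  shows "base_of_computability L (\<lambda>a. {i \<in> Arr L. AMap D i \<in> B (OMap D a)})"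
proof -
  note l = catD[OF L]
  have m: "is_mono L i" if i: "i \<in> Arr L" and m: "is_mono C (AMap D i)" for i
    unfolding is_mono_def
  proof (intro conjI ballI impI i)
    fix f g assume f: "f \<in> Arr L" "g \<in> Arr L" "Dom L f = Dom L g" "Cod L f = Dom L i" "Cod L g = Dom L i" "Comp L i f = Comp L i g"
    have "Comp C (AMap D i) (AMap D f) = Comp C (AMap D i) (AMap D g)" using f i D'(6)[of f i] D'(6)[of g i] by simp
    then have "AMap D f = AMap D g" using m f i unfolding is_mono_def by (simp add: D')
    then show "f = g" using f injA by blast
  qed
  have Bm: "is_mono C i" "Cod C i = a" if "a \<in> Obj C" "i \<in> B a" for a i
    using B that unfolding base_of_computability_def by simp_all
  have Bi: "Ident C a \<in> B a" if "a \<in> Obj C" for a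
    using B that unfolding base_of_computability_def by simp_all
  have pbx: "\<exists>p q. is_pullback L j f p q \<and> Comp L i p \<in> Arr L \<and> AMap D (Comp L i p) \<in> B (OMap D a)"
    if h: "a \<in> Obj L" "b \<in> Obj L" "i \<in> Arr L" "AMap D i \<in> B (OMap D a)" "j \<in> Arr L" "AMap D j \<in> B (OMap D b)"
      "f \<in> Arr L" "Dom L f = Dom L i" "Cod L f = b" for a b i j f
  proof -
    obtain p q where p: "is_pullback C (AMap D j) (AMap D f) p q" "Comp C (AMap D i) p \<in> B (OMap D a)"
      using base_pullback_exists[OF B D'(1)[OF h(1)] D'(1)[OF h(2)] h(4,6) D'(2)[OF h(7)]]
      by (auto simp: D' h)
    note pp = pullbackD[OF p(1)]
    have "is_pullback L j f (inv_arr p) (inv_arr q)" using pullback_iff[of j f "inv_arr p" "inv_arr q"] h p(1) pp by (simp add: inv_simps)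
    moreover have "Cod L (inv_arr p) = Dom L i" using h pp by (simp add: inv_dom D' inv_simps l)
    ultimately show ?thesis using h pp p(2) by (intro exI[of _ "inv_arr p"] exI[of _ "inv_arr q"]) (simp add: D' inv_simps l)
  qed
  have cod: "Cod L i = a" if "a \<in> Obj L" "i \<in> Arr L" "AMap D i \<in> B (OMap D a)" for a i
    using Bm(2)[OF D'(1)[OF that(1)] that(3)] injO[of "Cod L i" a] that by (simp add: l D')
  have mono: "is_mono L i" if "a \<in> Obj L" "i \<in> Arr L" "AMap D i \<in> B (OMap D a)" for a i
    using m[OF that(2) Bm(1)[OF D'(1)[OF that(1)] that(3)]] .
  show ?thesis
  proof (unfold base_of_computability_def, intro conjI ballI impI)
    fix a i assume "a \<in> Obj L" "i \<in> {i \<in> Arr L. AMap D i \<in> B (OMap D a)}"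
    then show "is_mono L i" "Cod L i = a" by (simp_all add: mono cod)
  next
    fix a assume "a \<in> Obj L"
    then show "Ident L a \<in> {i \<in> Arr L. AMap D i \<in> B (OMap D a)}" by (simp add: D' l Bi)
  next
    fix a b i j f
    assume "a \<in> Obj L" "b \<in> Obj L" "i \<in> {i \<in> Arr L. AMap D i \<in> B (OMap D a)}"
      "j \<in> {i \<in> Arr L. AMap D i \<in> B (OMap D b)}" "f \<in> Arr L" "Dom L f = Dom L i" "Cod L f = b"
    then show "\<exists>p q. is_pullback L j f p q \<and> Comp L i p \<in> {i \<in> Arr L. AMap D i \<in> B (OMap D a)}"
      using pbx[of a b i j f] by simp
  qed
qed

end

section \<open>The limit of a diagram of transfers\<close>

lemma Obj_transfer_cat [simp]: "Obj (transfer_cat X Y) = {F. computability_transfer X Y F}"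
  unfolding transfer_cat_def full_subcat_def functor_cat_def by (auto simp: computability_transfer_def)

lemma Arr_transfer_cat [simp]:
  "Arr (transfer_cat X Y) = {t. is_nt (fst X) (fst Y) t \<and> computability_transfer X Y (Src t) \<and> computability_transfer X Y (Tgt t)}"
  unfolding transfer_cat_def full_subcat_def functor_cat_def by (auto simp: computability_transfer_def)

lemma transfer_cat_simps [simp]:
  "Dom (transfer_cat X Y) = Src" "Cod (transfer_cat X Y) = Tgt" "Comp (transfer_cat X Y) = vcomp (fst X) (fst Y)"
  "Ident (transfer_cat X Y) = nt_id (fst X) (fst Y)"
  unfolding transfer_cat_def full_subcat_def functor_cat_def by simp_all

lemma CatBaseComp_simps [simp]:
  "Ob CatBaseComp = {(C, B). category C \<and> base_of_computability C B}"
  "Hom CatBaseComp = transfer_cat" "HId CatBaseComp X = functor_id (fst X)"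
  unfolding CatBaseComp_def by simp_all

lemma CatBaseComp_comp [simp]:
  "computability_transfer X Y f \<Longrightarrow> computability_transfer Y Z g \<Longrightarrow> comp1 CatBaseComp X Y Z g f = functor_comp (fst X) g f"
  "s \<in> Arr (transfer_cat X Y) \<Longrightarrow> t \<in> Arr (transfer_cat Y Z) \<Longrightarrow> comp2 CatBaseComp X Y Z t s = hcomp (fst X) (fst Z) t s"
  unfolding CatBaseComp_def two_cat.simps cat_hcomp_def functr.simps by simp_all


lemma transfer_functor: "computability_transfer X Y F \<Longrightarrow> is_functor (fst X) (fst Y) F"
  by (simp add: computability_transfer_def)

locale diagram_of_transfers =
  fixes W :: "('w, 'x, 'y) two_cat" and F :: "('w, 'x, 'y, 'p, 'b) cat_valued"
    and G :: "('w, 'x, 'y, 'u cat_base, ('u, 'u, 'u, 'u) functr, ('u, 'u, 'u, 'u) nt) two_functr"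
  assumes W: "two_category W" and F: "two_functor W CAT F" and G: "two_functor W CatBaseComp G"
    and pie: "coproduct_of_representables W (\<lambda>w. Obj (TObj F w)) (\<lambda>v w u. OMap (T1 F v w u))"
begin

text \<open>The diagram of underlying categories; transfers and their transformations are kept as they are.\<close>

definition H :: "('w, 'x, 'y, 'u, 'u) cat_valued" where
  "H = \<lparr>TObj = (\<lambda>w. fst (TObj G w)), THom = THom G\<rparr>"

lemma fold_H: "fst (TObj G w) = TObj H w" "THom G = THom H"
  by (simp_all add: H_def)

sublocale wd: weighted_diagram CatBaseComp W F G
  by unfold_locales (simp_all add: two_category_CatBaseComp W F G)

lemma G_ob: "w \<in> Ob W \<Longrightarrow> category (TObj H w)" "w \<in> Ob W \<Longrightarrow> base_of_computability (TObj H w) (snd (TObj G w))"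
  using two_functorD(1)[OF G, of w] by (auto simp: H_def)

lemma G_transfer: "v \<in> Ob W \<Longrightarrow> w \<in> Ob W \<Longrightarrow> u \<in> Obj (Hom W v w) \<Longrightarrow>
    computability_transfer (TObj G v) (TObj G w) (T1 H v w u)"
  using functorD(1)[OF two_functorD(2)[OF G], of v w u] by (simp add: H_def)

lemma two_functor_H: "two_functor W CAT H"
proof -
  note g = two_functorD[OF G] and gf = functorD[OF two_functorD(2)[OF G]]
  have 1: "is_functor (Hom W v w) (functor_cat (TObj H v) (TObj H w)) (THom H v w)" if "v \<in> Ob W" "w \<in> Ob W" for v w
    using g(2)[OF that] unfolding is_functor_def PiE_def by (auto simp: H_def computability_transfer_def)
  have 2: "T1 H v v (HId W v) = functor_id (TObj H v)" if "v \<in> Ob W" for v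
    using g(3)[OF that] by (simp add: H_def)
  have 3: "T1 H v z (comp1 W v w z q p) = functor_comp (TObj H v) (T1 H w z q) (T1 H v w p)"
    if "v \<in> Ob W" "w \<in> Ob W" "z \<in> Ob W" "p \<in> Obj (Hom W v w)" "q \<in> Obj (Hom W w z)" for v w z p q
    using g(4)[OF that] that gf(1)[of v w p] gf(1)[of w z q] by (simp add: H_def)
  have 4: "T2 H v z (comp2 W v w z q p) = hcomp (TObj H v) (TObj H z) (T2 H w z q) (T2 H v w p)"
    if "v \<in> Ob W" "w \<in> Ob W" "z \<in> Ob W" "p \<in> Arr (Hom W v w)" "q \<in> Arr (Hom W w z)" for v w z p q
    using g(5)[OF that] that gf(2)[of v w p] gf(2)[of w z q] by (simp add: H_def)
  show ?thesis
    unfolding two_functor_def CAT_def using functorD(1,2)[OF 1] by (simp add: G_ob 1 2 3 4 cat_hcomp_def)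
qed

sublocale db: diagram_of_bases W F H "\<lambda>w. snd (TObj G w)"
  using W F two_functor_H G_ob G_transfer pie by unfold_locales (simp_all add: H_def)

end

text \<open>
  The category of transformations lives in other types than the objects of \<open>CatBaseComp\<close>, so
  a copy \<open>L\<close> of it inside the universe is taken, with \<open>D\<close> the isomorphism that decodes it.
\<close>

locale coded_limit = diagram_of_transfers W F G + category_iso L "two_nat_cat W F H" D
  for W :: "('w, 'x, 'y) two_cat" and F :: "('w, 'x, 'y, 'p, 'b) cat_valued"
    and G :: "('w, 'x, 'y, 'u cat_base, ('u, 'u, 'u, 'u) functr, ('u, 'u, 'u, 'u) nt) two_functr"
    and L :: "('u, 'u) cat" and D
begin

definition limit_ob :: "'u cat_base" where
  "limit_ob = (L, \<lambda>a. {i \<in> Arr L. AMap D i \<in> db.lim_base (OMap D a)})"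

lemma fst_limit_ob [simp]: "fst limit_ob = L" by (simp add: limit_ob_def)

lemma limit_ob_in_Ob: "limit_ob \<in> Ob CatBaseComp"
  by (simp add: limit_ob_def L base_copy db.base_of_computability_lim)

lemmas lc = catD[OF L]

lemma D_obj_two_nat: "a \<in> Obj L \<Longrightarrow> two_nat W F H (OMap D a)"
  and D_arr_modification: "i \<in> Arr L \<Longrightarrow> modification W F H (AMap D i)"
  using D'(1,2) by simp_all

lemmas ot = db.td[OF D_obj_two_nat] and otf = db.tdf[OF D_obj_two_nat]
lemmas am = db.md[OF D_arr_modification] and amc = db.mdc[OF D_arr_modification]

lemma D_src: "i \<in> Arr L \<Longrightarrow> Src (AMap D i) = OMap D (Dom L i)"
  and D_tgt: "i \<in> Arr L \<Longrightarrow> Tgt (AMap D i) = OMap D (Cod L i)"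
  using D'(3,4) by simp_all

lemma D_natural:
  assumes i: "i \<in> Arr L" and w: "w \<in> Ob W" "\<phi> \<in> Arr (TObj F w)"
  shows "Comp (TObj H w) (AMap (OMap D (Cod L i) w) \<phi>) (Cmp (Cmp (AMap D i) w) (Dom (TObj F w) \<phi>))
    = Comp (TObj H w) (Cmp (Cmp (AMap D i) w) (Cod (TObj F w) \<phi>)) (AMap (OMap D (Dom L i) w) \<phi>)"
  using amc(4)[OF i w] by (simp add: D_src[OF i] D_tgt[OF i])

text \<open>
  Evaluation at an object \<open>x\<close> of \<open>F w\<close> is a functor from the limit to \<open>H w\<close>, and evaluation at an arrow
  is a transformation of such functors. These are the components of the universal cone.
\<close>

definition proj :: "'w \<Rightarrow> 'p \<Rightarrow> ('u, 'u, 'u, 'u) functr" where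
  "proj w x = \<lparr>OMap = (\<lambda>a\<in>Obj L. OMap (OMap D a w) x), AMap = (\<lambda>i\<in>Arr L. Cmp (Cmp (AMap D i) w) x)\<rparr>"

definition proj_nt :: "'w \<Rightarrow> 'b \<Rightarrow> ('u, 'u, 'u, 'u) nt" where
  "proj_nt w \<phi> = \<lparr>Src = proj w (Dom (TObj F w) \<phi>), Tgt = proj w (Cod (TObj F w) \<phi>), Cmp = (\<lambda>a\<in>Obj L. AMap (OMap D a w) \<phi>)\<rparr>"

lemma proj_simps [simp]:
  "a \<in> Obj L \<Longrightarrow> OMap (proj w x) a = OMap (OMap D a w) x"
  "i \<in> Arr L \<Longrightarrow> AMap (proj w x) i = Cmp (Cmp (AMap D i) w) x"
  by (simp_all add: proj_def)

lemma proj_nt_simps [simp]: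
  "Src (proj_nt w \<phi>) = proj w (Dom (TObj F w) \<phi>)" "Tgt (proj_nt w \<phi>) = proj w (Cod (TObj F w) \<phi>)"
  "a \<in> Obj L \<Longrightarrow> Cmp (proj_nt w \<phi>) a = AMap (OMap D a w) \<phi>"
  by (simp_all add: proj_nt_def)

lemma functor_proj:
  assumes w: "w \<in> Ob W" and x: "x \<in> Obj (TObj F w)"
  shows "is_functor L (TObj H w) (proj w x)"
  unfolding is_functor_def using w x
  by (auto simp: proj_def otf amc(1-3) lc D'(5,6) D_src D_tgt)

lemma proj_weight:
  assumes "v \<in> Ob W" "w \<in> Ob W" "u \<in> Obj (Hom W v w)" "x \<in> Obj (TObj F v)"
  shows "functor_comp L (T1 H v w u) (proj v x) = proj w (OMap (T1 F v w u) x)"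
  by (rule functor_eqI[OF functor_fcomp[OF L functor_proj db.h(2)] functor_proj])
    (simp_all add: assms db.fo ot am functor_comp_def)

text \<open>Preservation of the pullbacks of base arrows is the statement that these pullbacks are pointwise.\<close>

lemma transfer_proj:
  assumes w: "w \<in> Ob W" and x: "x \<in> Obj (TObj F w)"
  shows "computability_transfer limit_ob (TObj G w) (proj w x)"
proof -
  have "is_pullback (TObj H w) (AMap (proj w x) j) (AMap (proj w x) f) (AMap (proj w x) p) (AMap (proj w x) q)"
    if j: "b \<in> Obj L" "j \<in> Arr L" "AMap D j \<in> db.lim_base (OMap D b)" and pb: "is_pullback L j f p q" for b j f p q
    using db.pointwise_if_pullback[OF j(3) _ w x] pb pullback_iff[OF pullbackD(1-4)[OF pb]] pullbackD(1-4)[OF pb] by simp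
  then show ?thesis
    unfolding computability_transfer_def
    using functor_proj[OF w x] db.lim_baseD(4)[OF _ w x] by (auto simp: fold_H limit_ob_def)
qed

lemma nt_proj_nt:
  assumes w: "w \<in> Ob W" and x: "\<phi> \<in> Arr (TObj F w)"
  shows "is_nt L (TObj H w) (proj_nt w \<phi>)"
  unfolding is_nt_def using w x functor_proj[OF w]
  by (auto simp: db.fc otf lc D_natural proj_nt_def)

lemma whisker_G:
  assumes A: "category A" and v: "v \<in> Ob W" "w \<in> Ob W"
  shows "u \<in> Obj (Hom W v w) \<Longrightarrow> is_nt A (TObj H v) t \<Longrightarrow> a \<in> Obj A \<Longrightarrow>
      Cmp (hcomp A (TObj H w) (nt_id (TObj H v) (TObj H w) (T1 H v w u)) t) a = AMap (T1 H v w u) (Cmp t a)"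
    and "s \<in> Arr (Hom W v w) \<Longrightarrow> is_functor A (TObj H v) p \<Longrightarrow> a \<in> Obj A \<Longrightarrow>
      Cmp (hcomp A (TObj H w) (T2 H v w s) (nt_id A (TObj H v) p)) a = Cmp (T2 H v w s) (OMap p a)"
  using v by (simp_all add: whisker_left[OF A db.h(1) db.h(1) db.h(2)] whisker_right[OF A db.h(1) db.h(1) _ db.h(3)])

lemma G_cells:
  assumes v: "v \<in> Ob W" "w \<in> Ob W"
  shows "u \<in> Obj (Hom W v w) \<Longrightarrow>
      is_nt (TObj H v) (TObj H w) (nt_id (TObj H v) (TObj H w) (T1 H v w u))"
    and "s \<in> Arr (Hom W v w) \<Longrightarrow> is_nt (TObj H v) (TObj H w) (T2 H v w s)"
    and "s \<in> Arr (Hom W v w) \<Longrightarrow> computability_transfer (TObj G v) (TObj G w) (Src (T2 H v w s))"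
    and "s \<in> Arr (Hom W v w) \<Longrightarrow> computability_transfer (TObj G v) (TObj G w) (Tgt (T2 H v w s))"
  using v by (simp_all add: nt_nt_id db.h G_transfer db.wcc)

lemma hom_values:
  assumes A: "A \<in> Ob CatBaseComp" and v: "v \<in> Ob W" "w \<in> Ob W"
  shows "u \<in> Obj (Hom W v w) \<Longrightarrow> computability_transfer A (TObj G v) p \<Longrightarrow>
      OMap (T1 (wd.hom A) v w u) p = functor_comp (fst A) (T1 H v w u) p"
    and "u \<in> Obj (Hom W v w) \<Longrightarrow> t \<in> Arr (transfer_cat A (TObj G v)) \<Longrightarrow>
      AMap (T1 (wd.hom A) v w u) t = hcomp (fst A) (TObj H w) (nt_id (TObj H v) (TObj H w) (T1 H v w u)) t"
    and "s \<in> Arr (Hom W v w) \<Longrightarrow> computability_transfer A (TObj G v) p \<Longrightarrow>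
      Cmp (T2 (wd.hom A) v w s) p = hcomp (fst A) (TObj H w) (T2 H v w s) (nt_id (fst A) (TObj H v) p)"
  using v A G_cells[OF v] transfer_functor[of A "TObj G v" p]
  by (auto simp: hom_simps[OF G] G_transfer fold_H nt_nt_id G_ob)

text \<open>The cone formed by the evaluations; it is the universal one.\<close>

definition \<kappa> where "\<kappa> = mk_two_nat W F proj proj_nt"

lemma proj_nt_Arr: "w \<in> Ob W \<Longrightarrow> \<phi> \<in> Arr (TObj F w) \<Longrightarrow> proj_nt w \<phi> \<in> Arr (transfer_cat limit_ob (TObj G w))"
  by (simp add: nt_proj_nt transfer_proj db.fc fold_H)

lemma cone_kappa: "two_nat W F (wd.hom limit_ob) \<kappa>"
  unfolding \<kappa>_def
proof (rule two_nat_mk_two_nat[OF W F wd.hom[OF limit_ob_in_Ob]])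
  show "proj w x \<in> Obj (TObj (wd.hom limit_ob) w)" if "w \<in> Ob W" "x \<in> Obj (TObj F w)" for w x
    using transfer_proj that by simp
  show "proj_nt w \<phi> \<in> Arr (TObj (wd.hom limit_ob) w)" if "w \<in> Ob W" "\<phi> \<in> Arr (TObj F w)" for w \<phi>
    using proj_nt_Arr[OF that] by simp
  show "Dom (TObj (wd.hom limit_ob) w) (proj_nt w \<phi>) = proj w (Dom (TObj F w) \<phi>)" "Cod (TObj (wd.hom limit_ob) w) (proj_nt w \<phi>) = proj w (Cod (TObj F w) \<phi>)" for w \<phi>
    by simp_all
next
  fix w x assume w: "w \<in> Ob W" "x \<in> Obj (TObj F w)"
  have "proj_nt w (Ident (TObj F w) x) = nt_id L (TObj H w) (proj w x)"
    by (rule nt_eqI[OF nt_proj_nt nt_nt_id[OF L _ functor_proj]]) (simp_all add: w db.fc otf G_ob)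
  then show "proj_nt w (Ident (TObj F w) x) = Ident (TObj (wd.hom limit_ob) w) (proj w x)" by (simp add: fold_H)
next
  fix w \<phi> \<psi> assume w: "w \<in> Ob W" "\<phi> \<in> Arr (TObj F w)" "\<psi> \<in> Arr (TObj F w)" "Cod (TObj F w) \<phi> = Dom (TObj F w) \<psi>"
  have "proj_nt w (Comp (TObj F w) \<psi> \<phi>) = vcomp L (TObj H w) (proj_nt w \<psi>) (proj_nt w \<phi>)"
    by (rule nt_eqI[OF nt_proj_nt nt_vcomp[OF L _ nt_proj_nt nt_proj_nt]]) (simp_all add: w db.fc otf G_ob)
  then show "proj_nt w (Comp (TObj F w) \<psi> \<phi>) = Comp (TObj (wd.hom limit_ob) w) (proj_nt w \<psi>) (proj_nt w \<phi>)" by (simp add: fold_H)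
next
  fix v w u x assume v: "v \<in> Ob W" "w \<in> Ob W" and u: "u \<in> Obj (Hom W v w)" and x: "x \<in> Obj (TObj F v)"
  then show "OMap (T1 (wd.hom limit_ob) v w u) (proj v x) = proj w (OMap (T1 F v w u) x)"
    by (simp add: hom_values[OF limit_ob_in_Ob] transfer_proj proj_weight)
next
  fix v w u \<phi> assume v: "v \<in> Ob W" "w \<in> Ob W" and u: "u \<in> Obj (Hom W v w)" and x: "\<phi> \<in> Arr (TObj F v)"
  have "hcomp L (TObj H w) (nt_id (TObj H v) (TObj H w) (T1 H v w u)) (proj_nt v \<phi>) = proj_nt w (AMap (T1 F v w u) \<phi>)"
    by (rule nt_eqI[OF nt_hcomp[OF L _ _ nt_proj_nt G_cells(1)] nt_proj_nt])
      (simp_all add: v u x db.fo db.fc ot G_ob whisker_G[OF L] nt_proj_nt, simp_all add: hcomp_def proj_weight v u x db.fc)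
  then show "AMap (T1 (wd.hom limit_ob) v w u) (proj_nt v \<phi>) = proj_nt w (AMap (T1 F v w u) \<phi>)"
    using v u x proj_nt_Arr[OF v(1) x] by (simp add: hom_values[OF limit_ob_in_Ob])
next
  fix v w s x assume v: "v \<in> Ob W" "w \<in> Ob W" and s: "s \<in> Arr (Hom W v w)" and x: "x \<in> Obj (TObj F v)"
  have "hcomp L (TObj H w) (T2 H v w s) (nt_id L (TObj H v) (proj v x)) = proj_nt w (Cmp (T2 F v w s) x)"
    by (rule nt_eqI[OF nt_hcomp[OF L _ _ nt_nt_id[OF L _ functor_proj] G_cells(2)] nt_proj_nt])
      (simp_all add: v s x db.fa db.fc ot G_ob whisker_G[OF L] functor_proj, simp_all add: hcomp_def proj_weight v s x db.fc db.f db.h db.wcc)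
  then show "Cmp (T2 (wd.hom limit_ob) v w s) (proj v x) = proj_nt w (Cmp (T2 F v w s) x)"
    using v s x by (simp add: hom_values[OF limit_ob_in_Ob] transfer_proj)
qed


lemma functor_into_L:
  assumes "computability_transfer A limit_ob h"
  shows "is_functor (fst A) L h"
  using transfer_functor[OF assms] by simp

lemma kappa_comp:
  assumes A: "A \<in> Ob CatBaseComp" and h: "computability_transfer A limit_ob h" and w: "w \<in> Ob W"
  shows "x \<in> Obj (TObj F w) \<Longrightarrow> OMap (wd.cone_comp limit_ob A \<kappa> h w) x = functor_comp (fst A) (proj w x) h"
    and "\<phi> \<in> Arr (TObj F w) \<Longrightarrow>
      AMap (wd.cone_comp limit_ob A \<kappa> h w) \<phi> = hcomp (fst A) (TObj H w) (proj_nt w \<phi>) (nt_id (fst A) L h)"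
  using A w proj_nt_Arr[OF w, of \<phi>] functor_into_L[OF h] h
  by (auto simp: \<kappa>_def transfer_proj nt_nt_id L fold_H)

lemma kappa_comp_values:
  assumes A: "A \<in> Ob CatBaseComp" and h: "computability_transfer A limit_ob h" and w: "w \<in> Ob W"
  shows "x \<in> Obj (TObj F w) \<Longrightarrow> a \<in> Obj (fst A) \<Longrightarrow>
      OMap (OMap (wd.cone_comp limit_ob A \<kappa> h w) x) a = OMap (OMap D (OMap h a) w) x"
    and "x \<in> Obj (TObj F w) \<Longrightarrow> f \<in> Arr (fst A) \<Longrightarrow>
      AMap (OMap (wd.cone_comp limit_ob A \<kappa> h w) x) f = Cmp (Cmp (AMap D (AMap h f)) w) x"
    and "\<phi> \<in> Arr (TObj F w) \<Longrightarrow> a \<in> Obj (fst A) \<Longrightarrow>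
      Cmp (AMap (wd.cone_comp limit_ob A \<kappa> h w) \<phi>) a = AMap (OMap D (OMap h a) w) \<phi>"
proof -
  have A': "category (fst A)" using A by auto
  note h' = functorD[OF functor_into_L[OF h]]
  show "x \<in> Obj (TObj F w) \<Longrightarrow> a \<in> Obj (fst A) \<Longrightarrow>
      OMap (OMap (wd.cone_comp limit_ob A \<kappa> h w) x) a = OMap (OMap D (OMap h a) w) x"
    "x \<in> Obj (TObj F w) \<Longrightarrow> f \<in> Arr (fst A) \<Longrightarrow>
      AMap (OMap (wd.cone_comp limit_ob A \<kappa> h w) x) f = Cmp (Cmp (AMap D (AMap h f)) w) x"
    by (simp_all only: kappa_comp[OF A h w]) (simp_all add: functor_comp_def h')
  show "\<phi> \<in> Arr (TObj F w) \<Longrightarrow> a \<in> Obj (fst A) \<Longrightarrow>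
      Cmp (AMap (wd.cone_comp limit_ob A \<kappa> h w) \<phi>) a = AMap (OMap D (OMap h a) w) \<phi>"
    by (simp only: kappa_comp[OF A h w])
      (simp add: whisker_right[OF A' L G_ob(1)[OF w] functor_into_L[OF h] nt_proj_nt[OF w]] h')
qed

lemma kappa_comp2_values:
  assumes A: "A \<in> Ob CatBaseComp" and t: "t \<in> Arr (transfer_cat A limit_ob)" and w: "w \<in> Ob W" and x: "x \<in> Obj (TObj F w)"
    and a: "a \<in> Obj (fst A)"
  shows "Cmp (Cmp (Cmp (wd.cone_comp2 limit_ob A \<kappa> t) w) x) a = Cmp (Cmp (AMap D (Cmp t a)) w) x"
proof -
  have A': "category (fst A)" using A by auto
  have t': "is_nt (fst A) L t" using t by simp
  have "nt_id L (TObj H w) (proj w x) \<in> Arr (transfer_cat limit_ob (TObj G w))"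
    using w x by (simp add: nt_nt_id L G_ob functor_proj transfer_proj fold_H)
  then have "Cmp (Cmp (wd.cone_comp2 limit_ob A \<kappa> t) w) x = hcomp (fst A) (TObj H w) (nt_id L (TObj H w) (proj w x)) t"
    using t w x by (simp add: \<kappa>_def fold_H)
  then show ?thesis
    by (simp only:) (simp add: whisker_left[OF A' L G_ob(1)[OF w] functor_proj[OF w x] t'] a ntD[OF t'])
qed

lemma kappa_jointly_faithful:
  assumes "i \<in> Arr L" "j \<in> Arr L" "Dom L i = Dom L j" "Cod L i = Cod L j"
    and "\<And>w x. w \<in> Ob W \<Longrightarrow> x \<in> Obj (TObj F w) \<Longrightarrow> Cmp (Cmp (AMap D i) w) x = Cmp (Cmp (AMap D j) w) x"
  shows "i = j"
proof -
  have "AMap D i = AMap D j"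
    by (rule db.meq[OF D_arr_modification D_arr_modification]) (simp_all add: assms D_src D_tgt)
  then show ?thesis using injA assms by blast
qed

lemma kappa_comp_inj:
  assumes A: "A \<in> Ob CatBaseComp"
  shows "inj_on (wd.cone_comp limit_ob A \<kappa>) (Obj (transfer_cat A limit_ob))"
proof (rule inj_onI)
  fix h k assume "h \<in> Obj (transfer_cat A limit_ob)" "k \<in> Obj (transfer_cat A limit_ob)"
    and e: "wd.cone_comp limit_ob A \<kappa> h = wd.cone_comp limit_ob A \<kappa> k"
  then have h: "computability_transfer A limit_ob h" and k: "computability_transfer A limit_ob k" by simp_all
  note hf = functorD[OF functor_into_L[OF h]] and kf = functorD[OF functor_into_L[OF k]]
  have A': "category (fst A)" using A by auto
  have o: "OMap h a = OMap k a" if a: "a \<in> Obj (fst A)" for a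
  proof (rule injO)
    show "OMap D (OMap h a) = OMap D (OMap k a)"
    proof (rule db.teq[OF D_obj_two_nat D_obj_two_nat])
      fix w x assume w: "w \<in> Ob W" "x \<in> Obj (TObj F w)"
      show "OMap (OMap D (OMap h a) w) x = OMap (OMap D (OMap k a) w) x"
        using kappa_comp_values(1)[OF A h w a] kappa_comp_values(1)[OF A k w a] e by simp
    next
      fix w \<phi> assume w: "w \<in> Ob W" "\<phi> \<in> Arr (TObj F w)"
      show "AMap (OMap D (OMap h a) w) \<phi> = AMap (OMap D (OMap k a) w) \<phi>"
        using kappa_comp_values(3)[OF A h w a] kappa_comp_values(3)[OF A k w a] e by simp
    qed (simp_all add: hf kf a)
  qed (simp_all add: hf kf a)
  show "h = k"
  proof (rule functor_eqI[OF functor_into_L[OF h] functor_into_L[OF k] o])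
    fix f assume f: "f \<in> Arr (fst A)"
    show "AMap h f = AMap k f"
    proof (rule kappa_jointly_faithful)
      fix w x assume w: "w \<in> Ob W" "x \<in> Obj (TObj F w)"
      show "Cmp (Cmp (AMap D (AMap h f)) w) x = Cmp (Cmp (AMap D (AMap k f)) w) x"
        using kappa_comp_values(2)[OF A h w f] kappa_comp_values(2)[OF A k w f] e by simp
    qed (simp_all add: hf kf f o catD[OF A'])
  qed
qed

lemma kappa_comp2_inj:
  assumes A: "A \<in> Ob CatBaseComp"
  shows "inj_on (wd.cone_comp2 limit_ob A \<kappa>) (Arr (transfer_cat A limit_ob))"
proof (rule inj_onI)
  fix s t assume s: "s \<in> Arr (transfer_cat A limit_ob)" and t: "t \<in> Arr (transfer_cat A limit_ob)"
    and e: "wd.cone_comp2 limit_ob A \<kappa> s = wd.cone_comp2 limit_ob A \<kappa> t"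
  have s': "is_nt (fst A) L s" and t': "is_nt (fst A) L t" using s t by simp_all
  have "wd.cone_comp limit_ob A \<kappa> (Src s) = wd.cone_comp limit_ob A \<kappa> (Src t)" "wd.cone_comp limit_ob A \<kappa> (Tgt s) = wd.cone_comp limit_ob A \<kappa> (Tgt t)"
    using arg_cong[OF e, of Src] arg_cong[OF e, of Tgt] by simp_all
  then have st: "Src s = Src t" "Tgt s = Tgt t"
    using inj_onD[OF kappa_comp_inj[OF A]] s t by simp_all
  show "s = t"
  proof (rule nt_eqI[OF s' t' st])
    fix a assume a: "a \<in> Obj (fst A)"
    show "Cmp s a = Cmp t a"
    proof (rule kappa_jointly_faithful)
      fix w x assume w: "w \<in> Ob W" "x \<in> Obj (TObj F w)"
      show "Cmp (Cmp (AMap D (Cmp s a)) w) x = Cmp (Cmp (AMap D (Cmp t a)) w) x"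
        using kappa_comp2_values[OF A s w a] kappa_comp2_values[OF A t w a] e by simp
    qed (simp_all add: ntD[OF s'] ntD[OF t'] a st)
  qed
qed

lemma cone_values:
  assumes A: "A \<in> Ob CatBaseComp" and b: "two_nat W F (wd.hom A) \<beta>"
  shows "w \<in> Ob W \<Longrightarrow> x \<in> Obj (TObj F w) \<Longrightarrow> computability_transfer A (TObj G w) (OMap (\<beta> w) x)"
    and "w \<in> Ob W \<Longrightarrow> \<phi> \<in> Arr (TObj F w) \<Longrightarrow> is_nt (fst A) (TObj H w) (AMap (\<beta> w) \<phi>)"
    and "w \<in> Ob W \<Longrightarrow> \<phi> \<in> Arr (TObj F w) \<Longrightarrow> Src (AMap (\<beta> w) \<phi>) = OMap (\<beta> w) (Dom (TObj F w) \<phi>)"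
    and "w \<in> Ob W \<Longrightarrow> \<phi> \<in> Arr (TObj F w) \<Longrightarrow> Tgt (AMap (\<beta> w) \<phi>) = OMap (\<beta> w) (Cod (TObj F w) \<phi>)"
    and "w \<in> Ob W \<Longrightarrow> x \<in> Obj (TObj F w) \<Longrightarrow> a \<in> Obj (fst A) \<Longrightarrow>
      Cmp (AMap (\<beta> w) (Ident (TObj F w) x)) a = Ident (TObj H w) (OMap (OMap (\<beta> w) x) a)"
    and "w \<in> Ob W \<Longrightarrow> \<phi> \<in> Arr (TObj F w) \<Longrightarrow> \<psi> \<in> Arr (TObj F w) \<Longrightarrow> Cod (TObj F w) \<phi> = Dom (TObj F w) \<psi> \<Longrightarrow>
      a \<in> Obj (fst A) \<Longrightarrow>
      Cmp (AMap (\<beta> w) (Comp (TObj F w) \<psi> \<phi>)) a = Comp (TObj H w) (Cmp (AMap (\<beta> w) \<psi>) a) (Cmp (AMap (\<beta> w) \<phi>) a)"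
    and "v \<in> Ob W \<Longrightarrow> w \<in> Ob W \<Longrightarrow> u \<in> Obj (Hom W v w) \<Longrightarrow> x \<in> Obj (TObj F v) \<Longrightarrow> a \<in> Obj (fst A) \<Longrightarrow>
      OMap (OMap (\<beta> w) (OMap (T1 F v w u) x)) a = OMap (T1 H v w u) (OMap (OMap (\<beta> v) x) a)"
    and "v \<in> Ob W \<Longrightarrow> w \<in> Ob W \<Longrightarrow> u \<in> Obj (Hom W v w) \<Longrightarrow> x \<in> Obj (TObj F v) \<Longrightarrow> f \<in> Arr (fst A) \<Longrightarrow>
      AMap (OMap (\<beta> w) (OMap (T1 F v w u) x)) f = AMap (T1 H v w u) (AMap (OMap (\<beta> v) x) f)"
    and "v \<in> Ob W \<Longrightarrow> w \<in> Ob W \<Longrightarrow> u \<in> Obj (Hom W v w) \<Longrightarrow> \<phi> \<in> Arr (TObj F v) \<Longrightarrow> a \<in> Obj (fst A) \<Longrightarrow>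
      Cmp (AMap (\<beta> w) (AMap (T1 F v w u) \<phi>)) a = AMap (T1 H v w u) (Cmp (AMap (\<beta> v) \<phi>) a)"
    and "v \<in> Ob W \<Longrightarrow> w \<in> Ob W \<Longrightarrow> s \<in> Arr (Hom W v w) \<Longrightarrow> x \<in> Obj (TObj F v) \<Longrightarrow> a \<in> Obj (fst A) \<Longrightarrow>
      Cmp (AMap (\<beta> w) (Cmp (T2 F v w s) x)) a = Cmp (T2 H v w s) (OMap (OMap (\<beta> v) x) a)"
proof -
  have A': "category (fst A)" using A by auto
  note c = wd.coneD(2-7)[OF A b, simplified, unfolded fold_H]
  note td = two_natD(3-5)[OF W F wd.hom[OF A] b]
  show 1: "w \<in> Ob W \<Longrightarrow> x \<in> Obj (TObj F w) \<Longrightarrow> computability_transfer A (TObj G w) (OMap (\<beta> w) x)" for w x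
    using c(1) by simp
  have 2: "w \<in> Ob W \<Longrightarrow> \<phi> \<in> Arr (TObj F w) \<Longrightarrow> AMap (\<beta> w) \<phi> \<in> Arr (transfer_cat A (TObj G w))" for w \<phi>
    using wd.coneD(3)[OF A b] by simp
  show 3: "w \<in> Ob W \<Longrightarrow> \<phi> \<in> Arr (TObj F w) \<Longrightarrow> is_nt (fst A) (TObj H w) (AMap (\<beta> w) \<phi>)" for w \<phi>
    using 2 by (simp add: fold_H)
  show "w \<in> Ob W \<Longrightarrow> \<phi> \<in> Arr (TObj F w) \<Longrightarrow> Src (AMap (\<beta> w) \<phi>) = OMap (\<beta> w) (Dom (TObj F w) \<phi>)"
    "w \<in> Ob W \<Longrightarrow> \<phi> \<in> Arr (TObj F w) \<Longrightarrow> Tgt (AMap (\<beta> w) \<phi>) = OMap (\<beta> w) (Cod (TObj F w) \<phi>)"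
    using c(3,4) by simp_all
  show "w \<in> Ob W \<Longrightarrow> x \<in> Obj (TObj F w) \<Longrightarrow> a \<in> Obj (fst A) \<Longrightarrow>
      Cmp (AMap (\<beta> w) (Ident (TObj F w) x)) a = Ident (TObj H w) (OMap (OMap (\<beta> w) x) a)"
    using c(5) by simp
  show "w \<in> Ob W \<Longrightarrow> \<phi> \<in> Arr (TObj F w) \<Longrightarrow> \<psi> \<in> Arr (TObj F w) \<Longrightarrow> Cod (TObj F w) \<phi> = Dom (TObj F w) \<psi> \<Longrightarrow>
      a \<in> Obj (fst A) \<Longrightarrow>
      Cmp (AMap (\<beta> w) (Comp (TObj F w) \<psi> \<phi>)) a = Comp (TObj H w) (Cmp (AMap (\<beta> w) \<psi>) a) (Cmp (AMap (\<beta> w) \<phi>) a)"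
    using c(6) by simp
  have 4: "w \<in> Ob W \<Longrightarrow> x \<in> Obj (TObj F w) \<Longrightarrow> is_functor (fst A) (TObj H w) (OMap (\<beta> w) x)" for w x
    using transfer_functor[OF 1] by (simp add: fold_H)
  { assume v: "v \<in> Ob W" "w \<in> Ob W" "u \<in> Obj (Hom W v w)" "x \<in> Obj (TObj F v)"
    have e: "OMap (\<beta> w) (OMap (T1 F v w u) x) = functor_comp (fst A) (T1 H v w u) (OMap (\<beta> v) x)"
      using td(1)[OF v] v by (simp add: hom_values[OF A] 1)
    show "a \<in> Obj (fst A) \<Longrightarrow> OMap (OMap (\<beta> w) (OMap (T1 F v w u) x)) a = OMap (T1 H v w u) (OMap (OMap (\<beta> v) x) a)"
      "f \<in> Arr (fst A) \<Longrightarrow> AMap (OMap (\<beta> w) (OMap (T1 F v w u) x)) f = AMap (T1 H v w u) (AMap (OMap (\<beta> v) x) f)"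
      by (simp_all add: e functor_comp_def) }
  { assume v: "v \<in> Ob W" "w \<in> Ob W" "u \<in> Obj (Hom W v w)" "\<phi> \<in> Arr (TObj F v)" "a \<in> Obj (fst A)"
    show "Cmp (AMap (\<beta> w) (AMap (T1 F v w u) \<phi>)) a = AMap (T1 H v w u) (Cmp (AMap (\<beta> v) \<phi>) a)"
      using td(2)[OF v(1-4), symmetric] v 2[OF v(1,4)] by (simp add: hom_values[OF A] whisker_G[OF A'] 3) }
  { assume v: "v \<in> Ob W" "w \<in> Ob W" "s \<in> Arr (Hom W v w)" "x \<in> Obj (TObj F v)" "a \<in> Obj (fst A)"
    show "Cmp (AMap (\<beta> w) (Cmp (T2 F v w s) x)) a = Cmp (T2 H v w s) (OMap (OMap (\<beta> v) x) a)"
      using td(3)[OF v(1-4), symmetric] v by (simp add: hom_values[OF A] whisker_G[OF A'] 1 4) }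
qed

text \<open>
  A cone with vertex \<open>A\<close> is a family, indexed by the weight, of functors out of \<open>A\<close> and of
  transformations between them. Read with \<open>a\<close> fixed, it gives the transformation
  \<open>\<alpha> a\<close>; read with an arrow \<open>f\<close> of \<open>A\<close> fixed, the modification \<open>\<mu> f\<close>. The functor \<open>h\<close> so obtained
  is a transfer since both its base condition and the pullbacks are tested pointwise.
\<close>

lemma kappa_comp_surj:
  assumes A: "A \<in> Ob CatBaseComp" and b: "two_nat W F (wd.hom A) \<beta>"
  shows "\<exists>h. computability_transfer A limit_ob h \<and> wd.cone_comp limit_ob A \<kappa> h = \<beta>"
proof -
  have A': "category (fst A)" "base_of_computability (fst A) (snd A)" using A by auto
  note v = cone_values[OF A b]
  have bf: "w \<in> Ob W \<Longrightarrow> x \<in> Obj (TObj F w) \<Longrightarrow> is_functor (fst A) (TObj H w) (OMap (\<beta> w) x)" for w x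
    using transfer_functor[OF v(1)] by (simp add: fold_H)
  note bo = functorD[OF bf] and bn = ntD[OF v(2)] and ac = catD[OF A'(1)]
  define \<alpha> where "\<alpha> a = mk_two_nat W F (\<lambda>w x. OMap (OMap (\<beta> w) x) a) (\<lambda>w \<phi>. Cmp (AMap (\<beta> w) \<phi>) a)" for a
  define \<mu> where "\<mu> f = mk_modif W F (\<alpha> (Dom (fst A) f)) (\<alpha> (Cod (fst A) f)) (\<lambda>w x. AMap (OMap (\<beta> w) x) f)" for f
  have \<alpha>: "two_nat W F H (\<alpha> a)" if a: "a \<in> Obj (fst A)" for a
    unfolding \<alpha>_def by (rule two_nat_mk_two_nat[OF W F two_functor_H]) (simp_all add: v bo bn a)
  have \<alpha>v [simp]: "w \<in> Ob W \<Longrightarrow> x \<in> Obj (TObj F w) \<Longrightarrow> OMap (\<alpha> a w) x = OMap (OMap (\<beta> w) x) a"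
     "w \<in> Ob W \<Longrightarrow> \<phi> \<in> Arr (TObj F w) \<Longrightarrow> AMap (\<alpha> a w) \<phi> = Cmp (AMap (\<beta> w) \<phi>) a" for a w x \<phi>
    by (simp_all add: \<alpha>_def)
  have \<mu>: "modification W F H (\<mu> f)" if f: "f \<in> Arr (fst A)" for f
    unfolding \<mu>_def
    by (rule modification_mk_modif[OF W F two_functor_H \<alpha> \<alpha>])
      (simp_all add: f ac bo v db.fc bn(6)[OF _ _ f, symmetric] flip: v(3,4))
  have \<mu>v [simp]: "Src (\<mu> f) = \<alpha> (Dom (fst A) f)" "Tgt (\<mu> f) = \<alpha> (Cod (fst A) f)"
     "w \<in> Ob W \<Longrightarrow> x \<in> Obj (TObj F w) \<Longrightarrow> Cmp (Cmp (\<mu> f) w) x = AMap (OMap (\<beta> w) x) f" for f w x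
    by (simp_all add: \<mu>_def)
  define h where "h = \<lparr>OMap = (\<lambda>a\<in>Obj (fst A). inv_obj (\<alpha> a)), AMap = (\<lambda>f\<in>Arr (fst A). inv_arr (\<mu> f))\<rparr>"
  have i: "a \<in> Obj (fst A) \<Longrightarrow> inv_obj (\<alpha> a) \<in> Obj L" "f \<in> Arr (fst A) \<Longrightarrow> inv_arr (\<mu> f) \<in> Arr L"
    "a \<in> Obj (fst A) \<Longrightarrow> OMap D (inv_obj (\<alpha> a)) = \<alpha> a" "f \<in> Arr (fst A) \<Longrightarrow> AMap D (inv_arr (\<mu> f)) = \<mu> f"
    "f \<in> Arr (fst A) \<Longrightarrow> Dom L (inv_arr (\<mu> f)) = inv_obj (\<alpha> (Dom (fst A) f))" "f \<in> Arr (fst A) \<Longrightarrow> Cod L (inv_arr (\<mu> f)) = inv_obj (\<alpha> (Cod (fst A) f))"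
    for a f
    using inv_simps(1,2)[of "\<alpha> a"] inv_simps(3,4)[of "\<mu> f"] inv_dom[of "\<mu> f"] \<alpha> \<mu> by simp_all
  have hf: "is_functor (fst A) L h"
  proof -
    have "inv_arr (\<mu> (Ident (fst A) a)) = Ident L (inv_obj (\<alpha> a))" if a: "a \<in> Obj (fst A)" for a
      by (rule kappa_jointly_faithful) (simp_all add: a i ac lc bo D')
    moreover have "inv_arr (\<mu> (Comp (fst A) g f)) = Comp L (inv_arr (\<mu> g)) (inv_arr (\<mu> f))"
      if "f \<in> Arr (fst A)" "g \<in> Arr (fst A)" "Cod (fst A) f = Dom (fst A) g" for f g
      by (rule kappa_jointly_faithful) (simp_all add: that i ac lc bo D')
    ultimately show ?thesis unfolding is_functor_def h_def by (simp add: i ac)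
  qed
  have hv: "a \<in> Obj (fst A) \<Longrightarrow> OMap D (OMap h a) = \<alpha> a" "f \<in> Arr (fst A) \<Longrightarrow> AMap D (AMap h f) = \<mu> f" for a f
    by (simp_all add: h_def i)
  note hfd = functorD[OF hf]
  have ht: "computability_transfer A limit_ob h"
    unfolding computability_transfer_def
  proof (intro conjI ballI allI impI)
    show "is_functor (fst A) (fst limit_ob) h" using hf by simp
    have ba: "k \<in> Arr (fst A)" "Cod (fst A) k = a" if "a \<in> Obj (fst A)" "k \<in> snd A a" for a k
      using A'(2) that unfolding base_of_computability_def is_mono_def by blast+
    have 1: "\<mu> k \<in> db.lim_base (\<alpha> a)" if "a \<in> Obj (fst A)" "k \<in> snd A a" for a k
      using v(1) that ba[OF that] \<mu> unfolding db.lim_base_def computability_transfer_def by auto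
    show "AMap h k \<in> snd limit_ob (OMap h a)" if "a \<in> Obj (fst A)" "k \<in> snd A a" for a k
      using 1[OF that] that ba[OF that] by (simp add: limit_ob_def hv hfd)
    fix b j f p q assume j: "b \<in> Obj (fst A)" "j \<in> snd A b" and pb: "is_pullback (fst A) j f p q"
    note p = pullbackD[OF pb]
    have pbw: "is_pullback (TObj H w) (Cmp (Cmp (\<mu> j) w) x) (Cmp (Cmp (\<mu> f) w) x) (Cmp (Cmp (\<mu> p) w) x) (Cmp (Cmp (\<mu> q) w) x)"
      if "w \<in> Ob W" "x \<in> Obj (TObj F w)" for w x
      using v(1)[OF that] j pb that unfolding computability_transfer_def by (simp add: fold_H)
    have "is_pullback (two_nat_cat W F H) (\<mu> j) (\<mu> f) (\<mu> p) (\<mu> q)"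
      by (rule db.pullback_if_pointwise[OF _ _ _ _ _ _ _ _ pbw]) (simp_all add: p \<mu>)
    then show "is_pullback (fst limit_ob) (AMap h j) (AMap h f) (AMap h p) (AMap h q)"
      using pullback_iff[of "AMap h j" "AMap h f" "AMap h p" "AMap h q"] p by (simp add: hv hfd)
  qed
  have "wd.cone_comp limit_ob A \<kappa> h = \<beta>"
  proof (rule two_nat_eqI[OF W F wd.hom[OF A] _ b])
    show cone: "two_nat W F (wd.hom A) (wd.cone_comp limit_ob A \<kappa> h)"
      using wd.two_nat_cone_comp[OF limit_ob_in_Ob A cone_kappa] ht by simp
    note cv = cone_values[OF A cone] and kv = kappa_comp_values[OF A ht]
    show o: "OMap (wd.cone_comp limit_ob A \<kappa> h w) x = OMap (\<beta> w) x" if "w \<in> Ob W" "x \<in> Obj (TObj F w)" for w x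
      by (rule functor_eqI[OF transfer_functor[OF cv(1)] bf]) (simp_all only: kv that hv, simp_all add: that)
    show "AMap (wd.cone_comp limit_ob A \<kappa> h w) \<phi> = AMap (\<beta> w) \<phi>" if "w \<in> Ob W" "\<phi> \<in> Arr (TObj F w)" for w \<phi>
      by (rule nt_eqI[OF cv(2) v(2)]) (simp_all only: that cv(3,4) v(3,4) o db.fc kv hv, simp_all add: that)
  qed
  with ht show ?thesis by blast
qed

lemma modification_component:
  assumes A: "A \<in> Ob CatBaseComp" and m: "modification W F (wd.hom A) m" and w: "w \<in> Ob W" "x \<in> Obj (TObj F w)"
  shows "Cmp (Cmp m w) x \<in> Arr (transfer_cat A (TObj G w))"
    and "Src (Cmp (Cmp m w) x) = OMap (Src m w) x"
    and "Tgt (Cmp (Cmp m w) x) = OMap (Tgt m w) x"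
    and "is_nt (fst A) (TObj H w) (Cmp (Cmp m w) x)"
  using ntD(3-5)[OF modificationD(4)[OF W F wd.hom[OF A] m w(1)] w(2)] modificationD(5,6)[OF W F wd.hom[OF A] m w(1)]
  by (simp_all add: fold_H)

text \<open>
  Exchanging the order of evaluation as for 1-cells: fixing an object \<open>a\<close> of the vertex in a modification of cones
  leaves a modification \<open>\<nu> a\<close> between the transformations \<open>h a\<close> and \<open>k a\<close>, that is, an arrow of the limit.
\<close>

lemma kappa_comp2_surj:
  assumes A: "A \<in> Ob CatBaseComp" and m: "modification W F (wd.hom A) m"
  shows "\<exists>t\<in>Arr (transfer_cat A limit_ob). wd.cone_comp2 limit_ob A \<kappa> t = m"
proof -
  have A': "category (fst A)" using A by auto
  note ac = catD[OF A']
  note md = modificationD[OF W F wd.hom[OF A] m]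
  obtain h k where h: "computability_transfer A limit_ob h" "wd.cone_comp limit_ob A \<kappa> h = Src m"
    and k: "computability_transfer A limit_ob k" "wd.cone_comp limit_ob A \<kappa> k = Tgt m"
    using kappa_comp_surj[OF A] md(1,2) by metis
  note hf = functorD[OF functor_into_L[OF h(1)]] and kf = functorD[OF functor_into_L[OF k(1)]]
  note hv = kappa_comp_values[OF A h(1), unfolded h(2)] and kv = kappa_comp_values[OF A k(1), unfolded k(2)]
  note mt = modification_component(1-3)[OF A m] and mn = modification_component(4)[OF A m]
  note mnd = ntD[OF mn]
  have nat: "Comp (TObj H w) (Cmp (Cmp (Cmp m w) (Cod (TObj F w) \<phi>)) a) (Cmp (AMap (Src m w) \<phi>) a) =
      Comp (TObj H w) (Cmp (AMap (Tgt m w) \<phi>) a) (Cmp (Cmp (Cmp m w) (Dom (TObj F w) \<phi>)) a)"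
    if w: "w \<in> Ob W" "\<phi> \<in> Arr (TObj F w)" and a: "a \<in> Obj (fst A)" for w \<phi> a
    using arg_cong[OF ntD(6)[OF md(4)[OF w(1)] w(2)], of "\<lambda>t. Cmp t a"] a w by (simp add: md(5,6) fold_H)
  have wt: "AMap (T1 H v w u) (Cmp (Cmp (Cmp m v) x) a) = Cmp (Cmp (Cmp m w) (OMap (T1 F v w u) x)) a"
    if v: "v \<in> Ob W" "w \<in> Ob W" "u \<in> Obj (Hom W v w)" "x \<in> Obj (TObj F v)" "a \<in> Obj (fst A)" for v w u x a
    using arg_cong[OF md(7)[OF v(1-4)], of "\<lambda>t. Cmp t a"] v mt(1)[OF v(1,4)] mn[OF v(1,4)]
    by (simp add: hom_values[OF A] whisker_G[OF A'])
  define \<nu> where "\<nu> a = mk_modif W F (OMap D (OMap h a)) (OMap D (OMap k a)) (\<lambda>w x. Cmp (Cmp (Cmp m w) x) a)" for a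
  have \<nu>: "modification W F H (\<nu> a)" if a: "a \<in> Obj (fst A)" for a
    unfolding \<nu>_def
    by (rule modification_mk_modif[OF W F two_functor_H D_obj_two_nat D_obj_two_nat])
      (simp_all add: a hf kf mnd mt wt nat db.fc flip: hv kv)
  have \<nu>v [simp]: "Src (\<nu> a) = OMap D (OMap h a)" "Tgt (\<nu> a) = OMap D (OMap k a)"
     "w \<in> Ob W \<Longrightarrow> x \<in> Obj (TObj F w) \<Longrightarrow> Cmp (Cmp (\<nu> a) w) x = Cmp (Cmp (Cmp m w) x) a" for a w x
    by (simp_all add: \<nu>_def)
  have i: "inv_arr (\<nu> a) \<in> Arr L" "AMap D (inv_arr (\<nu> a)) = \<nu> a" "Dom L (inv_arr (\<nu> a)) = OMap h a" "Cod L (inv_arr (\<nu> a)) = OMap k a"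
    if "a \<in> Obj (fst A)" for a
    using inv_simps(3,4)[of "\<nu> a"] inv_dom[of "\<nu> a"] \<nu>[OF that] inv_simps(5)[OF hf(1)[OF that]] inv_simps(5)[OF kf(1)[OF that]]
    by simp_all
  define t where "t = \<lparr>Src = h, Tgt = k, Cmp = (\<lambda>a\<in>Obj (fst A). inv_arr (\<nu> a))\<rparr>"
  have "is_nt (fst A) L t"
  proof -
    have "Comp L (inv_arr (\<nu> (Cod (fst A) f))) (AMap h f) = Comp L (AMap k f) (inv_arr (\<nu> (Dom (fst A) f)))"
      if f: "f \<in> Arr (fst A)" for f
    proof (rule kappa_jointly_faithful)
      fix w x assume w: "w \<in> Ob W" "x \<in> Obj (TObj F w)"
      show "Cmp (Cmp (AMap D (Comp L (inv_arr (\<nu> (Cod (fst A) f))) (AMap h f))) w) x =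
        Cmp (Cmp (AMap D (Comp L (AMap k f) (inv_arr (\<nu> (Dom (fst A) f))))) w) x"
        using mnd(6)[OF w f] w f by (simp add: D' i hf kf ac mt hv kv)
    qed (simp_all add: f i hf kf ac lc)
    then show ?thesis
      unfolding is_nt_def t_def using functor_into_L[OF h(1)] functor_into_L[OF k(1)] by (simp add: i ac)
  qed
  then have t: "t \<in> Arr (transfer_cat A limit_ob)" using h k by (simp add: t_def)
  have "wd.cone_comp2 limit_ob A \<kappa> t = m"
  proof (rule modification_eqI[OF W F wd.hom[OF A] _ m])
    show tm: "modification W F (wd.hom A) (wd.cone_comp2 limit_ob A \<kappa> t)"
      using wd.modification_cone_comp2[OF limit_ob_in_Ob A cone_kappa] t by simp
    note cd = modificationD[OF W F wd.hom[OF A] tm]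
    show st: "Src (wd.cone_comp2 limit_ob A \<kappa> t) = Src m" "Tgt (wd.cone_comp2 limit_ob A \<kappa> t) = Tgt m"
      by (simp_all add: t_def h k)
    fix w x assume w: "w \<in> Ob W" "x \<in> Obj (TObj F w)"
    note c = modification_component[OF A tm w, unfolded st]
    show "Cmp (Cmp (wd.cone_comp2 limit_ob A \<kappa> t) w) x = Cmp (Cmp m w) x"
    proof (rule nt_eqI[OF c(4) mn[OF w]])
      fix a assume a: "a \<in> Obj (fst A)"
      show "Cmp (Cmp (Cmp (wd.cone_comp2 limit_ob A \<kappa> t) w) x) a = Cmp (Cmp (Cmp m w) x) a"
        unfolding kappa_comp2_values[OF A t w a] using w a by (simp add: t_def i)
    qed (simp_all only: c(2,3) mt(2,3)[OF w])
  qed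
  with t show ?thesis by blast
qed

lemma limit_ob_is_weighted_limit: "is_weighted_limit CatBaseComp W F G limit_ob (restrict (wd.yoneda limit_ob \<kappa>) (Ob CatBaseComp))"
proof (rule wd.weighted_limitI[OF limit_ob_in_Ob cone_kappa])
  fix A :: "'u cat_base" assume A: "A \<in> Ob CatBaseComp"
  show "bij_betw (wd.cone_comp limit_ob A \<kappa>) (Obj (Hom CatBaseComp A limit_ob)) {\<alpha>. two_nat W F (wd.hom A) \<alpha>}"
    unfolding bij_betw_def
    using kappa_comp_inj[OF A] wd.two_nat_cone_comp[OF limit_ob_in_Ob A cone_kappa] kappa_comp_surj[OF A] by fastforce
  show "bij_betw (wd.cone_comp2 limit_ob A \<kappa>) (Arr (Hom CatBaseComp A limit_ob)) {m. modification W F (wd.hom A) m}"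
    unfolding bij_betw_def
    using kappa_comp2_inj[OF A] wd.modification_cone_comp2[OF limit_ob_in_Ob A cone_kappa] kappa_comp2_surj[OF A] by fastforce
qed

end

theorem theorem3p8:
  fixes W :: "('w, 'x, 'y) two_cat"
    and F :: "('w, 'x, 'y, 'p, 'b) cat_valued"
  assumes "infinite (UNIV :: 'u set)"
    and "pie_weight TYPE('u) W F"
  shows "has_weighted_limits
    (CatBaseComp :: ('u cat_base, ('u, 'u, 'u, 'u) functr, ('u, 'u, 'u, 'u) nt) two_cat) W F"
  unfolding has_weighted_limits_def
proof (intro allI impI)
  fix G :: "('w, 'x, 'y, 'u cat_base, ('u, 'u, 'u, 'u) functr, ('u, 'u, 'u, 'u) nt) two_functr"
  assume G: "two_functor W CatBaseComp G"
  have W: "two_category W" and sW: "small_two_cat TYPE('u) W" and FC: "two_functor W (Cat TYPE('u)) F"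
    and pie: "coproduct_of_representables W (\<lambda>w. Obj (TObj F w)) (\<lambda>v w u. OMap (T1 F v w u))"
    using assms(2) unfolding pie_weight_def by simp_all
  interpret diagram_of_transfers W F G
    using W two_functor_CatD[OF FC] G pie by unfold_locales
  have "small_cat TYPE('u) (TObj F w)" if "w \<in> Ob W" for w
    using two_functorD(1)[OF FC that] by (simp add: Cat_def)
  moreover have "small TYPE('u) (Ob W)" using sW by (simp add: small_two_cat_def)
  ultimately obtain c d where "inj_on (c :: _ \<Rightarrow> 'u) (Obj (two_nat_cat W F H))" "inj_on (d :: _ \<Rightarrow> 'u) (Arr (two_nat_cat W F H))"
    using two_nat_cat_codes[OF W F two_functor_H assms(1)] by metis
  then obtain L :: "('u, 'u) cat" and D where "category L" "is_functor L (two_nat_cat W F H) D"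
    "bij_betw (OMap D) (Obj L) (Obj (two_nat_cat W F H))" "bij_betw (AMap D) (Arr L) (Arr (two_nat_cat W F H))"
    using category_copy[OF db.catL] by metis
  then interpret coded_limit W F G L D
    using db.catL by unfold_locales
  show "\<exists>L \<phi>. is_weighted_limit CatBaseComp W F G L \<phi>"
    using limit_ob_is_weighted_limit by blast
qed

end
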